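(* Let $s\in(0,\tfrac12)$ and $\mu\in\{-1,1\}$. There exists $\varepsilon_0>0$ such that for every $\varepsilon\in(0,\varepsilon_0)$ there exist global solutions $u_1^\varepsilon,u_2^\varepsilon\in C(\mathbb{R};H^\sigma(\mathbb{R}))$ (for every $\sigma>\tfrac12$) of the cubic nonlinear half-wave equation $$i\partial_t u-|D|u=\mu|u|^2u,\qquad (t,x)\in\mathbb{R}\times\mathbb{R},$$ such that $\|u_1^\varepsilon(0)\|_{H^s}\lesssim 1$, $\|u_2^\varepsilon(0)\|_{H^s}\lesssim 1$ uniformly in $\varepsilon$, $$\lim_{\varepsilon\to0}\|u_1^\varepsilon(0)-u_2^\varepsilon(0)\|_{H^s}=0,$$ and $$\liminf_{\varepsilon\to0}\|u_1^\varepsilon-u_2^\varepsilon\|_{L^\infty([0,T];H^s)}\gtrsim 1\quad\text{for all }T>0.$$ In particular, the solution map of this equation fails to be uniformly continuous on bounded subsets of $H^s(\mathbb{R})$.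
   Context: $|D|$ is the Fourier multiplier with symbol $|\xi|$, i.e. $\widehat{|D|f}(\xi)=|\xi|\widehat f(\xi)$, where $\widehat f(\xi)=\int_{\mathbb{R}}e^{-ix\xi}f(x)\,dx$. The Sobolev norm is $\|f\|_{H^s}=\frac{1}{\sqrt{2\pi}}\big(\int\langle\xi\rangle^{2s}|\widehat f(\xi)|^2d\xi\big)^{1/2}$ with $\langle\xi\rangle=\sqrt{1+\xi^2}$. Implicit constants in $\lesssim$ are independent of $\varepsilon$ (they may depend on $s$). *)

theory Defs
  imports "HOL-Analysis.Analysis"
begin

definition L2 :: "(real \<Rightarrow> complex) \<Rightarrow> bool" where
  "L2 f \<longleftrightarrow> f \<in> borel_measurable lborel \<and>
     (\<integral>\<^sup>+ x. ennreal ((cmod (f x))\<^sup>2) \<partial>lborel) < \<infinity>"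

definition is_fourier :: "(real \<Rightarrow> complex) \<Rightarrow> (real \<Rightarrow> complex) \<Rightarrow> bool" where
  "is_fourier f g \<longleftrightarrow> L2 f \<and> L2 g \<and>
     ((\<lambda>R. \<integral>\<^sup>+ \<xi>. ennreal ((cmod (g \<xi> -
         (LINT x:{-R..R}|lborel. cis (-(x * \<xi>)) * f x)))\<^sup>2) \<partial>lborel)
       \<longlongrightarrow> 0) at_top"

definition fourier :: "(real \<Rightarrow> complex) \<Rightarrow> real \<Rightarrow> complex" where
  "fourier f = (SOME g. is_fourier f g)"

definition jbr :: "real \<Rightarrow> real" where
  "jbr \<xi> = sqrt (1 + \<xi>\<^sup>2)"

definition in_Hs :: "real \<Rightarrow> (real \<Rightarrow> complex) \<Rightarrow> bool" where
  "in_Hs s f \<longleftrightarrow> L2 f \<and>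
     (\<integral>\<^sup>+ \<xi>. ennreal (jbr \<xi> powr (2 * s) * (cmod (fourier f \<xi>))\<^sup>2) \<partial>lborel) < \<infinity>"

definition Hs_norm :: "real \<Rightarrow> (real \<Rightarrow> complex) \<Rightarrow> real" where
  "Hs_norm s f = (1 / sqrt (2 * pi)) *
     sqrt (enn2real (\<integral>\<^sup>+ \<xi>. ennreal (jbr \<xi> powr (2 * s) * (cmod (fourier f \<xi>))\<^sup>2) \<partial>lborel))"

text \<open>Fourier transform (in x) of the nonlinearity |u(t)|^2 u(t), an L1 function.\<close>
definition nonlin_hat :: "(real \<Rightarrow> real \<Rightarrow> complex) \<Rightarrow> real \<Rightarrow> real \<Rightarrow> complex" where
  "nonlin_hat u \<tau> \<xi> = (LINT x|lborel. cis (-(x * \<xi>)) * (complex_of_real ((cmod (u \<tau> x))\<^sup>2) * u \<tau> x))"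

text \<open>u is a global solution in C(R; H^sigma) for every sigma > 1/2 of
  i u_t - |D| u = mu |u|^2 u, in the mild (Duhamel) sense written on the Fourier side:
  hat u(t,xi) = e^(-it|xi|) hat u(0,xi) - i mu int_0^t e^(-i(t-tau)|xi|) hat(|u|^2u)(tau,xi) dtau
  for a.e. xi, for every t.\<close>
definition half_wave_global_solution :: "real \<Rightarrow> (real \<Rightarrow> real \<Rightarrow> complex) \<Rightarrow> bool" where
  "half_wave_global_solution \<mu> u \<longleftrightarrow>
     (\<forall>\<sigma>>1/2. (\<forall>t. in_Hs \<sigma> (u t)) \<and>
        (\<forall>t0. ((\<lambda>t. Hs_norm \<sigma> (\<lambda>x. u t x - u t0 x)) \<longlongrightarrow> 0) (at t0))) \<and>
     (\<forall>\<tau>. integrable lborel (\<lambda>x. complex_of_real ((cmod (u \<tau> x))\<^sup>2) * u \<tau> x)) \<and>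
     (\<forall>t. AE \<xi> in lborel.
        interval_lebesgue_integrable lborel 0 (ereal t)
          (\<lambda>\<tau>. cis (-((t - \<tau>) * \<bar>\<xi>\<bar>)) * nonlin_hat u \<tau> \<xi>) \<and>
        fourier (u t) \<xi> =
          cis (-(t * \<bar>\<xi>\<bar>)) * fourier (u 0) \<xi>
          - \<i> * complex_of_real \<mu> *
            (LBINT \<tau>=0..t. cis (-((t - \<tau>) * \<bar>\<xi>\<bar>)) * nonlin_hat u \<tau> \<xi>))"

end

theory Submission
  imports Defs "HOL-Probability.Probability"
begin

text \<open>
Write \<open>u(t) = \<integral> v(t, \<xi>) exp(i x \<xi>) d\<xi>\<close>, so that the equation becomes \<open>i v' = \<bar>\<xi>\<bar> v + \<mu> v * v~ * v\<close>, with
convolution powers on the Fourier side. Here \<open>v\<close> lives in spaces of continuous functions of decay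
\<open>(1 + \<bar>\<xi>\<bar>) ^ -k\<close>, where the cubic term is tame: its weighted norm is bounded by the weighted norm of \<open>v\<close> times
the squared \<open>L1\<close> norm. Mass and energy are conserved, and for small mass they control \<open>H^(1/2)\<close> also in the focusing case;
a logarithmic Brezis--Gallouet bound for the \<open>L1\<close> norm and Osgood's lemma then give global solutions.

Instability: at frequency \<open>N\<close> the operator \<open>\<bar>D\<bar>\<close> acts as \<open>D\<close> up to the negligible negative
frequencies, so wave packets \<open>A exp(iNx) \<phi>(x/\<delta>)\<close> follow \<open>A exp(iN(x-t)) \<phi> exp(-i \<mu> t A^2 \<bar>\<phi>\<bar>^2)\<close> with
\<open>\<phi>\<close> evaluated at \<open>(x-t)/\<delta>\<close>. With \<open>A = 1/\<epsilon>\<close> and \<open>\<delta>\<close> normalised by the \<open>Hs\<close> norm,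
packets of relative amplitude 1 and \<open>1 + \<epsilon>\<close> are out of phase at time \<open>\<epsilon>\<close>, provided \<open>N\<close> is large enough
depending on \<open>\<epsilon>\<close>; the condition \<open>s < 1/2\<close> ensures that \<open>N \<delta>\<close> tends to infinity.
\<close>

section \<open>Weighted decay and convolution\<close>

text \<open>The rescaled time needed for dephasing is 1 / \<epsilon>, so the error between packet
  and approximate profile grows like exp (L / \<epsilon>). The order of choices rescues the
  argument: \<epsilon> is fixed, all bounds on the profiles become constants, and only then N tends
  to infinity, where the coupling to negative frequencies decays faster than any power of N times
  the packet width. No explicit rate linking N to \<epsilon> appears. The large amplitude does not
  endanger global existence. The packets are so narrow that their mass is of order
  \<open>N powr (- 2 * s)\<close>, and s > 0 brings it below the threshold 1 / 8 that the focusing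
  case uses. Pointwise decay of continuous functions makes the equation an ordinary differential
  equation at each frequency, and every differentiation under an integral is dominated by a multiple
  of 1 / J^2. The notion of solution refers to \<open>fourier\<close>, an arbitrary representative
  of an L2 class, so identities proved at every frequency reach it through \<open>invF\<close> and
  hold almost everywhere.\<close>

definition J :: "real \<Rightarrow> real" where "J x = 1 + \<bar>x\<bar>"

definition decay :: "nat \<Rightarrow> real \<Rightarrow> (real \<Rightarrow> complex) \<Rightarrow> bool" where
  "decay k C f \<longleftrightarrow> (\<forall>x. cmod (f x) \<le> C / J x ^ k)"

definition conv :: "(real \<Rightarrow> complex) \<Rightarrow> (real \<Rightarrow> complex) \<Rightarrow> real \<Rightarrow> complex" where
  "conv f g \<xi> = (LINT \<eta>|lborel. f \<eta> * g (\<xi> - \<eta>))"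

text \<open>Fourier-side form of pointwise complex conjugation (\<open>invF_flip\<close>); with it
  \<open>cubic\<close> corresponds to |u|^2 u without any constant
  (\<open>invF_cubic\<close>).\<close>

definition flip :: "(real \<Rightarrow> complex) \<Rightarrow> real \<Rightarrow> complex" where
  "flip f \<xi> = cnj (f (-\<xi>))"

definition cubic :: "(real \<Rightarrow> complex) \<Rightarrow> real \<Rightarrow> complex" where
  "cubic f = conv (conv f (flip f)) f"

definition L1norm :: "(real \<Rightarrow> complex) \<Rightarrow> real" where
  "L1norm f = (LINT x|lborel. cmod (f x))"

lemma J_ge1 [simp]: "1 \<le> J x" and J_pos [simp]: "0 < J x" and J_nonneg [simp]: "0 \<le> J x"
  and J_nonzero [simp]: "J x \<noteq> 0"
  by (auto simp: J_def)

lemma J_minus [simp]: "J (- x) = J x"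
  by (simp add: J_def)

lemma continuous_on_J [continuous_intros]: "continuous_on S f \<Longrightarrow> continuous_on S (\<lambda>x. J (f x))"
  unfolding J_def by (intro continuous_intros)

lemma J_measurable [measurable]: "J \<in> borel_measurable borel"
  unfolding J_def by measurable

lemma J_power_ge1 [simp]: "1 \<le> J x ^ k"
  by simp

lemma decay_nonneg: assumes "decay k C f" shows "0 \<le> C"
proof -
  have "cmod (f 0) \<le> C" using assms unfolding decay_def J_def by (drule_tac spec[of _ 0]) simp
  then show ?thesis using norm_ge_zero order_trans by blast
qed

lemma decay_mono: assumes "decay k C f" "j \<le> k" "C \<le> D" shows "decay j D f"
  unfolding decay_def
proof
  fix x
  have "cmod (f x) \<le> C / J x ^ k" using assms by (simp add: decay_def)
  also have "\<dots> \<le> D / J x ^ j"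
    using decay_nonneg[OF assms(1)] assms by (intro frac_le power_increasing) auto
  finally show "cmod (f x) \<le> D / J x ^ j" .
qed

lemma decay_bounded: "decay k C f \<Longrightarrow> cmod (f x) \<le> C"
  using decay_mono[of k C f 0 C] by (simp add: decay_def)

lemma decay_flip [simp]: "decay k C (flip f) \<longleftrightarrow> decay k C f"
  unfolding decay_def flip_def by (metis J_minus complex_mod_cnj minus_minus)

lemma decay_add: "decay k C f \<Longrightarrow> decay k D g \<Longrightarrow> decay k (C + D) (\<lambda>x. f x + g x)"
  unfolding decay_def add_divide_distrib
  by (meson add_mono norm_triangle_ineq order_trans)

lemma decay_diff: "decay k C f \<Longrightarrow> decay k D g \<Longrightarrow> decay k (C + D) (\<lambda>x. f x - g x)"
  unfolding decay_def add_divide_distrib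
  by (meson add_mono norm_triangle_ineq4 order_trans)

lemma decay_cmult: assumes "decay k C f" shows "decay k (cmod a * C) (\<lambda>x. a * f x)"
  using assms mult_left_mono[of "cmod (f _)" "C / _" "cmod a"] unfolding decay_def by (simp add: norm_mult)

lemma decay_phase: "decay k C (\<lambda>x. cis (h x) * f x) \<longleftrightarrow> decay k C f"
  by (simp add: decay_def norm_mult)

lemma continuous_flip [continuous_intros]: "continuous_on UNIV f \<Longrightarrow> continuous_on UNIV (flip f)"
  unfolding flip_def by (rule continuous_on_cnj, rule continuous_on_compose2[of UNIV f]) (auto intro: continuous_intros)

lemma flip_flip [simp]: "flip (flip f) = f"
  by (simp add: flip_def fun_eq_iff)

section \<open>Integrals of explicit even weights\<close>

lemma nn_integral_even_FTC:
  fixes g :: "real \<Rightarrow> real"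
  assumes [measurable]: "g \<in> borel_measurable borel"
    and F: "\<And>x. 0 \<le> x \<Longrightarrow> DERIV F x :> g x" and nn: "\<And>x. 0 \<le> x \<Longrightarrow> 0 \<le> g x"
    and lim: "(F \<longlongrightarrow> T) at_top"
  shows "(\<integral>\<^sup>+x. ennreal (g \<bar>x\<bar>) \<partial>lborel) = ennreal (2 * (T - F 0))"
proof -
  have half: "(\<integral>\<^sup>+x. ennreal (g x) * indicator {0..} x \<partial>lborel) = ennreal (T - F 0)"
    by (rule nn_integral_FTC_atLeast[where F=F]) (use assms in auto)
  \<comment> \<open>\<open>ennreal\<close> sends negative numbers to 0, so the two equal halves can
    be added only once this difference is known to be nonnegative.\<close>
  have mono: "F 0 \<le> T"
  proof (rule tendsto_lowerbound[OF lim])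
    show "\<forall>\<^sub>F x in at_top. F 0 \<le> F x"
      using eventually_ge_at_top[of 0]
    proof eventually_elim
      fix x :: real assume "0 \<le> x"
      then show "F 0 \<le> F x" by (rule DERIV_nonneg_imp_nondecreasing) (metis F nn)
    qed
  qed auto
  have "(\<integral>\<^sup>+x. ennreal (g \<bar>x\<bar>) \<partial>lborel) =
     (\<integral>\<^sup>+x. ennreal (g x) * indicator {0..} x + ennreal (g (- x)) * indicator {..<0} x \<partial>lborel)"
    by (intro nn_integral_cong) (auto simp: indicator_def)
  also have "\<dots> = (\<integral>\<^sup>+x. ennreal (g x) * indicator {0..} x \<partial>lborel)
      + (\<integral>\<^sup>+x. ennreal (g (- x)) * indicator {..<0} x \<partial>lborel)"
    by (rule nn_integral_add) auto
  also have "(\<integral>\<^sup>+x. ennreal (g (- x)) * indicator {..<0} x \<partial>lborel)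
     = (\<integral>\<^sup>+x. ennreal (g x) * indicator {0<..} x \<partial>lborel)"
    by (subst nn_integral_real_affine[where c="-1" and t=0]) (auto intro!: nn_integral_cong simp: indicator_def)
  also have "\<dots> = (\<integral>\<^sup>+x. ennreal (g x) * indicator {0..} x \<partial>lborel)"
    by (intro nn_integral_cong_AE AE_I[where N="{0}"]) (auto simp: indicator_def)
  finally show ?thesis unfolding half using mono ennreal_plus[of "T - F 0" "T - F 0"] by simp
qed

lemma nn_integral_inverse_J2: "(\<integral>\<^sup>+x. ennreal (1 / J x ^ 2) \<partial>lborel) = 2"
proof -
  have "(\<integral>\<^sup>+x. ennreal (1 / (1 + \<bar>x\<bar>) ^ 2) \<partial>lborel) = ennreal (2 * (0 - (- 1 / (1 + 0))))"
    by (rule nn_integral_even_FTC[where F="\<lambda>x. - 1 / (1 + x)"])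
       (auto intro!: derivative_eq_intros simp: field_simps power2_eq_square, real_asymp)
  then show ?thesis by (simp add: J_def)
qed

lemma integrable_inverse_J2 [simp]: "integrable lborel (\<lambda>x. C / J x ^ 2)"
  and LINT_inverse_J2 [simp]: "(LINT x|lborel. C / J x ^ 2) = 2 * C"
proof -
  have *: "has_bochner_integral lborel (\<lambda>x. 1 / J x ^ 2) 2"
    by (rule has_bochner_integral_nn_integral) (use nn_integral_inverse_J2 in auto)
  show "integrable lborel (\<lambda>x. C / J x ^ 2)" "(LINT x|lborel. C / J x ^ 2) = 2 * C"
    using has_bochner_integral_mult_right[of C lborel "\<lambda>x. 1 / J x ^ 2" 2] * by (auto simp: has_bochner_integral_iff)
qed

lemma integrable_inverse_J: "2 \<le> k \<Longrightarrow> integrable lborel (\<lambda>x. C / J x ^ k)"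
  by (rule Bochner_Integration.integrable_bound[OF integrable_inverse_J2[of C]])
     (auto intro!: frac_le power_increasing)

section \<open>Continuity and differentiation of parameter integrals\<close>

lemma integrable_norm_le:
  fixes f :: "'a \<Rightarrow> 'b::{banach, second_countable_topology}"
  assumes "integrable M g" "f \<in> borel_measurable M" "\<And>x. norm (f x) \<le> g x"
  shows "integrable M f"
  by (rule Bochner_Integration.integrable_bound[OF assms(1,2)], rule AE_I2)
     (metis assms(3) abs_ge_self order_trans real_norm_def)

lemma continuous_borel: "continuous_on UNIV f \<Longrightarrow> f \<in> borel_measurable borel"
  for f :: "'a::topological_space \<Rightarrow> 'b::topological_space"
  by (rule borel_measurable_continuous_onI)

lemma decay_integrable:
  assumes "f \<in> borel_measurable borel" "decay k C f" "2 \<le> k"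
  shows "integrable lborel f" and "L1norm f \<le> 2 * C" and "0 \<le> L1norm f"
proof -
  have C: "\<bar>C\<bar> = C" using decay_nonneg[OF assms(2)] by simp
  have d: "cmod (f x) \<le> C / J x ^ 2" for x
    using decay_mono[OF assms(2,3) order_refl] by (simp add: decay_def)
  show i: "integrable lborel f"
    by (rule Bochner_Integration.integrable_bound[OF integrable_inverse_J2[of C]]) (use assms d C in auto)
  have "(LINT x|lborel. cmod (f x)) \<le> (LINT x|lborel. C / J x ^ 2)"
    by (rule integral_mono) (use i d in auto)
  then show "L1norm f \<le> 2 * C" by (simp add: L1norm_def)
  show "0 \<le> L1norm f" unfolding L1norm_def by simp
qed

text \<open>The dominating function may depend on a ball around the parameter, because the decay
  constants of a flow are uniform only on bounded time intervals.\<close>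

lemma continuous_on_LINT_dominated:
  fixes F :: "'a::metric_space \<Rightarrow> 'b \<Rightarrow> 'c::{banach, second_countable_topology}"
  assumes meas: "\<And>x. F x \<in> borel_measurable M"
    and cont: "\<And>\<eta>. continuous_on UNIV (\<lambda>x. F x \<eta>)"
    and dom: "\<And>x. \<exists>e>0. \<exists>g. integrable M g \<and> (\<forall>y\<in>ball x e. \<forall>\<eta>. norm (F y \<eta>) \<le> g \<eta>)"
  shows "continuous_on UNIV (\<lambda>x. LINT \<eta>|M. F x \<eta>)"
proof (rule continuous_on_sequentiallyI)
  fix u a assume u: "u \<longlonglongrightarrow> (a::'a)"
  obtain e g where e: "e > 0" "integrable M g" "\<And>y \<eta>. y \<in> ball a e \<Longrightarrow> norm (F y \<eta>) \<le> g \<eta>"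
    using dom[of a] by blast
  from u e(1) obtain N where N: "\<And>n. n \<ge> N \<Longrightarrow> u n \<in> ball a e"
    by (metis LIMSEQ_iff_nz dist_commute mem_ball metric_LIMSEQ_D)
  show "(\<lambda>n. LINT \<eta>|M. F (u n) \<eta>) \<longlonglongrightarrow> (LINT \<eta>|M. F a \<eta>)"
  proof (rule LIMSEQ_offset[where k=N], rule integral_dominated_convergence[where w=g])
    show "AE \<eta> in M. (\<lambda>n. F (u (n + N)) \<eta>) \<longlonglongrightarrow> F a \<eta>"
    proof (rule AE_I2)
      fix \<eta>
      have "(\<lambda>n. F (u n) \<eta>) \<longlonglongrightarrow> F a \<eta>"
        by (rule continuous_on_tendsto_compose[OF cont[of \<eta>] u]) auto
      then show "(\<lambda>n. F (u (n + N)) \<eta>) \<longlonglongrightarrow> F a \<eta>" by (rule LIMSEQ_ignore_initial_segment)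
    qed
  qed (use meas e N in auto)
qed

text \<open>The mean value inequality turns the bound on the derivative into a bound on all
  difference quotients, to which dominated convergence applies. One-sided derivatives on a convex
  set are used because the evolution is known only on {0..T}.\<close>

lemma has_vector_derivative_LINT:
  fixes f :: "real \<Rightarrow> 'a \<Rightarrow> 'b::{banach, second_countable_topology}"
  assumes S: "convex S" and t0: "t0 \<in> S"
    and int: "\<And>t. t \<in> S \<Longrightarrow> integrable M (f t)"
    and der: "\<And>t x. t \<in> S \<Longrightarrow> ((\<lambda>s. f s x) has_vector_derivative f' t x) (at t within S)"
    and bnd: "\<And>t x. t \<in> S \<Longrightarrow> norm (f' t x) \<le> g x"
    and g: "integrable M g" and meas: "f' t0 \<in> borel_measurable M"
  shows "((\<lambda>t. LINT x|M. f t x) has_vector_derivative (LINT x|M. f' t0 x)) (at t0 within S)"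
proof -
  have f'int: "integrable M (f' t0)"
    by (rule integrable_norm_le[OF g meas bnd[OF t0]])
  have lip: "norm (f t x - f t0 x) \<le> g x * \<bar>t - t0\<bar>" if "t \<in> S" for t x
  proof -
    have "norm (f t x - f t0 x) \<le> g x * norm (t - t0)"
    proof (rule differentiable_bound[OF S])
      show "((\<lambda>s. f s x) has_derivative (\<lambda>h. h *\<^sub>R f' s x)) (at s within S)" if "s \<in> S" for s
        using der[OF that] by (simp add: has_vector_derivative_def)
      show "onorm (\<lambda>h. h *\<^sub>R f' s x) \<le> g x" if "s \<in> S" for s
      proof (rule onorm_le)
        show "norm (h *\<^sub>R f' s x) \<le> g x * norm h" for h
          using mult_left_mono[OF bnd[OF that, of x], of "\<bar>h\<bar>"] by (simp add: mult.commute)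
      qed
    qed (use that t0 in auto)
    then show ?thesis by simp
  qed
  have "((\<lambda>t. norm (((LINT x|M. f t x) - (LINT x|M. f t0 x)) - (t - t0) *\<^sub>R (LINT x|M. f' t0 x)) / norm (t - t0)) \<longlongrightarrow> 0) (at t0 within S)"
    unfolding tendsto_at_iff_sequentially
  proof (intro allI impI)
    fix X assume X: "\<forall>i. X i \<in> S - {t0}" "X \<longlonglongrightarrow> t0"
    define h where "h n x = inverse (X n - t0) *\<^sub>R (f (X n) x - f t0 x)" for n x
    have hlim: "(\<lambda>n. LINT x|M. h n x) \<longlonglongrightarrow> (LINT x|M. f' t0 x)"
    proof (rule integral_dominated_convergence[where w=g])
      show "AE x in M. (\<lambda>n. h n x) \<longlonglongrightarrow> f' t0 x"
      proof (rule AE_I2)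
        fix x
        have "((\<lambda>t. norm ((f t x - f t0 x) - (t - t0) *\<^sub>R f' t0 x) / norm (t - t0)) \<longlongrightarrow> 0) (at t0 within S)"
          using der[OF t0, of x] unfolding has_vector_derivative_def has_derivative_iff_norm by simp
        then have "(\<lambda>n. norm ((f (X n) x - f t0 x) - (X n - t0) *\<^sub>R f' t0 x) / norm (X n - t0)) \<longlonglongrightarrow> 0"
          using X unfolding tendsto_at_iff_sequentially comp_def by blast
        moreover have "norm ((f (X n) x - f t0 x) - (X n - t0) *\<^sub>R f' t0 x) / norm (X n - t0) = norm (h n x - f' t0 x)" for n
        proof -
          have "X n - t0 \<noteq> 0" using X by auto
          then have "h n x - f' t0 x = inverse (X n - t0) *\<^sub>R ((f (X n) x - f t0 x) - (X n - t0) *\<^sub>R f' t0 x)"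
            by (simp add: h_def scaleR_diff_right)
          then show ?thesis by (simp add: divide_inverse mult.commute)
        qed
        ultimately have "(\<lambda>n. norm (h n x - f' t0 x)) \<longlonglongrightarrow> 0" by simp
        then show "(\<lambda>n. h n x) \<longlonglongrightarrow> f' t0 x" by (rule LIM_zero_cancel[OF tendsto_norm_zero_cancel])
      qed
      show "AE x in M. norm (h n x) \<le> g x" for n
      proof (rule AE_I2)
        fix x
        have "X n \<in> S" "\<bar>X n - t0\<bar> > 0" using X by auto
        then have "norm (f (X n) x - f t0 x) / \<bar>X n - t0\<bar> \<le> g x" using lip[of "X n" x]
          by (simp only: pos_divide_le_eq)
        then show "norm (h n x) \<le> g x" by (simp add: h_def divide_inverse mult.commute)
      qed
      show "h n \<in> borel_measurable M" for n
        unfolding h_def using int X t0 by auto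
    qed (use meas g in auto)
    have "(\<lambda>n. norm ((LINT x|M. h n x) - (LINT x|M. f' t0 x))) \<longlonglongrightarrow> 0"
      by (rule tendsto_norm_zero[OF LIM_zero[OF hlim]])
    moreover have "norm ((LINT x|M. h n x) - (LINT x|M. f' t0 x))
       = norm (((LINT x|M. f (X n) x) - (LINT x|M. f t0 x)) - (X n - t0) *\<^sub>R (LINT x|M. f' t0 x)) / norm (X n - t0)" for n
    proof -
      have nz: "X n - t0 \<noteq> 0" using X by auto
      have "(LINT x|M. h n x) = inverse (X n - t0) *\<^sub>R ((LINT x|M. f (X n) x) - (LINT x|M. f t0 x))"
        unfolding h_def using int X t0 by (simp add: Bochner_Integration.integral_diff)
      with nz have "(LINT x|M. h n x) - (LINT x|M. f' t0 x)
         = inverse (X n - t0) *\<^sub>R (((LINT x|M. f (X n) x) - (LINT x|M. f t0 x)) - (X n - t0) *\<^sub>R (LINT x|M. f' t0 x))"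
        by (simp add: scaleR_diff_right)
      then show ?thesis by (simp add: divide_inverse mult.commute)
    qed
    ultimately show "((\<lambda>t. norm (((LINT x|M. f t x) - (LINT x|M. f t0 x)) - (t - t0) *\<^sub>R (LINT x|M. f' t0 x)) / norm (t - t0)) \<circ> X) \<longlonglongrightarrow> 0"
      by (simp add: comp_def)
  qed
  then show ?thesis
    unfolding has_vector_derivative_def has_derivative_iff_norm
    by (auto intro: bounded_linear_scaleR_left)
qed

section \<open>Changes of variables, Fubini and convolution estimates\<close>

lemma LINT_translate: "(LINT y|lborel. g (y - x)) = (LINT y|lborel. g y)"
  for g :: "real \<Rightarrow> 'a::{banach, second_countable_topology}"
  using lborel_integral_real_affine[of 1 g "-x"] by (simp add: algebra_simps)

lemma LINT_reflect: "(LINT y|lborel. g (x - y)) = (LINT y|lborel. g y)"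
  for g :: "real \<Rightarrow> 'a::{banach, second_countable_topology}"
  using lborel_integral_real_affine[of "-1" g x] by simp

lemma integrable_translate: "integrable lborel g \<Longrightarrow> integrable lborel (\<lambda>y. g (y - x))"
  for g :: "real \<Rightarrow> 'a::{banach, second_countable_topology}"
  using lborel_integrable_real_affine[of g 1 "-x"] by (simp add: algebra_simps)

lemma integrable_reflect: "integrable lborel g \<Longrightarrow> integrable lborel (\<lambda>y. g (x - y))"
  for g :: "real \<Rightarrow> 'a::{banach, second_countable_topology}"
  using lborel_integrable_real_affine[of g "-1" x] by simp

lemma integrable_mult_bounded:
  fixes f h :: "'a \<Rightarrow> complex"
  assumes "integrable M f" "h \<in> borel_measurable M" "\<And>x. cmod (h x) \<le> B"
  shows "integrable M (\<lambda>x. f x * h x)"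
proof (rule Bochner_Integration.integrable_bound[where f="\<lambda>x. B * cmod (f x)"])
  show "AE x in M. cmod (f x * h x) \<le> norm (B * cmod (f x))"
  proof (rule AE_I2)
    fix x
    have "cmod (f x * h x) \<le> cmod (f x) * B" using assms(3)[of x] by (simp add: norm_mult mult_left_mono)
    then show "cmod (f x * h x) \<le> norm (B * cmod (f x))" by (simp add: mult.commute)
  qed
qed (use assms in auto)

lemma integrable_pair_shift:
  fixes f g :: "real \<Rightarrow> complex"
  assumes f: "integrable lborel f" and g: "integrable lborel g"
  shows "integrable (lborel \<Otimes>\<^sub>M lborel) (\<lambda>(x, y). f x * g (y - x))"
proof (rule lborel_pair.Fubini_integrable)
  have [measurable]: "f \<in> borel_measurable borel" "g \<in> borel_measurable borel" using f g by auto
  show "(\<lambda>(x, y). f x * g (y - x)) \<in> borel_measurable (lborel \<Otimes>\<^sub>M lborel)" by measurable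
  show "integrable lborel (\<lambda>x. LINT y|lborel. norm (case (x, y) of (x, y) \<Rightarrow> f x * g (y - x)))"
    using f LINT_translate[of "\<lambda>y. cmod (g y)"] by (simp add: norm_mult)
  show "AE x in lborel. integrable lborel (\<lambda>y. case (x, y) of (x, y) \<Rightarrow> f x * g (y - x))"
    using integrable_translate[OF g] by auto
qed

lemma integrable_pair_prod:
  fixes f g :: "real \<Rightarrow> complex"
  assumes f: "integrable lborel f" and g: "integrable lborel g"
  shows "integrable (lborel \<Otimes>\<^sub>M lborel) (\<lambda>(x, y). f x * g y)"
proof (rule lborel_pair.Fubini_integrable)
  have [measurable]: "f \<in> borel_measurable borel" "g \<in> borel_measurable borel" using f g by auto
  show "(\<lambda>(x, y). f x * g y) \<in> borel_measurable (lborel \<Otimes>\<^sub>M lborel)" by measurable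
  show "integrable lborel (\<lambda>x. LINT y|lborel. norm (case (x, y) of (x, y) \<Rightarrow> f x * g y))"
    using f by (simp add: norm_mult)
  show "AE x in lborel. integrable lborel (\<lambda>y. case (x, y) of (x, y) \<Rightarrow> f x * g y)"
    using g by auto
qed

lemma conv_commute: "conv f g = conv g f"
proof
  fix \<xi> show "conv f g \<xi> = conv g f \<xi>"
    unfolding conv_def using LINT_reflect[of "\<lambda>\<eta>. f \<eta> * g (\<xi> - \<eta>)" \<xi>] by (simp add: mult.commute)
qed

lemma flip_conv: "flip (conv f g) = conv (flip f) (flip g)"
proof
  fix \<xi>
  have "conv (flip f) (flip g) \<xi> = (LINT \<eta>|lborel. cnj (f (0 - \<eta>) * g (- \<xi> - (0 - \<eta>))))"
    unfolding conv_def flip_def by (intro Bochner_Integration.integral_cong) (auto simp: algebra_simps)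
  also have "\<dots> = cnj (LINT \<eta>|lborel. f \<eta> * g (- \<xi> - \<eta>))"
    by (subst LINT_reflect[of "\<lambda>\<eta>. cnj (f \<eta> * g (- \<xi> - \<eta>))"]) (rule Bochner_Integration.integral_cnj)
  finally show "flip (conv f g) \<xi> = conv (flip f) (flip g) \<xi>" by (simp add: flip_def conv_def)
qed

text \<open>Young's inequality in L1. Integrability alone is assumed, as it is later applied to
  energy densities for which no continuity or pointwise bound is at hand.\<close>

lemma conv_integrable:
  assumes f: "integrable lborel f" and g: "integrable lborel g"
  shows "integrable lborel (conv f g)" and "L1norm (conv f g) \<le> L1norm f * L1norm g"
proof -
  note I = integrable_pair_shift[OF f g]
  show i: "integrable lborel (conv f g)"
    using lborel_pair.integrable_snd[OF I] by (simp add: conv_def[abs_def])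
  have I': "integrable (lborel \<Otimes>\<^sub>M lborel) (\<lambda>(x, y). cmod (f x * g (y - x)))"
    using integrable_norm[OF I] by (simp add: case_prod_beta')
  have "L1norm (conv f g) \<le> (LINT y|lborel. LINT x|lborel. cmod (f x * g (y - x)))"
    unfolding L1norm_def
  proof (rule integral_mono)
    show "cmod (conv f g y) \<le> (LINT x|lborel. cmod (f x * g (y - x)))" for y
      unfolding conv_def by (rule integral_norm_bound)
  qed (use i lborel_pair.integrable_snd[OF I'] in auto)
  also have "\<dots> = (LINT x|lborel. LINT y|lborel. cmod (f x * g (y - x)))"
    by (rule lborel_pair.Fubini_integral[OF I'])
  also have "\<dots> = L1norm f * L1norm g"
    using LINT_translate[of "\<lambda>y. cmod (g y)"] by (simp add: norm_mult L1norm_def)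
  finally show "L1norm (conv f g) \<le> L1norm f * L1norm g" .
qed

lemma J_triangle: "J \<xi> \<le> 2 * J \<eta> \<or> J \<xi> \<le> 2 * J (\<xi> - \<eta>)"
  unfolding J_def by (auto simp: abs_if)

text \<open>One of the two frequencies \<eta> and \<xi> - \<eta> carries at least half the weight of
  \<xi>; the decay of that factor is used pointwise and the other factor is integrated. The outcome
  is linear in the weighted bounds with only L1 norms as coefficients, the tame form on which the
  global bound rests.\<close>

lemma conv_decay:
  assumes [measurable]: "f \<in> borel_measurable borel" "g \<in> borel_measurable borel"
    and f: "decay k A f" and g: "decay k B g" and k: "2 \<le> k"
  shows "decay k (2 ^ k * (A * L1norm g + B * L1norm f)) (conv f g)"
  unfolding decay_def
proof
  fix \<xi>
  note fi = decay_integrable(1)[OF assms(1) f k] and gi = decay_integrable(1)[OF assms(2) g k]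
  have A: "0 \<le> A" "0 \<le> B" using f g decay_nonneg by auto
  have aux: "C / J \<eta> ^ k \<le> 2 ^ k * C / J \<xi> ^ k" if "0 \<le> C" "J \<xi> \<le> 2 * J \<eta>" for \<eta> C
  proof -
    have "J \<xi> ^ k \<le> 2 ^ k * J \<eta> ^ k" using that power_mono[of "J \<xi>" "2 * J \<eta>" k] by (simp add: power_mult_distrib)
    then show ?thesis using that by (simp add: field_simps mult_left_mono)
  qed
  have le: "cmod (f \<eta> * g (\<xi> - \<eta>)) \<le> 2 ^ k / J \<xi> ^ k * (A * cmod (g (\<xi> - \<eta>)) + B * cmod (f \<eta>))" for \<eta>
    using J_triangle[of \<xi> \<eta>]
  proof
    assume "J \<xi> \<le> 2 * J \<eta>"
    then have "cmod (f \<eta>) \<le> 2 ^ k * A / J \<xi> ^ k" using aux[of A \<eta>] A f unfolding decay_def by (meson order_trans)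
    then have "cmod (f \<eta> * g (\<xi> - \<eta>)) \<le> 2 ^ k * A / J \<xi> ^ k * cmod (g (\<xi> - \<eta>))"
      unfolding norm_mult by (rule mult_right_mono) auto
    moreover have "0 \<le> 2 ^ k / J \<xi> ^ k * (B * cmod (f \<eta>))" using A by simp
    ultimately show ?thesis by (simp add: distrib_left mult.assoc)
  next
    assume "J \<xi> \<le> 2 * J (\<xi> - \<eta>)"
    then have "cmod (g (\<xi> - \<eta>)) \<le> 2 ^ k * B / J \<xi> ^ k" using aux[of B "\<xi> - \<eta>"] A g unfolding decay_def by (meson order_trans)
    then have "cmod (f \<eta> * g (\<xi> - \<eta>)) \<le> cmod (f \<eta>) * (2 ^ k * B / J \<xi> ^ k)"
      unfolding norm_mult by (rule mult_left_mono) auto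
    moreover have "0 \<le> 2 ^ k / J \<xi> ^ k * (A * cmod (g (\<xi> - \<eta>)))" using A by simp
    ultimately show ?thesis by (simp add: distrib_left mult.assoc mult.commute[of "cmod (f \<eta>)"])
  qed
  have "cmod (conv f g \<xi>) \<le> (LINT \<eta>|lborel. cmod (f \<eta> * g (\<xi> - \<eta>)))"
    unfolding conv_def by (rule integral_norm_bound)
  also have "\<dots> \<le> (LINT \<eta>|lborel. 2 ^ k / J \<xi> ^ k * (A * cmod (g (\<xi> - \<eta>)) + B * cmod (f \<eta>)))"
  proof (rule integral_mono)
    show I: "integrable lborel (\<lambda>\<eta>. 2 ^ k / J \<xi> ^ k * (A * cmod (g (\<xi> - \<eta>)) + B * cmod (f \<eta>)))"
      using fi integrable_reflect[OF gi, of \<xi>] by auto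
    show "integrable lborel (\<lambda>\<eta>. cmod (f \<eta> * g (\<xi> - \<eta>)))"
      by (rule integrable_norm_le[OF I]) (use le in auto)
  qed (use le in auto)
  also have "\<dots> = 2 ^ k / J \<xi> ^ k * (A * L1norm g + B * L1norm f)"
  proof -
    have "(LINT \<eta>|lborel. A * cmod (g (\<xi> - \<eta>)) + B * cmod (f \<eta>)) = A * L1norm g + B * L1norm f"
      using fi integrable_reflect[OF gi, of \<xi>] LINT_reflect[of "\<lambda>y. cmod (g y)" \<xi>]
      by (subst Bochner_Integration.integral_add) (auto simp: L1norm_def)
    then show ?thesis by (simp only: integral_mult_right_zero)
  qed
  finally show "cmod (conv f g \<xi>) \<le> 2 ^ k * (A * L1norm g + B * L1norm f) / J \<xi> ^ k" by simp
qed

section \<open>Picard iteration in weighted spaces\<close>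

definition jcont :: "(real \<Rightarrow> real \<Rightarrow> complex) \<Rightarrow> bool" where
  "jcont w \<longleftrightarrow> continuous_on UNIV (\<lambda>(t, \<xi>). w t \<xi>)"

text \<open>The constant may grow with the time horizon, as the a priori bound does; uniformity on
  bounded intervals is enough for all local domination arguments.\<close>

definition ldecay :: "nat \<Rightarrow> (real \<Rightarrow> real \<Rightarrow> complex) \<Rightarrow> bool" where
  "ldecay k w \<longleftrightarrow> (\<forall>T. \<exists>C. \<forall>t. \<bar>t\<bar> \<le> T \<longrightarrow> decay k C (w t))"

lemma jcont_compose:
  assumes "jcont w" "continuous_on S f" "continuous_on S g"
  shows "continuous_on S (\<lambda>x. w (f x) (g x))"
  using continuous_on_compose2[OF assms(1)[unfolded jcont_def] continuous_on_Pair[OF assms(2,3)]] by simp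

lemma jcont_slice: "jcont w \<Longrightarrow> continuous_on S (w t)" "jcont w \<Longrightarrow> continuous_on S (\<lambda>t. w t \<xi>)"
  by (auto intro!: jcont_compose continuous_intros)

lemma jcont_const: "continuous_on UNIV f \<Longrightarrow> jcont (\<lambda>t. f)"
  unfolding jcont_def case_prod_beta' by (rule continuous_on_compose2[of UNIV f]) (auto intro: continuous_intros)

lemma ldecay_const: "decay k C f \<Longrightarrow> ldecay k (\<lambda>t. f)"
  unfolding ldecay_def by blast

lemma ldecayE:
  assumes "ldecay k w" obtains C where "\<And>t. \<bar>t\<bar> \<le> T \<Longrightarrow> decay k C (w t)"
  using assms unfolding ldecay_def by blast

lemma ldecay_slice: "ldecay k w \<Longrightarrow> \<exists>C. decay k C (w t)"
  by (meson ldecay_def order_refl)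

lemma ldecay_mono: "ldecay k w \<Longrightarrow> j \<le> k \<Longrightarrow> ldecay j w"
  unfolding ldecay_def using decay_mono by blast

lemma jcont_flip: "jcont w \<Longrightarrow> jcont (\<lambda>t. flip (w t))"
  unfolding jcont_def[of "\<lambda>t. flip (w t)"] flip_def case_prod_beta'
  by (rule continuous_on_cnj, rule jcont_compose) (auto intro!: continuous_intros)

lemma ldecay_flip: "ldecay k w \<Longrightarrow> ldecay k (\<lambda>t. flip (w t))"
  by (simp add: ldecay_def)

lemma ldecay_phase: "ldecay k w \<Longrightarrow> ldecay k (\<lambda>t \<xi>. cis (h t \<xi>) * w t \<xi>)"
  by (simp add: ldecay_def decay_phase)

lemma ldecay_cmult: "ldecay k w \<Longrightarrow> ldecay k (\<lambda>t \<xi>. a * w t \<xi>)"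
  unfolding ldecay_def using decay_cmult by blast

lemma jcont_diff: "jcont p \<Longrightarrow> jcont q \<Longrightarrow> jcont (\<lambda>t \<xi>. p t \<xi> - q t \<xi>)"
  unfolding jcont_def case_prod_beta' by (intro continuous_intros)

lemma ldecay_diff: "ldecay k p \<Longrightarrow> ldecay k q \<Longrightarrow> ldecay k (\<lambda>t \<xi>. p t \<xi> - q t \<xi>)"
  unfolding ldecay_def using decay_diff by meson

section \<open>Convolution and the cubic term under weighted bounds\<close>

lemma decay_conv:
  assumes "f \<in> borel_measurable borel" "g \<in> borel_measurable borel"
    and f: "decay k A f" and g: "decay k B g" and k: "2 \<le> k"
  shows "decay k (4 * 2 ^ k * A * B) (conv f g)"
proof (rule decay_mono[OF conv_decay[OF assms] order_refl])
  have "A * L1norm g \<le> A * (2 * B)" "B * L1norm f \<le> B * (2 * A)"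
    using decay_integrable(2)[OF assms(1) f k] decay_integrable(2)[OF assms(2) g k] decay_nonneg f g
    by (auto intro: mult_left_mono)
  then have "A * L1norm g + B * L1norm f \<le> 4 * A * B" by (simp add: algebra_simps)
  from mult_left_mono[OF this, of "2 ^ k"]
  show "2 ^ k * (A * L1norm g + B * L1norm f) \<le> 4 * 2 ^ k * A * B" by (simp add: mult_ac)
qed

lemma jcont_conv:
  assumes f: "jcont f" "ldecay 2 f" and g: "jcont g" "ldecay 2 g"
  shows "jcont (\<lambda>t. conv (f t) (g t))"
proof -
  have "continuous_on UNIV (\<lambda>p. LINT \<eta>|lborel. f (fst p) \<eta> * g (fst p) (snd p - \<eta>))"
  proof (rule continuous_on_LINT_dominated)
    fix p :: "real \<times> real"
    show "(\<lambda>\<eta>. f (fst p) \<eta> * g (fst p) (snd p - \<eta>)) \<in> borel_measurable lborel"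
      by (subst measurable_lborel2, rule borel_measurable_continuous_onI)
         (auto intro!: continuous_intros jcont_compose[OF f(1)] jcont_compose[OF g(1)])
    obtain A where A: "\<And>t. \<bar>t\<bar> \<le> \<bar>fst p\<bar> + 1 \<Longrightarrow> decay 2 A (f t)" using ldecayE[OF f(2)] by metis
    obtain B where B: "\<And>t. \<bar>t\<bar> \<le> \<bar>fst p\<bar> + 1 \<Longrightarrow> decay 2 B (g t)" using ldecayE[OF g(2)] by metis
    show "\<exists>e>0. \<exists>h. integrable lborel h \<and> (\<forall>q\<in>ball p e. \<forall>\<eta>. norm (f (fst q) \<eta> * g (fst q) (snd q - \<eta>)) \<le> h \<eta>)"
    proof (intro exI[of _ 1] conjI exI[of _ "\<lambda>\<eta>. (A * B) / J \<eta> ^ 2"] ballI allI)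
      fix q \<eta> assume "q \<in> ball p 1"
      then have "\<bar>fst q - fst p\<bar> \<le> 1"
        using dist_fst_le[of q p] by (simp add: dist_commute dist_real_def)
      then have t: "\<bar>fst q\<bar> \<le> \<bar>fst p\<bar> + 1" by linarith
      have "norm (f (fst q) \<eta> * g (fst q) (snd q - \<eta>)) \<le> (A / J \<eta> ^ 2) * B"
        unfolding norm_mult using A[OF t] decay_bounded[OF B[OF t]] decay_nonneg[OF A[OF t]]
        by (intro mult_mono) (auto simp: decay_def)
      then show "norm (f (fst q) \<eta> * g (fst q) (snd q - \<eta>)) \<le> (A * B) / J \<eta> ^ 2" by simp
    qed auto
  qed (auto intro!: continuous_intros jcont_compose[OF f(1)] jcont_compose[OF g(1)])
  then show ?thesis by (simp add: jcont_def conv_def case_prod_beta')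
qed

lemma ldecay_conv:
  assumes f: "jcont f" "ldecay k f" and g: "jcont g" "ldecay k g" and k: "2 \<le> k"
  shows "ldecay k (\<lambda>t. conv (f t) (g t))"
  unfolding ldecay_def
proof
  fix T
  obtain A where A: "\<And>t. \<bar>t\<bar> \<le> T \<Longrightarrow> decay k A (f t)" using ldecayE[OF f(2)] by metis
  obtain B where B: "\<And>t. \<bar>t\<bar> \<le> T \<Longrightarrow> decay k B (g t)" using ldecayE[OF g(2)] by metis
  show "\<exists>C. \<forall>t. \<bar>t\<bar> \<le> T \<longrightarrow> decay k C (conv (f t) (g t))"
    using decay_conv[OF _ _ A B k] jcont_slice(1)[OF f(1), THEN continuous_borel] jcont_slice(1)[OF g(1), THEN continuous_borel] by blast
qed

lemma continuous_conv:
  assumes "continuous_on UNIV f" "continuous_on UNIV g" "decay 2 A f" "decay 2 B g"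
  shows "continuous_on UNIV (conv f g)"
  using jcont_slice(1)[OF jcont_conv[OF jcont_const ldecay_const jcont_const ldecay_const]] assms by blast

lemma jcont_cubic: "jcont w \<Longrightarrow> ldecay 2 w \<Longrightarrow> jcont (\<lambda>t. cubic (w t))"
  unfolding cubic_def by (intro jcont_conv ldecay_conv jcont_flip ldecay_flip) auto

lemma ldecay_cubic: "jcont w \<Longrightarrow> ldecay k w \<Longrightarrow> 2 \<le> k \<Longrightarrow> ldecay k (\<lambda>t. cubic (w t))"
  unfolding cubic_def by (intro jcont_conv ldecay_conv jcont_flip ldecay_flip) (auto intro: ldecay_mono)

lemma continuous_cubic: "continuous_on UNIV f \<Longrightarrow> decay 2 C f \<Longrightarrow> continuous_on UNIV (cubic f)"
  using jcont_slice(1)[OF jcont_cubic[OF jcont_const ldecay_const]] by blast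

lemma conv_diff_left:
  assumes "integrable lborel (\<lambda>\<eta>. f \<eta> * h (\<xi> - \<eta>))" "integrable lborel (\<lambda>\<eta>. g \<eta> * h (\<xi> - \<eta>))"
  shows "conv (\<lambda>x. f x - g x) h \<xi> = conv f h \<xi> - conv g h \<xi>"
  using assms by (simp add: conv_def left_diff_distrib)

lemma conv_kernel_integrable:
  assumes "continuous_on UNIV f" "continuous_on UNIV g" "decay 2 A f" "decay 2 B g"
  shows "integrable lborel (\<lambda>\<eta>. f \<eta> * g (\<xi> - \<eta>))"
  using assms
  by (intro integrable_mult_bounded[where B=B] decay_integrable(1)[of f 2 A] continuous_borel)
     (auto intro!: continuous_borel decay_bounded continuous_intros continuous_on_compose2[of UNIV g UNIV])

lemma conv_diff:
  assumes "continuous_on UNIV f" "continuous_on UNIV g" "continuous_on UNIV f'" "continuous_on UNIV g'"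
    and "decay 2 A f" "decay 2 B g" "decay 2 A' f'" "decay 2 B' g'"
  shows "conv f g \<xi> - conv f' g' \<xi> = conv (\<lambda>x. f x - f' x) g \<xi> + conv f' (\<lambda>x. g x - g' x) \<xi>"
proof -
  note I = conv_kernel_integrable
  have "conv (\<lambda>x. f x - f' x) g \<xi> = conv f g \<xi> - conv f' g \<xi>"
    using assms by (intro conv_diff_left I)
  moreover have "conv f' (\<lambda>x. g x - g' x) \<xi> = conv f' g \<xi> - conv f' g' \<xi>"
    unfolding conv_commute[of f'] using assms by (intro conv_diff_left I)
  ultimately show ?thesis by simp
qed

lemma decay_conv_diff:
  assumes c: "continuous_on UNIV f" "continuous_on UNIV g" "continuous_on UNIV f'" "continuous_on UNIV g'"
    and d: "decay k A f" "decay k B g" "decay k A f'" "decay k B g'"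
    and e: "decay k D (\<lambda>x. f x - f' x)" "decay k E (\<lambda>x. g x - g' x)" and k: "2 \<le> k"
  shows "decay k (4 * 2 ^ k * (D * B + A * E)) (\<lambda>x. conv f g x - conv f' g' x)"
proof -
  have [measurable]: "f \<in> borel_measurable borel" "g \<in> borel_measurable borel"
     "f' \<in> borel_measurable borel" "g' \<in> borel_measurable borel"
    using c by (auto intro: continuous_borel)
  have "(\<lambda>x. conv f g x - conv f' g' x) = (\<lambda>\<xi>. conv (\<lambda>x. f x - f' x) g \<xi> + conv f' (\<lambda>x. g x - g' x) \<xi>)"
    using conv_diff[OF c] decay_mono[OF _ k order_refl] d by blast
  moreover have "decay k (4 * 2 ^ k * D * B + 4 * 2 ^ k * A * E) \<dots>"
    by (intro decay_add decay_conv d e k) measurable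
  ultimately show ?thesis by (simp add: algebra_simps)
qed

lemma decay_cubic_diff:
  assumes c: "continuous_on UNIV f" "continuous_on UNIV g"
    and d: "decay k A f" "decay k A g" "decay k D (\<lambda>x. f x - g x)" and k: "2 \<le> k"
  shows "decay k (48 * 4 ^ k * A\<^sup>2 * D) (\<lambda>x. cubic f x - cubic g x)"
proof -
  let ?c = "4 * 2 ^ k :: real"
  have d2: "decay 2 A f" "decay 2 A g" using d k by (auto intro: decay_mono)
  have fl: "decay k D (\<lambda>x. flip f x - flip g x)"
  proof -
    have "(\<lambda>x. flip f x - flip g x) = flip (\<lambda>x. f x - g x)" by (simp add: flip_def fun_eq_iff)
    then show ?thesis using d(3) by simp
  qed
  have r: "decay k (?c * (D * A + A * D)) (\<lambda>x. conv f (flip f) x - conv g (flip g) x)"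
    by (rule decay_conv_diff) (use c d fl k in \<open>auto intro: continuous_flip\<close>)
  have b: "decay k (?c * A * A) (conv f (flip f))" "decay k (?c * A * A) (conv g (flip g))"
    using decay_conv[OF c(1)[THEN continuous_borel] continuous_flip[OF c(1), THEN continuous_borel] d(1) _ k]
      decay_conv[OF c(2)[THEN continuous_borel] continuous_flip[OF c(2), THEN continuous_borel] d(2) _ k] d by auto
  \<comment> \<open>Telescoping over the three slots of the cubic term: each contributes c^2 A^2 D
    with c = 4 * 2 ^ k, which gives 3 * 16 * 4 ^ k.\<close>
  have "decay k (?c * (?c * (D * A + A * D) * A + ?c * A * A * D)) (\<lambda>x. cubic f x - cubic g x)"
    unfolding cubic_def
    by (rule decay_conv_diff) (use c d r b k d2 in \<open>auto intro!: continuous_conv continuous_flip\<close>)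
  moreover have "?c * (?c * (D * A + A * D) * A + ?c * A * A * D) = 48 * (2 ^ k * 2 ^ k) * A\<^sup>2 * D"
    by (simp add: algebra_simps power2_eq_square)
  moreover have "(2 ^ k * 2 ^ k :: real) = 4 ^ k" by (simp flip: power_mult_distrib)
  ultimately show ?thesis by (simp only:)
qed

section \<open>Time integrals and the fixed point theorem\<close>

lemma integral_time_rescale:
  fixes h :: "real \<Rightarrow> complex"
  assumes h: "continuous_on UNIV h" and t: "0 \<le> t"
  shows "integral {0..t} h = of_real t * integral {0..1} (\<lambda>\<sigma>. h (t * \<sigma>))"
proof -
  let ?P = "\<lambda>t. integral {0..t} h"
  have "((\<lambda>\<sigma>. t *\<^sub>R h (t * \<sigma>)) has_integral (?P (t * 1) - ?P (t * 0))) {0..1}"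
  proof (rule fundamental_theorem_of_calculus)
    fix x assume x: "x \<in> {0..1::real}"
    have xt: "t * x \<in> {0..t}" using x t by (auto simp: mult_left_le)
    have D: "(?P has_vector_derivative h (t * x)) (at (t * x) within {0..t})"
      by (rule integral_has_vector_derivative[OF _ xt]) (use h in \<open>auto intro: continuous_on_subset\<close>)
    have im: "(\<lambda>x. t * x) ` {0..1} \<subseteq> {0..t}" using t by (auto simp: mult_left_le)
    have "((?P \<circ> (\<lambda>x. t * x)) has_vector_derivative t *\<^sub>R h (t * x)) (at x within {0..1})"
      by (rule vector_diff_chain_within) (auto intro!: derivative_eq_intros has_vector_derivative_within_subset[OF D im])
    then show "((\<lambda>x. ?P (t * x)) has_vector_derivative t *\<^sub>R h (t * x)) (at x within {0..1})"
      by (simp add: comp_def)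
  qed auto
  then show ?thesis by (simp add: has_integral_iff scaleR_conv_of_real)
qed

text \<open>Rescaling to the fixed interval {0..1} moves the variable endpoint into the integrand,
  where continuity in a parameter is available. For t < 0 the interval is empty and the integral
  vanishes, hence the factor \<open>max 0 t\<close>.\<close>

lemma jcont_time_integral:
  assumes h: "jcont h"
  shows "jcont (\<lambda>t \<xi>. integral {0..t} (\<lambda>s. h s \<xi>))"
proof -
  have "integral {0..t} (\<lambda>s. h s \<xi>) = of_real (max 0 t) * integral {0..1} (\<lambda>\<sigma>. h (max 0 t * \<sigma>) \<xi>)" for t \<xi>
  proof (cases "0 \<le> t")
    case True
    then show ?thesis using integral_time_rescale[OF jcont_slice(2)[OF h] True] by (simp add: max_absorb2)
  qed auto
  moreover have "continuous_on UNIV (\<lambda>p. integral (cbox 0 1) (\<lambda>\<sigma>. h (max 0 (fst p) * \<sigma>) (snd p)))"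
    by (rule integral_continuous_on_param)
       (auto simp: case_prod_beta' intro!: jcont_compose[OF h] continuous_intros)
  ultimately show ?thesis unfolding jcont_def case_prod_beta'
    by (auto intro!: continuous_intros simp: cbox_interval)
qed

lemma has_integral_exp:
  assumes "0 < a" "0 \<le> t"
  shows "((\<lambda>s. exp (a * s)) has_integral (exp (a * t) - 1) / a) {0..t::real}"
proof -
  have "((\<lambda>s. exp (a * s)) has_integral exp (a * t) / a - exp (a * 0) / a) {0..t}"
    by (rule fundamental_theorem_of_calculus)
       (use assms in \<open>auto intro!: derivative_eq_intros simp flip: has_real_derivative_iff_has_vector_derivative\<close>)
  then show ?thesis by (simp add: diff_divide_distrib)
qed

lemma integral_exp_bound:
  fixes h :: "real \<Rightarrow> complex"
  assumes h: "continuous_on {0..t} h" and b: "\<And>s. s \<in> {0..t} \<Longrightarrow> cmod (h s) \<le> K * exp (a * s)"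
    and a: "0 < a" and K: "0 \<le> K" and t: "0 \<le> t"
  shows "cmod (integral {0..t} h) \<le> K / a * exp (a * t)"
proof -
  have I: "((\<lambda>s. K * exp (a * s)) has_integral K * ((exp (a * t) - 1) / a)) {0..t}"
    by (rule has_integral_mult_right[OF has_integral_exp[OF a t]])
  have "cmod (integral {0..t} h) \<le> integral {0..t} (\<lambda>s. K * exp (a * s))"
    by (rule integral_norm_bound_integral) (use b I in \<open>auto intro: integrable_continuous_interval[OF h] has_integral_integrable\<close>)
  also have "\<dots> = K * ((exp (a * t) - 1) / a)" using I by (rule integral_unique)
  also have "\<dots> \<le> K / a * exp (a * t)" using a K by (simp add: field_simps mult_left_mono)
  finally show ?thesis .
qed

text \<open>The Lipschitz constant L does not depend on the sizes of f and g, so a sup norm damped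
  by exp (- a |t|) makes the Duhamel map a contraction on all times at once, without iterating over
  short intervals. At negative times the integral is empty and the solution stays equal to its
  datum.\<close>

theorem weighted_picard:
  fixes G :: "real \<Rightarrow> (real \<Rightarrow> complex) \<Rightarrow> real \<Rightarrow> complex"
  assumes L: "0 \<le> L"
    and lip: "\<And>t f g A B D. 0 \<le> t \<Longrightarrow> continuous_on UNIV f \<Longrightarrow> continuous_on UNIV g \<Longrightarrow> decay k A f \<Longrightarrow> decay k B g
        \<Longrightarrow> decay k D (\<lambda>\<xi>. f \<xi> - g \<xi>) \<Longrightarrow> decay k (L * D) (\<lambda>\<xi>. G t f \<xi> - G t g \<xi>)"
    and zero: "\<And>t \<xi>. G t (\<lambda>_. 0) \<xi> = 0"
    and cont: "\<And>w. jcont w \<Longrightarrow> ldecay k w \<Longrightarrow> jcont (\<lambda>t. G t (w t))"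
    and w0: "continuous_on UNIV w0" "decay k C0 w0"
  obtains w where "jcont w" "ldecay k w"
    "\<And>t \<xi>. w t \<xi> = w0 \<xi> + integral {0..t} (\<lambda>s. G s (w s) \<xi>)"
proof -
  \<comment> \<open>Integrating exp (a s) gains a factor 1 / a; this choice makes the contraction
    factor L / a at most 1 / 2.\<close>
  define a where "a = 2 * (L + 1)"
  have a: "0 < a" "L / a \<le> 1 / 2" using L by (auto simp: a_def field_simps)
  \<comment> \<open>The unknown is stored after division by time and frequency weights, so the
    complete space is that of bounded continuous functions of (t, \<xi>), and joint continuity of
    the fixed point comes for free.\<close>
  define W where "W b t \<xi> = of_real (exp (a * \<bar>t\<bar>) / J \<xi> ^ k) * apply_bcontfun b (t, \<xi>)"
    for b :: "(real \<times> real) \<Rightarrow>\<^sub>C complex" and t \<xi>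
  have Wj: "jcont (W b)" for b
    unfolding jcont_def W_def case_prod_beta' by (auto intro!: continuous_intros)
  have Wdiff: "decay k (exp (a * \<bar>t\<bar>) * dist b b') (\<lambda>\<xi>. W b t \<xi> - W b' t \<xi>)" for b b' t
    unfolding decay_def
  proof
    fix \<xi>
    have "W b t \<xi> - W b' t \<xi> = of_real (exp (a * \<bar>t\<bar>) / J \<xi> ^ k) * (apply_bcontfun b (t, \<xi>) - apply_bcontfun b' (t, \<xi>))"
      by (simp only: W_def right_diff_distrib)
    also have "cmod \<dots> = exp (a * \<bar>t\<bar>) / J \<xi> ^ k * dist (apply_bcontfun b (t, \<xi>)) (apply_bcontfun b' (t, \<xi>))"
      by (simp add: norm_mult norm_divide norm_power dist_norm del: of_real_divide of_real_power)
    also have "\<dots> \<le> exp (a * \<bar>t\<bar>) / J \<xi> ^ k * dist b b'"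
      by (intro mult_left_mono dist_bounded) auto
    finally show "cmod (W b t \<xi> - W b' t \<xi>) \<le> exp (a * \<bar>t\<bar>) * dist b b' / J \<xi> ^ k" by simp
  qed
  have Wd: "decay k (exp (a * \<bar>t\<bar>) * norm b) (W b t)" for b t
  proof -
    have "W 0 t = (\<lambda>\<xi>. 0)" by (simp add: W_def[abs_def])
    then show ?thesis using Wdiff[of t b 0] by simp
  qed
  have Wl: "ldecay k (W b)" for b
    unfolding ldecay_def
  proof (intro allI exI impI)
    fix T t :: real assume "\<bar>t\<bar> \<le> T"
    then show "decay k (exp (a * T) * norm b) (W b t)"
      using a by (intro decay_mono[OF Wd order_refl] mult_right_mono) auto
  qed
  define I where "I b t \<xi> = integral {0..t} (\<lambda>s. G s (W b s) \<xi>)" for b t \<xi>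
  have Gj: "jcont (\<lambda>t. G t (W b t))" for b by (rule cont[OF Wj Wl])
  have Ij: "jcont (I b)" for b using jcont_time_integral[OF Gj[of b]] by (simp add: I_def[abs_def])
  have Idiff: "cmod (I b t \<xi> - I b' t \<xi>) \<le> (1 / 2) * dist b b' * exp (a * \<bar>t\<bar>) / J \<xi> ^ k" for b b' t \<xi>
  proof (cases "0 \<le> t")
    case True
    have int: "(\<lambda>s. G s (W c s) \<xi>) integrable_on {0..t}" for c
      by (rule integrable_continuous_interval) (rule jcont_slice(2)[OF Gj])
    have "I b t \<xi> - I b' t \<xi> = integral {0..t} (\<lambda>s. G s (W b s) \<xi> - G s (W b' s) \<xi>)"
      unfolding I_def by (rule Henstock_Kurzweil_Integration.integral_diff[symmetric]) (rule int)+
    also have "cmod \<dots> \<le> (L * dist b b' / J \<xi> ^ k) / a * exp (a * t)"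
    proof (rule integral_exp_bound)
      show "continuous_on {0..t} (\<lambda>s. G s (W b s) \<xi> - G s (W b' s) \<xi>)"
        by (intro continuous_intros jcont_slice(2)[OF Gj])
      fix s assume s: "s \<in> {0..t}"
      have "decay k (L * (exp (a * \<bar>s\<bar>) * dist b b')) (\<lambda>\<xi>. G s (W b s) \<xi> - G s (W b' s) \<xi>)"
        using s by (intro lip[OF _ _ _ Wd Wd Wdiff] jcont_slice(1)[OF Wj]) auto
      then show "cmod (G s (W b s) \<xi> - G s (W b' s) \<xi>) \<le> L * dist b b' / J \<xi> ^ k * exp (a * s)"
        using s by (simp add: decay_def mult_ac)
    qed (use a L True in auto)
    also have "\<dots> = (L / a) * (dist b b' * exp (a * t) / J \<xi> ^ k)" by (simp add: mult_ac)
    also have "\<dots> \<le> (1 / 2) * (dist b b' * exp (a * t) / J \<xi> ^ k)"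
      by (rule mult_right_mono[OF a(2)]) auto
    finally show ?thesis using True by simp
  qed (simp add: I_def)
  have Izero: "I 0 t \<xi> = 0" for t \<xi>
  proof -
    have "W 0 s = (\<lambda>_. 0)" for s by (simp add: W_def[abs_def])
    then show ?thesis by (simp add: I_def zero)
  qed
  define \<Phi> where "\<Phi> b = Bcontfun (\<lambda>(t, \<xi>). of_real (exp (- a * \<bar>t\<bar>) * J \<xi> ^ k) * (w0 \<xi> + I b t \<xi>))" for b
  have w0': "continuous_on UNIV (\<lambda>p::real \<times> real. w0 (snd p))"
    by (rule continuous_on_compose2[OF w0(1)]) (auto intro: continuous_intros)
  have \<Phi>: "apply_bcontfun (\<Phi> b) (t, \<xi>) = of_real (exp (- a * \<bar>t\<bar>) * J \<xi> ^ k) * (w0 \<xi> + I b t \<xi>)" for b t \<xi>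
  proof -
    have "(\<lambda>(t, \<xi>). of_real (exp (- a * \<bar>t\<bar>) * J \<xi> ^ k) * (w0 \<xi> + I b t \<xi>)) \<in> bcontfun"
    proof (rule bcontfun_normI)
      show "continuous_on UNIV (\<lambda>(t, \<xi>). of_real (exp (- a * \<bar>t\<bar>) * J \<xi> ^ k) * (w0 \<xi> + I b t \<xi>))"
        unfolding case_prod_beta' by (intro continuous_intros w0' jcont_compose[OF Ij])
      show "norm (case p of (t, \<xi>) \<Rightarrow> of_real (exp (- a * \<bar>t\<bar>) * J \<xi> ^ k) * (w0 \<xi> + I b t \<xi>)) \<le> C0 + norm b" for p
      proof -
        obtain t \<xi> where p: "p = (t, \<xi>)" by force
        have C0: "0 \<le> C0" using w0(2) decay_nonneg by blast
        have "cmod (w0 \<xi> + I b t \<xi>) \<le> C0 / J \<xi> ^ k + (1 / 2) * norm b * exp (a * \<bar>t\<bar>) / J \<xi> ^ k"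
          using w0(2) Idiff[of b t \<xi> 0] norm_triangle_ineq[of "w0 \<xi>" "I b t \<xi>"]
          by (auto simp: decay_def Izero intro: order_trans add_mono)
        also have "\<dots> \<le> (C0 * exp (a * \<bar>t\<bar>) + norm b * exp (a * \<bar>t\<bar>)) / J \<xi> ^ k"
        proof -
          have "C0 * 1 \<le> C0 * exp (a * \<bar>t\<bar>)" using a C0 by (intro mult_left_mono) auto
          then have "(C0 + (1 / 2) * norm b * exp (a * \<bar>t\<bar>)) / J \<xi> ^ k \<le> (C0 * exp (a * \<bar>t\<bar>) + norm b * exp (a * \<bar>t\<bar>)) / J \<xi> ^ k"
            by (intro divide_right_mono add_mono) auto
          then show ?thesis by (simp add: add_divide_distrib)
        qed
        finally have "cmod (w0 \<xi> + I b t \<xi>) \<le> (C0 + norm b) * exp (a * \<bar>t\<bar>) / J \<xi> ^ k"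
          by (simp add: algebra_simps)
        from mult_left_mono[OF this, of "exp (- a * \<bar>t\<bar>) * J \<xi> ^ k"]
        have "exp (- a * \<bar>t\<bar>) * J \<xi> ^ k * cmod (w0 \<xi> + I b t \<xi>) \<le> (C0 + norm b) * (exp (- a * \<bar>t\<bar>) * exp (a * \<bar>t\<bar>))"
          by (simp add: mult_ac)
        also have "exp (- a * \<bar>t\<bar>) * exp (a * \<bar>t\<bar>) = 1" by (simp flip: exp_add)
        finally show ?thesis by (simp add: p norm_mult norm_power)
      qed
    qed
    then show ?thesis by (simp add: \<Phi>_def Bcontfun_inverse)
  qed
  have "\<exists>!b. \<Phi> b = b"
  proof (rule banach_fix_type)
    show "\<forall>b b'. dist (\<Phi> b) (\<Phi> b') \<le> (1 / 2) * dist b b'"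
    proof (intro allI dist_bound)
      fix b b' :: "(real \<times> real) \<Rightarrow>\<^sub>C complex" and p :: "real \<times> real"
      obtain t \<xi> where p: "p = (t, \<xi>)" by force
      have "dist (apply_bcontfun (\<Phi> b) p) (apply_bcontfun (\<Phi> b') p)
         = cmod (of_real (exp (- a * \<bar>t\<bar>) * J \<xi> ^ k) * (I b t \<xi> - I b' t \<xi>))"
        unfolding p \<Phi> dist_norm by (simp add: algebra_simps)
      also have "\<dots> = exp (- a * \<bar>t\<bar>) * J \<xi> ^ k * cmod (I b t \<xi> - I b' t \<xi>)"
        by (simp add: norm_mult norm_power)
      also have "\<dots> \<le> exp (- a * \<bar>t\<bar>) * J \<xi> ^ k * ((1 / 2) * dist b b' * exp (a * \<bar>t\<bar>) / J \<xi> ^ k)"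
        by (rule mult_left_mono[OF Idiff]) auto
      also have "\<dots> = (1 / 2) * dist b b' * (exp (- a * \<bar>t\<bar>) * exp (a * \<bar>t\<bar>))" by simp
      also have "exp (- a * \<bar>t\<bar>) * exp (a * \<bar>t\<bar>) = 1" by (simp flip: exp_add)
      finally show "dist (apply_bcontfun (\<Phi> b) p) (apply_bcontfun (\<Phi> b') p) \<le> (1 / 2) * dist b b'" by simp
    qed
  qed auto
  then obtain b where b: "\<Phi> b = b" by blast
  show ?thesis
  proof (rule that[OF Wj[of b] Wl[of b]])
    fix t \<xi>
    have "W b t \<xi> = of_real (exp (a * \<bar>t\<bar>) / J \<xi> ^ k) * (of_real (exp (- a * \<bar>t\<bar>) * J \<xi> ^ k) * (w0 \<xi> + I b t \<xi>))"
      unfolding W_def using \<Phi>[of b t \<xi>] b by simp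
    also have "\<dots> = of_real ((exp (a * \<bar>t\<bar>) / J \<xi> ^ k) * (exp (- a * \<bar>t\<bar>) * J \<xi> ^ k)) * (w0 \<xi> + I b t \<xi>)"
      by (simp only: of_real_mult mult.assoc)
    also have "(exp (a * \<bar>t\<bar>) / J \<xi> ^ k) * (exp (- a * \<bar>t\<bar>) * J \<xi> ^ k) = 1"
      by (simp flip: exp_add)
    finally show "W b t \<xi> = w0 \<xi> + integral {0..t} (\<lambda>s. G s (W b s) \<xi>)" by (simp add: I_def)
  qed
qed

section \<open>Gronwall-type lemmas and pairing identities\<close>

lemma DERIV_nonpos_within_imp_le:
  fixes g :: "real \<Rightarrow> real"
  assumes d: "\<And>x. x \<in> {0..T} \<Longrightarrow> (g has_vector_derivative g' x) (at x within {0..T})"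
    and n: "\<And>x. x \<in> {0..T} \<Longrightarrow> g' x \<le> 0" and t: "t \<in> {0..T}"
  shows "g t \<le> g 0"
proof (cases "t = 0")
  case False
  have gc: "continuous_on {0..T} g" by (rule continuous_on_vector_derivative[OF d])
  show ?thesis
  proof (rule DERIV_nonpos_imp_decreasing_open[of 0 t g])
    show "continuous_on {0..t} g"
      by (rule continuous_on_subset[OF gc]) (use t in auto)
    fix x assume x: "0 < x" "x < t"
    then have "(g has_real_derivative g' x) (at x)"
      using d[of x] t by (simp add: at_within_Icc_at has_real_derivative_iff_has_vector_derivative)
    then show "\<exists>y. (g has_real_derivative y) (at x) \<and> y \<le> 0" using n[of x] x t by auto
  qed (use t in auto)
qed auto

text \<open>Majorant for P' = K P (1 + ln P) with P 0 = 1 + a, along which ln (1 + ln P) has slope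
  K. The exact solution has an additional -1 in the outer exponent, which is dropped.\<close>

definition osgood_bound :: "real \<Rightarrow> real \<Rightarrow> real \<Rightarrow> real" where
  "osgood_bound a K t = exp (exp (ln (1 + ln (1 + a)) + K * t))"

text \<open>The function y is merely continuous, so the argument is run on its differentiable
  integral majorant P: monotonicity of r (1 + ln r) makes ln (1 + ln P) - K t nonincreasing.\<close>

lemma osgood:
  assumes y: "continuous_on {0..T} y" and nn: "\<And>t. t \<in> {0..T} \<Longrightarrow> 0 \<le> y t" and K: "0 \<le> K" and a: "0 \<le> a"
    and le: "\<And>t. t \<in> {0..T} \<Longrightarrow> y t \<le> a + integral {0..t} (\<lambda>s. K * (y s * (1 + ln (1 + y s))))"
    and t: "t \<in> {0..T}"
  shows "y t \<le> osgood_bound a K t"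
proof -
  define h where "h s = K * (y s * (1 + ln (1 + y s)))" for s
  have hc: "continuous_on {0..T} h"
    unfolding h_def using y nn by (auto intro!: continuous_intros simp: add_nonneg_eq_0_iff)
  have hn: "0 \<le> h s" if "s \<in> {0..T}" for s using nn[OF that] K by (simp add: h_def)
  define P where "P t = 1 + a + integral {0..t} h" for t
  have int0: "0 \<le> integral {0..t} h" if "t \<in> {0..T}" for t
    using hn that by (intro Henstock_Kurzweil_Integration.integral_nonneg integrable_continuous_interval continuous_on_subset[OF hc]) auto
  have P1: "1 \<le> P t" if "t \<in> {0..T}" for t using int0[OF that] a by (simp add: P_def)
  have yP: "1 + y t \<le> P t" if "t \<in> {0..T}" for t using le[OF that] by (simp add: P_def h_def[abs_def])
  have dP: "(P has_vector_derivative h t) (at t within {0..T})" if "t \<in> {0..T}" for t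
    unfolding P_def[abs_def] using integral_has_vector_derivative[OF hc that]
    by (auto intro!: derivative_eq_intros)
  have dg: "((\<lambda>t. ln (1 + ln (P t)) - K * t) has_vector_derivative (h t / (P t * (1 + ln (P t))) - K)) (at t within {0..T})"
    if t: "t \<in> {0..T}" for t
  proof -
    have "0 < 1 + ln (P t)" using P1[OF t] by (simp add: add_pos_nonneg)
    then show ?thesis using dP[OF t] P1[OF t] unfolding has_real_derivative_iff_has_vector_derivative[symmetric]
      by (auto intro!: derivative_eq_intros simp: field_simps)
  qed
  have "ln (1 + ln (P t)) - K * t \<le> ln (1 + ln (P 0)) - K * 0"
  proof (rule DERIV_nonpos_within_imp_le[OF dg _ t])
    fix s assume s: "s \<in> {0..T}"
    have pos: "0 < P s * (1 + ln (P s))" using P1[OF s] by (simp add: add_pos_nonneg)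
    have "y s * (1 + ln (1 + y s)) \<le> P s * (1 + ln (P s))"
      using yP[OF s] nn[OF s] P1[OF s] by (intro mult_mono) auto
    then have "h s \<le> K * (P s * (1 + ln (P s)))" unfolding h_def using K by (rule mult_left_mono)
    then show "h s / (P s * (1 + ln (P s))) - K \<le> 0" using pos by (simp add: pos_divide_le_eq)
  qed
  then have *: "ln (1 + ln (P t)) \<le> ln (1 + ln (1 + a)) + K * t" by (simp add: P_def)
  have "1 + ln (P t) \<le> exp (ln (1 + ln (1 + a)) + K * t)"
    using * P1[OF t] by (metis add_pos_nonneg exp_le_cancel_iff exp_ln ln_ge_zero zero_less_one)
  then have "ln (P t) \<le> exp (ln (1 + ln (1 + a)) + K * t)" by simp
  then have "P t \<le> osgood_bound a K t"
    unfolding osgood_bound_def using P1[OF t] by (metis exp_le_cancel_iff exp_ln less_le_trans zero_less_one)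
  then show ?thesis using yP[OF t] by simp
qed

lemma gronwall:
  fixes y :: "real \<Rightarrow> real"
  assumes y: "continuous_on {0..T} y" and L: "0 \<le> L"
    and le: "\<And>t. t \<in> {0..T} \<Longrightarrow> y t \<le> a + integral {0..t} (\<lambda>s. L * y s)"
    and t: "t \<in> {0..T}"
  shows "y t \<le> a * exp (L * t)"
proof -
  have hc: "continuous_on {0..T} (\<lambda>s. L * y s)" using y by (intro continuous_intros)
  define P where "P t = a + integral {0..t} (\<lambda>s. L * y s)" for t
  have dP: "(P has_vector_derivative L * y t) (at t within {0..T})" if "t \<in> {0..T}" for t
    unfolding P_def[abs_def] by (subst add.commute, subst has_vector_derivative_add_const) (rule integral_has_vector_derivative[OF hc that])
  have "P t * exp (- L * t) \<le> P 0 * exp (- L * 0)"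
  proof (rule DERIV_nonpos_within_imp_le[OF _ _ t])
    fix s assume s: "s \<in> {0..T}"
    show "((\<lambda>t. P t * exp (- L * t)) has_vector_derivative (L * y s * exp (- L * s) + P s * (exp (- L * s) * (- L)))) (at s within {0..T})"
      using dP[OF s] unfolding has_real_derivative_iff_has_vector_derivative[symmetric]
      by (auto intro!: derivative_eq_intros)
    have "L * y s \<le> L * P s" using le[OF s] L by (auto simp: P_def intro: mult_left_mono)
    then have "exp (- L * s) * (L * y s) \<le> exp (- L * s) * (L * P s)" by simp
    then show "L * y s * exp (- L * s) + P s * (exp (- L * s) * (- L)) \<le> 0" by (simp add: algebra_simps)
  qed
  then have "P t * exp (- L * t) \<le> a" by (simp add: P_def)
  then have "P t \<le> a * exp (L * t)" by (simp add: exp_minus field_simps)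
  then show ?thesis using le[OF t] by (simp add: P_def)
qed

text \<open>At the first time b with y b \<ge> R, the weak bound y \<le> R holds on all of {0..b},
  so the hypothesis improves it to y b < R, a contradiction. This closes every bootstrap
  below.\<close>

lemma first_exit:
  fixes y :: "real \<Rightarrow> real"
  assumes y: "continuous_on {0..T} y" and y0: "y 0 < R"
    and step: "\<And>t. t \<in> {0..T} \<Longrightarrow> (\<And>s. s \<in> {0..t} \<Longrightarrow> y s \<le> R) \<Longrightarrow> y t < R"
    and t: "t \<in> {0..T}"
  shows "y t < R"
proof (rule ccontr)
  assume "\<not> y t < R"
  define S where "S = {s \<in> {0..T}. R \<le> y s}"
  have S: "t \<in> S" "bdd_below S" using t \<open>\<not> y t < R\<close> by (auto simp: S_def intro!: bdd_belowI[of _ 0])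
  have "S = {0..T} \<inter> y -` {R..}" by (auto simp: S_def)
  then have "closed S" using continuous_closed_preimage[OF y, of "{R..}"] by simp
  then have inf: "Inf S \<in> S" using closed_contains_Inf[of S] S by auto
  define b where "b = Inf S"
  have b: "0 \<le> b" "b \<le> T" "R \<le> y b" using inf by (auto simp: S_def b_def)
  have lt: "y s < R" if "0 \<le> s" "s < b" for s
    using cInf_lower[OF _ S(2), of s] that b by (fastforce simp: S_def b_def)
  obtain x where x: "0 \<le> x" "x \<le> b" "y x = R"
    using IVT'[of y 0 R b] y0 b continuous_on_subset[OF y, of "{0..b}"] by auto
  then have "x = b" using lt[of x] by fastforce
  have "y s \<le> R" if "s \<in> {0..b}" for s
    using lt[of s] that x \<open>x = b\<close> by (cases "s = b") auto
  then have "y b < R" using step[of b] b by auto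
  then show False using b by simp
qed

text \<open>The least constant admissible in \<open>decay\<close>. The supremum has this meaning
  only when some decay bound exists, so such a bound accompanies its use.\<close>

definition nrm :: "nat \<Rightarrow> (real \<Rightarrow> complex) \<Rightarrow> real" where
  "nrm k f = (SUP x. J x ^ k * cmod (f x))"

lemma decay_iff: "decay k C f \<longleftrightarrow> (\<forall>x. J x ^ k * cmod (f x) \<le> C)"
  by (simp add: decay_def pos_le_divide_eq mult.commute)

lemma nrm_le: "decay k C f \<Longrightarrow> nrm k f \<le> C"
  unfolding nrm_def decay_iff by (rule cSUP_least) auto

lemma decay_nrm: assumes "decay k C f" shows "decay k (nrm k f) f"
  unfolding decay_iff nrm_def
proof
  fix x show "J x ^ k * cmod (f x) \<le> (SUP x. J x ^ k * cmod (f x))"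
    by (rule cSUP_upper) (use assms in \<open>auto simp: decay_iff intro!: bdd_aboveI2\<close>)
qed

lemma nrm_nonneg: "decay k C f \<Longrightarrow> 0 \<le> nrm k f"
  using decay_nrm decay_nonneg by blast

lemma nrm_lipschitz:
  assumes "decay k A f" "decay k B g" "decay k D (\<lambda>x. f x - g x)"
  shows "\<bar>nrm k f - nrm k g\<bar> \<le> D"
proof -
  have "decay k (nrm k g + D) f"
    using decay_add[OF decay_nrm[OF assms(2)] assms(3)] by simp
  moreover have "decay k (nrm k f + D) g"
    using decay_diff[OF decay_nrm[OF assms(1)] assms(3)] by simp
  ultimately show ?thesis using nrm_le[of k "nrm k g + D" f] nrm_le[of k "nrm k f + D" g] by linarith
qed

lemma decay_integral:
  assumes h: "jcont h" and d: "\<And>s. s \<in> {a..b} \<Longrightarrow> decay k (D s) (h s)" and D: "continuous_on {a..b} D"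
  shows "decay k (integral {a..b} D) (\<lambda>\<xi>. integral {a..b} (\<lambda>s. h s \<xi>))"
  unfolding decay_def
proof
  fix \<xi>
  have "cmod (integral {a..b} (\<lambda>s. h s \<xi>)) \<le> integral {a..b} (\<lambda>s. D s / J \<xi> ^ k)"
    by (rule integral_norm_bound_integral)
       (use d D in \<open>auto intro!: integrable_continuous_interval jcont_slice(2)[OF h] continuous_intros simp: decay_def\<close>)
  then show "cmod (integral {a..b} (\<lambda>s. h s \<xi>)) \<le> integral {a..b} D / J \<xi> ^ k"
    by (simp add: divide_inverse)
qed

text \<open>A weighted bound C on h makes the norm Lipschitz in time with constant |C|. Joint
  continuity of w alone would not control a supremum over all frequencies.\<close>

lemma continuous_nrm:
  assumes h: "jcont h" "ldecay k h" and w: "ldecay k w"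
    and eq: "\<And>t \<xi>. t \<in> {0..T} \<Longrightarrow> w t \<xi> = w 0 \<xi> + integral {0..t} (\<lambda>s. h s \<xi>)"
  shows "continuous_on {0..T} (\<lambda>t. nrm k (w t))"
proof -
  obtain C where C: "\<And>s. \<bar>s\<bar> \<le> T \<Longrightarrow> decay k C (h s)" using ldecayE[OF h(2)] by metis
  have lip: "\<bar>nrm k (w t) - nrm k (w s)\<bar> \<le> \<bar>C\<bar> * \<bar>t - s\<bar>" if st: "s \<in> {0..T}" "t \<in> {0..T}" "s \<le> t" for s t
  proof -
    obtain A B where AB: "decay k A (w s)" "decay k B (w t)" using ldecay_slice[OF w] by metis
    have "decay k (integral {s..t} (\<lambda>_. C)) (\<lambda>\<xi>. integral {s..t} (\<lambda>s. h s \<xi>))"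
      using st by (intro decay_integral[OF h(1)] C) auto
    moreover have "integral {s..t} (\<lambda>r. h r \<xi>) = w t \<xi> - w s \<xi>" for \<xi>
      using Henstock_Kurzweil_Integration.integral_combine[of 0 s t "\<lambda>s. h s \<xi>"] eq[of s \<xi>] eq[of t \<xi>] st
        integrable_continuous_interval[OF jcont_slice(2)[OF h(1)]] by (auto simp: algebra_simps)
    ultimately have "decay k (C * (t - s)) (\<lambda>\<xi>. w t \<xi> - w s \<xi>)" using st by (simp add: mult.commute)
    from nrm_lipschitz[OF AB(2,1) this] have "\<bar>nrm k (w t) - nrm k (w s)\<bar> \<le> C * (t - s)" .
    also have "\<dots> \<le> \<bar>C\<bar> * \<bar>t - s\<bar>" using st by (simp add: mult_right_mono)
    finally show ?thesis .
  qed
  have "\<bar>C\<bar>-lipschitz_on {0..T} (\<lambda>t. nrm k (w t))"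
  proof (rule lipschitz_onI)
    fix s t assume "s \<in> {0..T}" "t \<in> {0..T}"
    then show "dist (nrm k (w s)) (nrm k (w t)) \<le> \<bar>C\<bar> * dist s t"
      using lip[of s t] lip[of t s] by (cases "s \<le> t") (auto simp: dist_real_def abs_minus_commute)
  qed auto
  then show ?thesis by (rule lipschitz_on_continuous_on)
qed

lemma Cauchy_Schwarz_LINT:
  fixes f g :: "'a \<Rightarrow> real"
  assumes f: "integrable M (\<lambda>x. (f x)\<^sup>2)" and g: "integrable M (\<lambda>x. (g x)\<^sup>2)"
    and fg: "integrable M (\<lambda>x. f x * g x)"
  shows "(LINT x|M. f x * g x)\<^sup>2 \<le> (LINT x|M. (f x)\<^sup>2) * (LINT x|M. (g x)\<^sup>2)"
proof -
  let ?a = "LINT x|M. (f x)\<^sup>2" and ?b = "LINT x|M. (g x)\<^sup>2" and ?c = "LINT x|M. f x * g x"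
  have q: "0 \<le> ?a * r\<^sup>2 - 2 * ?c * r + ?b" for r
  proof -
    have "0 \<le> (LINT x|M. (f x * r - g x)\<^sup>2)" by (rule Bochner_Integration.integral_nonneg) auto
    also have "(\<lambda>x. (f x * r - g x)\<^sup>2) = (\<lambda>x. (f x)\<^sup>2 * r\<^sup>2 - 2 * r * (f x * g x) + (g x)\<^sup>2)"
      by (simp add: fun_eq_iff power2_eq_square algebra_simps)
    also have "(LINT x|M. \<dots> x) = ?a * r\<^sup>2 - 2 * r * ?c + ?b"
      using f g fg by simp
    finally show ?thesis by (simp add: mult_ac)
  qed
  have a0: "0 \<le> ?a" by simp
  show ?thesis
  proof (cases "?a = 0")
    case True
    have "?c = 0"
    proof (rule ccontr)
      assume c: "?c \<noteq> 0"
      \<comment> \<open>With leading coefficient 0 the quadratic is affine in r, and at this r it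
        takes the value -1.\<close>
      show False using q[of "(?b + 1) / (2 * ?c)"] True c by (simp add: field_simps)
    qed
    then show ?thesis using True by simp
  next
    case False
    then have "0 < ?a" using a0 by linarith
    then show ?thesis using q[of "?c / ?a"] by (simp add: power2_eq_square field_simps)
  qed
qed

section \<open>Pairing identities behind the conservation laws\<close>

lemma cnj_measurable [measurable]: "cnj \<in> borel_measurable borel"
  by (intro borel_measurable_continuous_onI continuous_intros)

lemma decay_autocorrelation:
  assumes "continuous_on UNIV v" "decay 2 A v"
  shows "decay 2 (16 * A * A) (conv v (flip v))"
  using decay_conv[of v "flip v" 2 A A] assms by (simp add: continuous_borel continuous_flip)

lemma decay_cubic:
  assumes "continuous_on UNIV v" "decay 2 A v"
  shows "decay 2 (256 * A ^ 3) (cubic v)"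
  using decay_conv[of "conv v (flip v)" v 2 "16 * A * A" A] assms decay_autocorrelation[OF assms]
    continuous_conv[OF assms(1) continuous_flip[OF assms(1)] assms(2), of A]
  by (simp add: cubic_def continuous_borel power3_eq_cube mult_ac)

text \<open>Fubini: convolution with \<open>flip q\<close> is the L2 adjoint of convolution with q.
  On the physical side it says that a conjugated factor may be moved across the inner
  product.\<close>

lemma LINT_pairing:
  assumes c: "continuous_on UNIV r" "continuous_on UNIV p" "continuous_on UNIV q"
    and d: "decay 2 A r" "decay 2 B p" "decay 2 C q"
  shows "(LINT \<zeta>|lborel. cnj (r \<zeta>) * conv p (flip q) \<zeta>) = (LINT \<eta>|lborel. p \<eta> * cnj (conv r q \<eta>))"
proof -
  have [measurable]: "r \<in> borel_measurable borel" "p \<in> borel_measurable borel" "q \<in> borel_measurable borel"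
    using c by (auto intro: continuous_borel)
  have ri: "integrable lborel (\<lambda>\<zeta>. cnj (r \<zeta>))" using decay_integrable(1)[OF _ d(1)] by simp
  have pi: "integrable lborel p" using decay_integrable(1)[OF _ d(2)] by simp
  have "integrable (lborel \<Otimes>\<^sub>M lborel) (\<lambda>x. (case x of (\<zeta>, \<eta>) \<Rightarrow> cnj (r \<zeta>) * p \<eta>) * cnj (q (snd x - fst x)))"
    by (rule integrable_mult_bounded[where B=C, OF integrable_pair_prod[OF ri pi]])
       (use decay_bounded[OF d(3)] in simp_all)
  then have I: "integrable (lborel \<Otimes>\<^sub>M lborel) (\<lambda>(\<zeta>, \<eta>). cnj (r \<zeta>) * p \<eta> * cnj (q (\<eta> - \<zeta>)))"
    by (simp add: case_prod_beta')
  have "(LINT \<zeta>|lborel. cnj (r \<zeta>) * conv p (flip q) \<zeta>)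
      = (LINT \<zeta>|lborel. LINT \<eta>|lborel. cnj (r \<zeta>) * p \<eta> * cnj (q (\<eta> - \<zeta>)))"
    unfolding conv_def flip_def by (simp add: mult.assoc)
  also have "\<dots> = (LINT \<eta>|lborel. LINT \<zeta>|lborel. cnj (r \<zeta>) * p \<eta> * cnj (q (\<eta> - \<zeta>)))"
    by (rule lborel_pair.Fubini_integral[OF I, symmetric])
  also have "\<dots> = (LINT \<eta>|lborel. p \<eta> * cnj (conv r q \<eta>))"
  proof (rule Bochner_Integration.integral_cong)
    fix \<eta>
    have "(LINT \<zeta>|lborel. cnj (r \<zeta>) * p \<eta> * cnj (q (\<eta> - \<zeta>)))
        = (LINT \<zeta>|lborel. p \<eta> * cnj (r \<zeta> * q (\<eta> - \<zeta>)))"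
      by (simp add: mult_ac)
    also have "\<dots> = p \<eta> * (LINT \<zeta>|lborel. cnj (r \<zeta> * q (\<eta> - \<zeta>)))" by simp
    also have "(LINT \<zeta>|lborel. cnj (r \<zeta> * q (\<eta> - \<zeta>))) = cnj (conv r q \<eta>)"
      unfolding conv_def by (rule Bochner_Integration.integral_cnj)
    finally show "(LINT \<zeta>|lborel. cnj (r \<zeta>) * p \<eta> * cnj (q (\<eta> - \<zeta>))) = p \<eta> * cnj (conv r q \<eta>)" .
  qed simp
  finally show ?thesis .
qed

lemma flip_autocorrelation: "flip (conv v (flip v)) = conv v (flip v)"
  by (simp add: flip_conv conv_commute)

text \<open>By duality the pairing of v with \<open>cubic v\<close> is the squared L2 norm of the
  autocorrelation, hence real. This is the gauge invariance that conserves mass.\<close>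

lemma Im_cubic_pairing:
  assumes c: "continuous_on UNIV v" and d: "decay 2 A v"
  shows "(LINT \<eta>|lborel. Im (cnj (v \<eta>) * cubic v \<eta>)) = 0"
proof -
  let ?r = "conv v (flip v)"
  have rc: "continuous_on UNIV ?r" by (rule continuous_conv[OF c continuous_flip[OF c] d]) (use d in simp)
  note rd = decay_autocorrelation[OF c d]
  have Nc: "continuous_on UNIV (cubic v)" by (rule continuous_cubic[OF c d])
  have "(LINT \<eta>|lborel. v \<eta> * cnj (cubic v \<eta>)) = (LINT \<zeta>|lborel. cnj (?r \<zeta>) * ?r \<zeta>)"
    unfolding cubic_def by (rule LINT_pairing[symmetric, OF rc c c rd d d])
  also have "\<dots> = (LINT \<zeta>|lborel. complex_of_real ((cmod (?r \<zeta>))\<^sup>2))"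
    by (rule Bochner_Integration.integral_cong) (simp_all only: complex_norm_square mult.commute)
  finally have *: "Im (LINT \<eta>|lborel. v \<eta> * cnj (cubic v \<eta>)) = 0" by (simp only: integral_complex_of_real Im_complex_of_real)
  have "integrable lborel (\<lambda>\<eta>. v \<eta> * cnj (cubic v \<eta>))"
  proof (rule integrable_mult_bounded[OF decay_integrable(1)[OF continuous_borel[OF c] d]])
    show "cmod (cnj (cubic v \<eta>)) \<le> 256 * A ^ 3" for \<eta> using decay_bounded[OF decay_cubic[OF c d]] by simp
  qed (use Nc in \<open>auto intro!: continuous_borel continuous_intros\<close>)
  then have "Im (LINT \<eta>|lborel. v \<eta> * cnj (cubic v \<eta>)) = (LINT \<eta>|lborel. Im (v \<eta> * cnj (cubic v \<eta>)))"
    by (rule integral_Im[symmetric])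
  also have "\<dots> = (LINT \<eta>|lborel. - Im (cnj (v \<eta>) * cubic v \<eta>))"
    by (rule Bochner_Integration.integral_cong) (auto simp: algebra_simps)
  also have "\<dots> = - (LINT \<eta>|lborel. Im (cnj (v \<eta>) * cubic v \<eta>))" by (rule Bochner_Integration.integral_minus)
  finally show ?thesis using * by linarith
qed

text \<open>First variation of \<open>quartic\<close> in direction p. The two terms of the product
  rule are flips of each other and the autocorrelation is invariant under \<open>flip\<close>, so
  they contribute equally; together with the 2 from the square this gives 4.\<close>

lemma quartic_variation:
  assumes c: "continuous_on UNIV v" "continuous_on UNIV p" and d: "decay 2 A v" "decay 2 B p"
  defines "r \<equiv> conv v (flip v)"
  shows "(LINT \<zeta>|lborel. 2 * inner (r \<zeta>) (conv p (flip v) \<zeta> + conv v (flip p) \<zeta>))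
      = 4 * (LINT \<eta>|lborel. inner (cubic v \<eta>) (p \<eta>))"
proof -
  define X where "X = conv p (flip v)"
  have rc: "continuous_on UNIV r" unfolding r_def using c d by (intro continuous_conv continuous_flip) auto
  have rd: "decay 2 (16 * A * A) r" unfolding r_def by (rule decay_autocorrelation[OF c(1) d(1)])
  have Xc: "continuous_on UNIV X" unfolding X_def using c d by (intro continuous_conv continuous_flip) auto
  have Xd: "decay 2 (4 * 2\<^sup>2 * B * A) X" unfolding X_def using c d by (intro decay_conv) (auto intro: continuous_borel continuous_flip)
  have Y: "conv v (flip p) = flip X" by (simp add: X_def flip_conv conv_commute)
  have int: "integrable lborel (\<lambda>\<zeta>. cnj (r \<zeta>) * X \<zeta>)"
    by (rule integrable_mult_bounded[where B="4 * 2\<^sup>2 * B * A"])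
       (use rc rd Xc decay_bounded[OF Xd] in \<open>auto intro: continuous_borel decay_integrable(1)\<close>)
  then have int': "integrable lborel (\<lambda>\<zeta>. inner (r \<zeta>) (X \<zeta>))"
    using integrable_Re[OF int] by (simp add: inner_complex_def)
  have fl: "inner (r \<zeta>) (flip X \<zeta>) = inner (r (0 - \<zeta>)) (X (0 - \<zeta>))" for \<zeta>
  proof -
    have "r \<zeta> = cnj (r (- \<zeta>))" using flip_autocorrelation[of v] unfolding r_def flip_def by metis
    then show ?thesis by (simp add: flip_def inner_complex_def)
  qed
  have "(LINT \<zeta>|lborel. 2 * inner (r \<zeta>) (X \<zeta> + flip X \<zeta>))
     = (LINT \<zeta>|lborel. 2 * (inner (r \<zeta>) (X \<zeta>) + inner (r (0 - \<zeta>)) (X (0 - \<zeta>))))"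
    by (simp add: inner_add_right fl)
  also have "\<dots> = 2 * ((LINT \<zeta>|lborel. inner (r \<zeta>) (X \<zeta>)) + (LINT \<zeta>|lborel. inner (r (0 - \<zeta>)) (X (0 - \<zeta>))))"
    using int' integrable_reflect[OF int', of 0] by simp
  also have "(LINT \<zeta>|lborel. inner (r (0 - \<zeta>)) (X (0 - \<zeta>))) = (LINT \<zeta>|lborel. inner (r \<zeta>) (X \<zeta>))"
    by (rule LINT_reflect)
  also have "(LINT \<zeta>|lborel. inner (r \<zeta>) (X \<zeta>)) = Re (LINT \<zeta>|lborel. cnj (r \<zeta>) * X \<zeta>)"
    using integral_Re[OF int] by (simp add: inner_complex_def)
  also have "(LINT \<zeta>|lborel. cnj (r \<zeta>) * X \<zeta>) = (LINT \<eta>|lborel. p \<eta> * cnj (cubic v \<eta>))"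
    unfolding X_def cubic_def r_def[symmetric] by (rule LINT_pairing[OF rc c(2,1) rd d(2,1)])
  also have "Re \<dots> = (LINT \<eta>|lborel. inner (cubic v \<eta>) (p \<eta>))"
  proof -
    have "cmod (cnj (cubic v \<eta>)) \<le> 256 * A ^ 3" for \<eta> using decay_bounded[OF decay_cubic[OF c(1) d(1)]] by simp
    then have "integrable lborel (\<lambda>\<eta>. p \<eta> * cnj (cubic v \<eta>))"
      using c d by (intro integrable_mult_bounded[where B="256 * A ^ 3"] decay_integrable(1)[of p 2 B])
        (auto intro!: continuous_borel continuous_cubic continuous_intros)
    from integral_Re[OF this] show ?thesis by (simp add: inner_complex_def algebra_simps)
  qed
  finally show ?thesis unfolding X_def[symmetric] Y by simp
qed

section \<open>Interpolation inequalities\<close>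

lemma integrable_weighted_square:
  assumes c: "continuous_on UNIV v" and d: "decay 2 A v"
    and a: "a \<in> borel_measurable borel" "\<And>x. \<bar>a x\<bar> \<le> K * J x"
  shows "integrable lborel (\<lambda>x. a x * (cmod (v x))\<^sup>2)"
proof (rule integrable_norm_le[where g="\<lambda>x. (K * A\<^sup>2) / J x ^ 2"])
  fix x
  have K: "0 \<le> K" using a(2)[of 0] by (simp add: J_def)
  have "cmod (v x) \<le> A / J x ^ 2" using d by (simp add: decay_def)
  then have "(cmod (v x))\<^sup>2 \<le> (A / J x ^ 2)\<^sup>2" by (rule power_mono) simp
  then have "\<bar>a x\<bar> * (cmod (v x))\<^sup>2 \<le> (K * J x) * (A / J x ^ 2)\<^sup>2"
    using a(2)[of x] K by (intro mult_mono) auto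
  also have "\<dots> = K * A\<^sup>2 / J x ^ 3" by (simp add: field_simps power2_eq_square power3_eq_cube)
  also have "\<dots> \<le> K * A\<^sup>2 / J x ^ 2" using K by (intro divide_left_mono power_increasing) auto
  finally show "norm (a x * (cmod (v x))\<^sup>2) \<le> K * A\<^sup>2 / J x ^ 2" by (simp add: abs_mult)
qed (use c a in \<open>auto dest: continuous_borel\<close>)

definition mass :: "(real \<Rightarrow> complex) \<Rightarrow> real" where
  "mass v = (LINT x|lborel. (cmod (v x))\<^sup>2)"

definition kinetic :: "(real \<Rightarrow> complex) \<Rightarrow> real" where
  "kinetic v = (LINT x|lborel. \<bar>x\<bar> * (cmod (v x))\<^sup>2)"

definition quartic :: "(real \<Rightarrow> complex) \<Rightarrow> real" where
  "quartic v = (LINT x|lborel. (cmod (conv v (flip v) x))\<^sup>2)"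

lemma mass_kinetic_nonneg [simp]: "0 \<le> mass v" "0 \<le> kinetic v" "0 \<le> quartic v"
  unfolding mass_def kinetic_def quartic_def by (auto intro!: Bochner_Integration.integral_nonneg)

lemma mass_integrable: "continuous_on UNIV v \<Longrightarrow> decay 2 A v \<Longrightarrow> integrable lborel (\<lambda>x. (cmod (v x))\<^sup>2)"
  using integrable_weighted_square[of v A "\<lambda>_. 1" 1] by simp

lemma kinetic_integrable: "continuous_on UNIV v \<Longrightarrow> decay 2 A v \<Longrightarrow> integrable lborel (\<lambda>x. \<bar>x\<bar> * (cmod (v x))\<^sup>2)"
  using integrable_weighted_square[of v A "\<lambda>x. \<bar>x\<bar>" 1] by (simp add: J_def)

lemma LINT_inverse_square:
  fixes l :: real
  assumes "0 < l"
  shows "integrable lborel (\<lambda>x. 1 / (l + \<bar>x\<bar>)\<^sup>2)" "(LINT x|lborel. 1 / (l + \<bar>x\<bar>)\<^sup>2) = 2 / l"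
proof -
  have e: "1 / (l + \<bar>x\<bar>)\<^sup>2 = (1 / l\<^sup>2) / J (0 + (1 / l) * x) ^ 2" for x
    using assms by (simp add: J_def abs_mult field_simps flip: power_mult_distrib)
  show "integrable lborel (\<lambda>x. 1 / (l + \<bar>x\<bar>)\<^sup>2)"
    unfolding e using assms by (intro lborel_integrable_real_affine[OF integrable_inverse_J2]) auto
  have "(LINT x|lborel. (1 / l\<^sup>2) / J x ^ 2) = \<bar>1 / l\<bar> *\<^sub>R (LINT x|lborel. (1 / l\<^sup>2) / J (0 + (1 / l) * x) ^ 2)"
    by (rule lborel_integral_real_affine) (use assms in auto)
  then have "2 * (1 / l\<^sup>2) = 1 / l * (LINT x|lborel. 1 / (l + \<bar>x\<bar>)\<^sup>2)"
    unfolding e[symmetric] LINT_inverse_J2 using assms by simp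
  then show "(LINT x|lborel. 1 / (l + \<bar>x\<bar>)\<^sup>2) = 2 / l"
    using assms by (simp add: field_simps power2_eq_square)
qed

text \<open>A Gagliardo--Nirenberg inequality with a free scale \<open>l\<close>; the optimal choice of \<open>l\<close>
  gives the bound by mass times kinetic energy.\<close>
lemma quartic_le:
  assumes c: "continuous_on UNIV v" and d: "decay 2 A v" and l: "0 < l"
  shows "quartic v \<le> 2 / l * (l * mass v + kinetic v)\<^sup>2"
proof -
  define G where "G x = complex_of_real ((l + \<bar>x\<bar>) * (cmod (v x))\<^sup>2)" for x
  define r where "r = conv v (flip v)"
  note vm [measurable] = continuous_borel[OF c]
  have Gi: "integrable lborel (\<lambda>x. (l + \<bar>x\<bar>) * (cmod (v x))\<^sup>2)"
    using mass_integrable[OF c d] kinetic_integrable[OF c d] by (simp add: distrib_right)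
  then have Gi': "integrable lborel G" unfolding G_def[abs_def] by (rule integrable_of_real)
  have fGi: "integrable lborel (flip G)"
    unfolding flip_def[abs_def] using lborel_integrable_real_affine[OF Gi', of "-1" 0] by simp
  have GL: "L1norm G = l * mass v + kinetic v"
    using mass_integrable[OF c d] kinetic_integrable[OF c d] l
    by (simp add: L1norm_def G_def norm_mult distrib_right mass_def kinetic_def del: of_real_mult of_real_power of_real_add)
  have fGL: "L1norm (flip G) = L1norm G"
    using LINT_reflect[of "\<lambda>x. cmod (G x)" 0] by (simp add: L1norm_def flip_def)
  have rc: "continuous_on UNIV r" unfolding r_def by (rule continuous_conv[OF c continuous_flip[OF c] d]) (use d in simp)
  have rd: "decay 2 (16 * A * A) r" unfolding r_def by (rule decay_autocorrelation[OF c d])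
  have ri: "integrable lborel (\<lambda>x. (cmod (r x))\<^sup>2)" by (rule mass_integrable[OF rc rd])
  have bound: "(cmod (r \<zeta>))\<^sup>2 \<le> 2 / l * cmod (conv G (flip G) \<zeta>)"
    if Gint: "integrable lborel (\<lambda>\<eta>. G \<eta> * flip G (\<zeta> - \<eta>))" for \<zeta>
  proof -
    \<comment> \<open>Cauchy-Schwarz is applied after inserting the weight w and its inverse: the
      weighted part becomes a convolution of the density G, the inverse weight has integral at most
      2 / l uniformly in \<zeta>.\<close>
    define w where "w \<eta> = (l + \<bar>\<eta>\<bar>) * (l + \<bar>\<eta> - \<zeta>\<bar>)" for \<eta>
    have w: "0 < w \<eta>" for \<eta> using l by (simp add: w_def add_pos_nonneg)
    define f where "f \<eta> = sqrt (w \<eta>) * (cmod (v \<eta>) * cmod (v (\<eta> - \<zeta>)))" for \<eta>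
    define g where "g \<eta> = 1 / sqrt (w \<eta>)" for \<eta>
    have [measurable]: "w \<in> borel_measurable borel" unfolding w_def by measurable
    have f2: "(f \<eta>)\<^sup>2 = cmod (G \<eta> * flip G (\<zeta> - \<eta>))" for \<eta>
      using l w[of \<eta>] by (simp add: f_def G_def flip_def w_def norm_mult power_mult_distrib norm_power abs_of_nonneg
          del: of_real_mult of_real_power of_real_add)
    have f2i: "integrable lborel (\<lambda>\<eta>. (f \<eta>)\<^sup>2)" unfolding f2 using Gint by simp
    have g2: "(g \<eta>)\<^sup>2 = 1 / w \<eta>" for \<eta> using w[of \<eta>] by (simp add: g_def power_divide)
    define h where "h \<eta> = 1 / (l + \<bar>\<eta>\<bar>)\<^sup>2" for \<eta>
    \<comment> \<open>The arithmetic-geometric mean inequality replaces the product of two shifted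
      weights by an average of inverse squares, each of integral 2 / l.\<close>
    have g2le: "1 / w \<eta> \<le> (h \<eta> + h (\<eta> - \<zeta>)) / 2" for \<eta>
    proof -
      have "2 * (1 / (l + \<bar>\<eta>\<bar>)) * (1 / (l + \<bar>\<eta> - \<zeta>\<bar>)) \<le> (1 / (l + \<bar>\<eta>\<bar>))\<^sup>2 + (1 / (l + \<bar>\<eta> - \<zeta>\<bar>))\<^sup>2"
        by (rule sum_squares_bound)
      then show ?thesis by (simp add: w_def h_def power_divide)
    qed
    have I: "integrable lborel h" "(LINT \<eta>|lborel. h \<eta>) = 2 / l"
      using LINT_inverse_square[OF l] by (simp_all add: h_def[abs_def])
    note I' = integrable_translate[OF I(1), of \<zeta>]
    have bi: "integrable lborel (\<lambda>\<eta>. (h \<eta> + h (\<eta> - \<zeta>)) / 2)"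
      using I(1) I' by simp
    have g2i: "integrable lborel (\<lambda>\<eta>. (g \<eta>)\<^sup>2)"
      unfolding g2 using g2le w by (intro integrable_norm_le[OF bi]) (auto simp: less_imp_le)
    have "(LINT \<eta>|lborel. (g \<eta>)\<^sup>2) \<le> (LINT \<eta>|lborel. (h \<eta> + h (\<eta> - \<zeta>)) / 2)"
      using g2le by (intro integral_mono g2i bi) (auto simp: g2)
    also have "\<dots> = 2 / l"
      using I I' LINT_translate[of h \<zeta>] by simp
    finally have gI: "(LINT \<eta>|lborel. (g \<eta>)\<^sup>2) \<le> 2 / l" .
    have fg: "f \<eta> * g \<eta> = cmod (v \<eta> * flip v (\<zeta> - \<eta>))" for \<eta>
      using w[of \<eta>] by (simp add: f_def g_def norm_mult flip_def)
    have fgi: "integrable lborel (\<lambda>\<eta>. f \<eta> * g \<eta>)"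
      unfolding fg using conv_kernel_integrable[OF c continuous_flip[OF c] d, of A \<zeta>] d by simp
    have "cmod (r \<zeta>) \<le> (LINT \<eta>|lborel. f \<eta> * g \<eta>)"
      unfolding r_def conv_def fg by (rule integral_norm_bound)
    then have "(cmod (r \<zeta>))\<^sup>2 \<le> (LINT \<eta>|lborel. f \<eta> * g \<eta>)\<^sup>2" by (rule power_mono) simp
    also have "\<dots> \<le> (LINT \<eta>|lborel. (f \<eta>)\<^sup>2) * (LINT \<eta>|lborel. (g \<eta>)\<^sup>2)"
      by (rule Cauchy_Schwarz_LINT[OF f2i g2i fgi])
    also have "\<dots> \<le> (LINT \<eta>|lborel. (f \<eta>)\<^sup>2) * (2 / l)"
      by (rule mult_left_mono[OF gI]) simp
    also have "(LINT \<eta>|lborel. (f \<eta>)\<^sup>2) = cmod (conv G (flip G) \<zeta>)"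
    proof -
      have "G x = of_real (cmod (G x))" for x
        using l by (simp add: G_def abs_of_nonneg del: of_real_mult of_real_power of_real_add)
      then have "G \<eta> * flip G (\<zeta> - \<eta>) = of_real ((f \<eta>)\<^sup>2)" for \<eta>
        unfolding f2 flip_def by (metis complex_cnj_complex_of_real complex_mod_cnj norm_mult of_real_mult)
      then have "conv G (flip G) \<zeta> = of_real (LINT \<eta>|lborel. (f \<eta>)\<^sup>2)"
        by (simp only: conv_def integral_complex_of_real)
      then show ?thesis by simp
    qed
    finally show ?thesis by (simp add: mult.commute)
  qed
  \<comment> \<open>G is only known to be integrable, so its convolution kernel is integrable for
    almost every \<zeta>, which suffices for integrating the bound.\<close>
  have "AE \<zeta> in lborel. (cmod (r \<zeta>))\<^sup>2 \<le> 2 / l * cmod (conv G (flip G) \<zeta>)"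
    using lborel_pair.AE_integrable_snd[OF integrable_pair_shift[OF Gi' fGi]] by eventually_elim (rule bound)
  then have "(LINT \<zeta>|lborel. (cmod (r \<zeta>))\<^sup>2) \<le> (LINT \<zeta>|lborel. 2 / l * cmod (conv G (flip G) \<zeta>))"
    using ri conv_integrable(1)[OF Gi' fGi] by (intro integral_mono_AE) auto
  also have "\<dots> = 2 / l * L1norm (conv G (flip G))" by (simp add: L1norm_def)
  also have "\<dots> \<le> 2 / l * (L1norm G * L1norm (flip G))"
    using conv_integrable(2)[OF Gi' fGi] l by (intro mult_left_mono) auto
  finally show ?thesis by (simp add: quartic_def r_def fGL GL power2_eq_square)
qed

text \<open>Cauchy-Schwarz against w = J (1 + J / l). Since 1 / w = 1 / J - 1 / (J + l), its
  integral is only 2 ln (1 + l); the part J of w is paid by mass and kinetic energy, the part J^2 /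
  l by the pointwise decay of v.\<close>

lemma L1norm_log_bound:
  assumes c: "continuous_on UNIV v" and d: "decay k Y v" and k: "2 \<le> k"
  shows "(L1norm v)\<^sup>2 \<le> 2 * (2 * ln (1 + Y) + 1) * (mass v + kinetic v + 2)"
proof -
  have Y: "0 \<le> Y" using decay_nonneg[OF d] .
  have d2: "decay 2 Y v" by (rule decay_mono[OF d k order_refl])
  note [measurable] = continuous_borel[OF c]
  \<comment> \<open>Chosen so that Y^2 / l \<le> 1: the high-frequency part of the weighted square
    is then below 1 / J^2, whose integral is the additive 2 in the statement.\<close>
  define l where "l = 1 + Y\<^sup>2"
  have l: "1 \<le> l" by (simp add: l_def)
  define w where "w x = J x * (1 + J x / l)" for x
  have w: "0 < w x" for x using l by (simp add: w_def add_pos_nonneg)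
  have [measurable]: "w \<in> borel_measurable borel" unfolding w_def by measurable
  have "(\<integral>\<^sup>+x. ennreal (1 / (1 + \<bar>x\<bar>) - 1 / (1 + \<bar>x\<bar> + l)) \<partial>lborel) = ennreal (2 * (0 - (ln (1 + 0) - ln (1 + 0 + l))))"
  proof (rule nn_integral_even_FTC[where F="\<lambda>x. ln (1 + x) - ln (1 + x + l)" and g="\<lambda>x. 1 / (1 + x) - 1 / (1 + x + l)"])
    show "((\<lambda>x. ln (1 + x) - ln (1 + x + l)) \<longlongrightarrow> 0) at_top" using l by real_asymp
  qed (use l in \<open>auto intro!: derivative_eq_intros frac_le simp: divide_simps\<close>)
  moreover have "1 / (1 + \<bar>x\<bar>) - 1 / (1 + \<bar>x\<bar> + l) = 1 / w x" for x
    using l by (simp add: w_def J_def field_simps add_pos_nonneg)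
  ultimately have wn: "(\<integral>\<^sup>+x. ennreal (1 / w x) \<partial>lborel) = ennreal (2 * ln (1 + l))" by simp
  have hb: "has_bochner_integral lborel (\<lambda>x. 1 / w x) (2 * ln (1 + l))"
    by (rule has_bochner_integral_nn_integral) (use wn w l in \<open>auto simp: less_imp_le\<close>)
  define f where "f x = sqrt (w x) * cmod (v x)" for x
  define g where "g x = 1 / sqrt (w x)" for x
  have g2: "(g x)\<^sup>2 = 1 / w x" for x using w[of x] by (simp add: g_def power_divide)
  have fg: "f x * g x = cmod (v x)" for x using w[of x] by (simp add: f_def g_def)
  have f2: "(f x)\<^sup>2 = w x * (cmod (v x))\<^sup>2" for x using w[of x] by (simp add: f_def power_mult_distrib)
  have f2le: "(f x)\<^sup>2 \<le> (cmod (v x))\<^sup>2 + \<bar>x\<bar> * (cmod (v x))\<^sup>2 + 1 / J x ^ 2" for x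
  proof -
    have "cmod (v x) \<le> Y / J x ^ 2" using d2 by (simp add: decay_def)
    then have "(cmod (v x))\<^sup>2 \<le> (Y / J x ^ 2)\<^sup>2" by (rule power_mono) simp
    then have "J x ^ 2 / l * (cmod (v x))\<^sup>2 \<le> J x ^ 2 / l * (Y / J x ^ 2)\<^sup>2" using l by (intro mult_left_mono) auto
    also have "\<dots> = (Y\<^sup>2 / l) * (1 / J x ^ 2)" by (simp add: field_simps power2_eq_square)
    also have "\<dots> \<le> 1 * (1 / J x ^ 2)" by (intro mult_right_mono) (auto simp: l_def divide_le_eq_1 add_pos_nonneg)
    finally have "J x ^ 2 / l * (cmod (v x))\<^sup>2 \<le> 1 / J x ^ 2" by simp
    moreover have "(f x)\<^sup>2 = (cmod (v x))\<^sup>2 + \<bar>x\<bar> * (cmod (v x))\<^sup>2 + J x ^ 2 / l * (cmod (v x))\<^sup>2"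
      unfolding f2 w_def by (simp add: J_def algebra_simps power2_eq_square)
    ultimately show ?thesis by simp
  qed
  have bi: "integrable lborel (\<lambda>x. (cmod (v x))\<^sup>2 + \<bar>x\<bar> * (cmod (v x))\<^sup>2 + 1 / J x ^ 2)"
    using mass_integrable[OF c d2] kinetic_integrable[OF c d2] by simp
  have f2i: "integrable lborel (\<lambda>x. (f x)\<^sup>2)"
    using f2le by (intro integrable_norm_le[OF bi]) (auto simp: f_def)
  have "(L1norm v)\<^sup>2 = (LINT x|lborel. f x * g x)\<^sup>2" by (simp add: L1norm_def fg)
  also have "\<dots> \<le> (LINT x|lborel. (f x)\<^sup>2) * (LINT x|lborel. (g x)\<^sup>2)"
  proof (rule Cauchy_Schwarz_LINT[OF f2i])
    show "integrable lborel (\<lambda>x. (g x)\<^sup>2)" unfolding g2 using hb by (simp add: has_bochner_integral_iff)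
    show "integrable lborel (\<lambda>x. f x * g x)" unfolding fg using decay_integrable(1)[OF _ d2] by simp
  qed
  also have "(LINT x|lborel. (g x)\<^sup>2) = 2 * ln (1 + l)" unfolding g2 using hb by (simp add: has_bochner_integral_iff)
  also have "(LINT x|lborel. (f x)\<^sup>2) * (2 * ln (1 + l)) \<le> (mass v + kinetic v + 2) * (2 * (2 * ln (1 + Y) + 1))"
  proof (rule mult_mono)
    have "(LINT x|lborel. (f x)\<^sup>2) \<le> (LINT x|lborel. (cmod (v x))\<^sup>2 + \<bar>x\<bar> * (cmod (v x))\<^sup>2 + 1 / J x ^ 2)"
      using f2le by (intro integral_mono f2i bi)
    also have "\<dots> = mass v + kinetic v + 2"
      using mass_integrable[OF c d2] kinetic_integrable[OF c d2] by (simp add: mass_def kinetic_def)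
    finally show "(LINT x|lborel. (f x)\<^sup>2) \<le> mass v + kinetic v + 2" .
    \<comment> \<open>Here 1 + l = 2 + Y^2 and 2 \<le> exp 1, so the logarithm of the right-hand
      side is 1 + 2 ln (1 + Y).\<close>
    have "1 + l \<le> exp 1 * (1 + Y)\<^sup>2"
    proof -
      have "1 + l \<le> 2 * (1 + Y)\<^sup>2" using Y by (simp add: l_def power2_eq_square algebra_simps)
      also have "\<dots> \<le> exp 1 * (1 + Y)\<^sup>2" using exp_ge_add_one_self[of 1] by (intro mult_right_mono) auto
      finally show ?thesis .
    qed
    then have "ln (1 + l) \<le> ln (exp 1 * (1 + Y)\<^sup>2)" using l by simp
    also have "\<dots> = 1 + 2 * ln (1 + Y)" using Y by (simp add: ln_mult ln_realpow)
    finally show "2 * ln (1 + l) \<le> 2 * (2 * ln (1 + Y) + 1)" by simp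
  qed (use l in \<open>auto intro: add_nonneg_nonneg\<close>)
  finally show ?thesis by (simp add: mult_ac)
qed

text \<open>Two applications of \<open>conv_decay\<close> keep the weighted bound Y linear, with the
  squared L1 norm as coefficient. Inserting \<open>L1norm_log_bound\<close> turns the growth rate
  into Y (1 + ln (1 + Y)) up to a constant, which Osgood's lemma tolerates.\<close>

lemma decay_cubic_tame:
  assumes c: "continuous_on UNIV v" and d: "decay k Y v" and k: "2 \<le> k"
  shows "decay k (2 ^ k * (2 * 2 ^ k + 1) * Y * (L1norm v)\<^sup>2) (cubic v)"
proof -
  have d2: "decay 2 Y v" by (rule decay_mono[OF d k order_refl])
  note [measurable] = continuous_borel[OF c] continuous_borel[OF continuous_flip[OF c]]
  have vi: "integrable lborel v" "integrable lborel (flip v)"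
    using d k by (auto intro!: decay_integrable(1)[of _ k Y])
  have fL: "L1norm (flip v) = L1norm v"
    using LINT_reflect[of "\<lambda>x. cmod (v x)" 0] by (simp add: L1norm_def flip_def)
  have r: "decay k (2 ^ k * (Y * L1norm v + Y * L1norm v)) (conv v (flip v))"
    using conv_decay[of v "flip v" k Y Y] d k by (simp add: fL)
  have rL: "L1norm (conv v (flip v)) \<le> (L1norm v)\<^sup>2"
    using conv_integrable(2)[OF vi] by (simp add: fL power2_eq_square)
  have rc: "continuous_on UNIV (conv v (flip v))"
    by (rule continuous_conv[OF c continuous_flip[OF c] d2]) (use d2 in simp)
  have "decay k (2 ^ k * (2 ^ k * (Y * L1norm v + Y * L1norm v) * L1norm v + Y * L1norm (conv v (flip v)))) (cubic v)"
    unfolding cubic_def by (rule conv_decay[OF continuous_borel[OF rc] _ r d k]) measurable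
  then show ?thesis
  proof (rule decay_mono[OF _ order_refl])
    have "Y * L1norm (conv v (flip v)) \<le> Y * (L1norm v)\<^sup>2" using rL decay_nonneg[OF d] by (rule mult_left_mono)
    then have "2 ^ k * (2 ^ k * (Y * L1norm v + Y * L1norm v) * L1norm v + Y * L1norm (conv v (flip v)))
        \<le> 2 ^ k * (2 ^ k * (Y * L1norm v + Y * L1norm v) * L1norm v + Y * (L1norm v)\<^sup>2)" by simp
    also have "\<dots> = 2 ^ k * (2 * 2 ^ k + 1) * Y * (L1norm v)\<^sup>2" by (simp add: algebra_simps power2_eq_square)
    finally show "2 ^ k * (2 ^ k * (Y * L1norm v + Y * L1norm v) * L1norm v + Y * L1norm (conv v (flip v)))
        \<le> 2 ^ k * (2 * 2 ^ k + 1) * Y * (L1norm v)\<^sup>2" .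
  qed
qed

section \<open>Conservation laws and a priori bounds\<close>

text \<open>The right-hand side of the equation for the profile \<open>w(t, \<xi>) = exp(i t \<bar>\<xi>\<bar>) v(t, \<xi>)\<close>.\<close>
definition flow :: "real \<Rightarrow> real \<Rightarrow> (real \<Rightarrow> complex) \<Rightarrow> real \<Rightarrow> complex" where
  "flow \<mu> t f \<xi> = - \<i> * of_real \<mu> * (cis (t * \<bar>\<xi>\<bar>) * cubic (\<lambda>\<eta>. cis (- (t * \<bar>\<eta>\<bar>)) * f \<eta>) \<xi>)"

lemma jcont_phase:
  assumes "jcont w" "continuous_on UNIV (\<lambda>(t, \<xi>). h t \<xi>)"
  shows "jcont (\<lambda>t \<xi>. cis (h t \<xi>) * w t \<xi>)"
  using assms unfolding jcont_def case_prod_beta' by (auto intro!: continuous_intros)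

lemma jcont_halfwave:
  assumes "jcont w"
  shows "jcont (\<lambda>t \<xi>. cis (t * \<bar>\<xi>\<bar>) * w t \<xi>)" "jcont (\<lambda>t \<xi>. cis (- (t * \<bar>\<xi>\<bar>)) * w t \<xi>)"
  by (auto intro!: jcont_phase[OF assms] continuous_intros simp: case_prod_beta')

lemma jcont_cmult: "jcont w \<Longrightarrow> jcont (\<lambda>t \<xi>. a * w t \<xi>)"
  unfolding jcont_def case_prod_beta' by (intro continuous_intros)

lemma jcont_flow: "jcont w \<Longrightarrow> ldecay 2 w \<Longrightarrow> jcont (\<lambda>t. flow \<mu> t (w t))"
  unfolding flow_def[abs_def] by (intro jcont_cmult jcont_halfwave jcont_cubic ldecay_phase)

lemma ldecay_flow: "jcont w \<Longrightarrow> ldecay k w \<Longrightarrow> 2 \<le> k \<Longrightarrow> ldecay k (\<lambda>t. flow \<mu> t (w t))"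
  unfolding flow_def[abs_def] by (intro ldecay_cmult ldecay_cubic ldecay_phase jcont_halfwave)

lemma decay_flow_iff:
  assumes "\<bar>\<mu>\<bar> = 1"
  shows "decay k C (flow \<mu> t f) \<longleftrightarrow> decay k C (cubic (\<lambda>\<eta>. cis (- (t * \<bar>\<eta>\<bar>)) * f \<eta>))"
  using assms by (simp add: decay_def flow_def norm_mult)

lemma continuous_phase:
  "continuous_on UNIV f \<Longrightarrow> continuous_on UNIV (\<lambda>\<eta>. cis (- (t * \<bar>\<eta>\<bar>)) * f \<eta>)"
  by (intro continuous_intros)

text \<open>The equation is imposed on {0..T} only, whereas continuity and decay are asked for all
  times; solutions from \<open>weighted_picard\<close> satisfy the latter. Order 4 leaves room for
  the power of \<xi> lost in the time derivative of v.\<close>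

locale halfwave_profile =
  fixes \<mu> T :: real and k :: nat and w :: "real \<Rightarrow> real \<Rightarrow> complex"
  assumes \<mu>: "\<mu> \<in> {-1, 1}" and T: "0 \<le> T" and k: "4 \<le> k"
    and jc: "jcont w" and ld: "ldecay k w"
    and eq: "\<And>t \<xi>. t \<in> {0..T} \<Longrightarrow> w t \<xi> = w 0 \<xi> + integral {0..t} (\<lambda>s. flow \<mu> s (w s) \<xi>)"
begin

definition v where "v t \<xi> = cis (- (t * \<bar>\<xi>\<bar>)) * w t \<xi>"
definition v' where "v' t \<xi> = - \<i> * of_real \<bar>\<xi>\<bar> * v t \<xi> - \<i> * of_real \<mu> * cubic (v t) \<xi>"

lemma jcont_v: "jcont v" and ldecay_v: "ldecay k v"
  unfolding v_def[abs_def] by (intro jcont_halfwave jc ldecay_phase ld)+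

lemma continuous_v: "continuous_on UNIV (v t)" by (rule jcont_slice(1)[OF jcont_v])

lemma jcont_cubic_v: "jcont (\<lambda>t. cubic (v t))" and ldecay_cubic_v: "ldecay k (\<lambda>t. cubic (v t))"
  using k by (auto intro!: jcont_cubic ldecay_cubic jcont_v ldecay_v ldecay_mono[OF ldecay_v])

lemma jcont_flow_w: "jcont (\<lambda>t. flow \<mu> t (w t))" and ldecay_flow_w: "ldecay k (\<lambda>t. flow \<mu> t (w t))"
  using k by (auto intro!: jcont_flow ldecay_flow jc ld ldecay_mono[OF ld])

lemma flow_w: "flow \<mu> t (w t) \<xi> = - \<i> * of_real \<mu> * (cis (t * \<bar>\<xi>\<bar>) * cubic (v t) \<xi>)"
  by (simp add: flow_def v_def[abs_def])

lemma bounds: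
  "\<exists>C D. 0 \<le> C \<and> 0 \<le> D \<and> (\<forall>t\<in>{0..T}. decay 4 C (v t) \<and> decay 4 D (cubic (v t)))"
proof -
  obtain C where C: "\<And>t. \<bar>t\<bar> \<le> T \<Longrightarrow> decay 4 C (v t)" using ldecayE[OF ldecay_mono[OF ldecay_v k]] by metis
  obtain D where D: "\<And>t. \<bar>t\<bar> \<le> T \<Longrightarrow> decay 4 D (cubic (v t))"
    using ldecayE[OF ldecay_mono[OF ldecay_cubic_v k]] by metis
  show ?thesis using T C D decay_nonneg[OF C[of 0]] decay_nonneg[OF D[of 0]] by (intro exI[of _ C] exI[of _ D]) auto
qed

lemma w_deriv:
  assumes t: "t \<in> {0..T}"
  shows "((\<lambda>t. w t \<xi>) has_vector_derivative flow \<mu> t (w t) \<xi>) (at t within {0..T})"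
proof -
  have "((\<lambda>t. w 0 \<xi> + integral {0..t} (\<lambda>s. flow \<mu> s (w s) \<xi>)) has_vector_derivative flow \<mu> t (w t) \<xi>) (at t within {0..T})"
    by (subst add.commute, subst has_vector_derivative_add_const, rule integral_has_vector_derivative[OF jcont_slice(2)[OF jcont_flow_w] t])
  then show ?thesis
    by (rule has_vector_derivative_transform[OF t, rotated]) (rule eq)
qed

lemma v_deriv:
  assumes t: "t \<in> {0..T}"
  shows "((\<lambda>t. v t \<xi>) has_vector_derivative v' t \<xi>) (at t within {0..T})"
proof -
  have "((\<lambda>t. cis (- (t * \<bar>\<xi>\<bar>))) has_vector_derivative (- \<bar>\<xi>\<bar>) *\<^sub>R (\<i> * cis (- (t * \<bar>\<xi>\<bar>)))) (at t within {0..T})"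
    using exp_scaleR_has_vector_derivative_right[of "- (\<i> * of_real \<bar>\<xi>\<bar>)" t "{0..T}"]
    by (simp add: cis_conv_exp scaleR_conv_of_real mult_ac)
  from has_vector_derivative_mult[OF this w_deriv[OF t]]
  have "((\<lambda>t. v t \<xi>) has_vector_derivative
     cis (- (t * \<bar>\<xi>\<bar>)) * flow \<mu> t (w t) \<xi> + (- \<bar>\<xi>\<bar>) *\<^sub>R (\<i> * cis (- (t * \<bar>\<xi>\<bar>))) * w t \<xi>) (at t within {0..T})"
    by (simp add: v_def)
  moreover have "cis (- (t * \<bar>\<xi>\<bar>)) * cis (t * \<bar>\<xi>\<bar>) = 1" by (simp add: cis_mult)
  then have "cis (- (t * \<bar>\<xi>\<bar>)) * flow \<mu> t (w t) \<xi> = - \<i> * of_real \<mu> * cubic (v t) \<xi>"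
    unfolding flow_w by (simp add: mult.assoc[symmetric] mult.commute[of "cis (- (t * \<bar>\<xi>\<bar>))"])
  ultimately have "((\<lambda>t. v t \<xi>) has_vector_derivative
     - \<i> * of_real \<mu> * cubic (v t) \<xi> + (- \<bar>\<xi>\<bar>) *\<^sub>R (\<i> * cis (- (t * \<bar>\<xi>\<bar>))) * w t \<xi>) (at t within {0..T})" by simp
  then show ?thesis
    by (rule has_vector_derivative_eq_rhs) (simp add: v'_def v_def scaleR_conv_of_real mult_ac)
qed

text \<open>Each inner product kills one of the two terms of v', since multiplication by \<i> is
  skew. Against v only the nonlinear term survives, against \<open>cubic (v t)\<close> only the
  linear one, and what remains is in both cases the same imaginary part; this is why mass and energy
  close.\<close>

lemma inner_v': "inner (v t \<xi>) (v' t \<xi>) = \<mu> * Im (cnj (v t \<xi>) * cubic (v t) \<xi>)"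
  by (simp add: inner_complex_def v'_def algebra_simps)

lemma inner_cubic_v': "inner (cubic (v t) \<xi>) (v' t \<xi>) = - (\<bar>\<xi>\<bar> * Im (cnj (v t \<xi>) * cubic (v t) \<xi>))"
  by (simp add: inner_complex_def v'_def algebra_simps)

lemma v'_decay:
  assumes "decay 4 C (v t)" "decay 4 D (cubic (v t))"
  shows "decay 2 (C + D) (v' t)"
proof (rule decay_mono[of 3])
  have "decay 3 C (\<lambda>\<xi>. - \<i> * of_real \<bar>\<xi>\<bar> * v t \<xi>)"
    unfolding decay_def
  proof
    fix \<xi>
    have "\<bar>\<xi>\<bar> * cmod (v t \<xi>) \<le> J \<xi> * (C / J \<xi> ^ 4)"
      using assms(1) by (intro mult_mono) (auto simp: decay_def J_def)
    also have "\<dots> = C / J \<xi> ^ 3" by (simp add: field_simps eval_nat_numeral)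
    finally show "cmod (- \<i> * of_real \<bar>\<xi>\<bar> * v t \<xi>) \<le> C / J \<xi> ^ 3" by (simp add: norm_mult)
  qed
  moreover have "decay 3 D (\<lambda>\<xi>. \<i> * of_real \<mu> * cubic (v t) \<xi>)"
    using decay_cmult[OF decay_mono[OF assms(2), of 3 D], of "\<i> * of_real \<mu>"] \<mu> by (auto simp: norm_mult)
  ultimately show "decay 3 (C + D) (v' t)" unfolding v'_def[abs_def] by (rule decay_diff)
qed auto

lemma continuous_v': "continuous_on UNIV (v' t)"
  unfolding v'_def[abs_def] by (intro continuous_intros continuous_v jcont_slice(1)[OF jcont_cubic_v])

text \<open>The general weight a covers the mass with a = 1 and the kinetic energy with a = |x| in
  one differentiation.\<close>

lemma weighted_square_deriv:
  assumes a: "a \<in> borel_measurable borel" "\<And>x. \<bar>a x\<bar> \<le> J x" and t: "t \<in> {0..T}"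
  shows "((\<lambda>t. LINT x|lborel. a x * (cmod (v t x))\<^sup>2) has_vector_derivative
     2 * \<mu> * (LINT x|lborel. a x * Im (cnj (v t x) * cubic (v t) x))) (at t within {0..T})"
proof -
  obtain C D where CD: "\<And>t. t \<in> {0..T} \<Longrightarrow> decay 4 C (v t)" "\<And>t. t \<in> {0..T} \<Longrightarrow> decay 4 D (cubic (v t))"
    and nn: "0 \<le> C" "0 \<le> D" using bounds by blast
  note [measurable] = a(1) continuous_borel[OF continuous_v] continuous_borel[OF jcont_slice(1)[OF jcont_cubic_v]]
  have "((\<lambda>t. LINT x|lborel. a x * (cmod (v t x))\<^sup>2) has_vector_derivative
     (LINT x|lborel. a x * (2 * (\<mu> * Im (cnj (v t x) * cubic (v t) x))))) (at t within {0..T})"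
  proof (rule has_vector_derivative_LINT[where g="\<lambda>x. (2 * C * D) / J x ^ 2"])
    fix s assume s: "s \<in> {0..T}"
    show "integrable lborel (\<lambda>x. a x * (cmod (v s x))\<^sup>2)"
      by (rule integrable_weighted_square[where K=1, OF continuous_v decay_mono[OF CD(1)[OF s]]]) (use a in auto)
    fix x
    have "((\<lambda>t. inner (v t x) (v t x)) has_vector_derivative (inner (v s x) (v' s x) + inner (v' s x) (v s x))) (at s within {0..T})"
      by (rule bounded_bilinear.has_vector_derivative[OF bounded_bilinear_inner v_deriv[OF s] v_deriv[OF s]])
    then have "((\<lambda>t. (cmod (v t x))\<^sup>2) has_vector_derivative 2 * (\<mu> * Im (cnj (v s x) * cubic (v s) x))) (at s within {0..T})"
      unfolding inner_commute[of "v' s x"] inner_v' by (simp add: power2_norm_eq_inner)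
    from bounded_linear.has_vector_derivative[OF bounded_linear_mult_right this, of "a x"]
    show "((\<lambda>t. a x * (cmod (v t x))\<^sup>2) has_vector_derivative a x * (2 * (\<mu> * Im (cnj (v s x) * cubic (v s) x)))) (at s within {0..T})" .
    have "\<bar>Im (cnj (v s x) * cubic (v s) x)\<bar> \<le> cmod (v s x) * cmod (cubic (v s) x)"
      using abs_Im_le_cmod[of "cnj (v s x) * cubic (v s) x"] by (simp add: norm_mult)
    also have "\<dots> \<le> (C / J x ^ 4) * (D / J x ^ 4)"
      using CD(1)[OF s] CD(2)[OF s] nn by (intro mult_mono) (auto simp: decay_def)
    finally have "\<bar>a x\<bar> * (2 * \<bar>Im (cnj (v s x) * cubic (v s) x)\<bar>) \<le> J x * (2 * ((C / J x ^ 4) * (D / J x ^ 4)))"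
      using a(2)[of x] by (intro mult_mono) auto
    also have "\<dots> = 2 * C * D / J x ^ 7" by (simp add: field_simps eval_nat_numeral)
    also have "\<dots> \<le> 2 * C * D / J x ^ 2" using nn by (intro divide_left_mono power_increasing) auto
    finally show "norm (a x * (2 * (\<mu> * Im (cnj (v s x) * cubic (v s) x)))) \<le> 2 * C * D / J x ^ 2"
      using \<mu> by (auto simp: abs_mult)
  qed (use t in auto)
  moreover have "(LINT x|lborel. a x * (2 * (\<mu> * Im (cnj (v t x) * cubic (v t) x))))
     = (LINT x|lborel. (2 * \<mu>) * (a x * Im (cnj (v t x) * cubic (v t) x)))"
    by (rule Bochner_Integration.integral_cong) auto
  ultimately show ?thesis by simp
qed

text \<open>Differentiation under the integral is used twice, in the convolution and in its L2 norm;
  \<open>quartic_variation\<close> then leaves the pairing of \<open>cubic (v t)\<close> with v',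
  where only the linear part of the equation contributes.\<close>

lemma quartic_deriv:
  assumes t: "t \<in> {0..T}"
  shows "((\<lambda>t. quartic (v t)) has_vector_derivative
     - 4 * (LINT x|lborel. \<bar>x\<bar> * Im (cnj (v t x) * cubic (v t) x))) (at t within {0..T})"
proof -
  obtain C D where CD: "\<And>t. t \<in> {0..T} \<Longrightarrow> decay 4 C (v t)" "\<And>t. t \<in> {0..T} \<Longrightarrow> decay 4 D (cubic (v t))"
    and nn: "0 \<le> C" "0 \<le> D" using bounds by blast
  define E where "E = C + D"
  have d: "decay 2 C (v s)" "decay 2 E (v' s)" if "s \<in> {0..T}" for s
    using decay_mono[OF CD(1)[OF that], of 2 C] v'_decay[OF CD(1)[OF that] CD(2)[OF that]] by (auto simp: E_def)
  have E: "0 \<le> E" using nn by (simp add: E_def)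
  define r where "r s = conv (v s) (flip (v s))" for s
  define r' where "r' s \<zeta> = conv (v' s) (flip (v s)) \<zeta> + conv (v s) (flip (v' s)) \<zeta>" for s \<zeta>
  have rc: "continuous_on UNIV (r s)" if "s \<in> {0..T}" for s
    unfolding r_def by (rule continuous_conv[OF continuous_v continuous_flip[OF continuous_v] d(1)[OF that], of C]) (use d[OF that] in simp)
  have r'c: "continuous_on UNIV (r' s)" if "s \<in> {0..T}" for s
    unfolding r'_def
    by (intro continuous_intros continuous_conv[where A=E and B=C] continuous_conv[where A=C and B=E]
          continuous_v continuous_v' continuous_flip) (use d[OF that] in auto)
  have rd: "decay 2 (16 * C * C) (r s)" if "s \<in> {0..T}" for s
    unfolding r_def by (rule decay_autocorrelation[OF continuous_v d(1)[OF that]])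
  have r'd: "decay 2 (4 * 2\<^sup>2 * E * C + 4 * 2\<^sup>2 * C * E) (r' s)" if "s \<in> {0..T}" for s
    unfolding r'_def
    by (intro decay_add decay_conv) (use d[OF that] in \<open>auto intro!: continuous_borel continuous_v continuous_v' continuous_flip\<close>)
  have rder: "((\<lambda>s. r s \<zeta>) has_vector_derivative r' s \<zeta>) (at s within {0..T})" if s: "s \<in> {0..T}" for s \<zeta>
  proof -
    have int: "integrable lborel (\<lambda>\<eta>. v' s \<eta> * flip (v s) (\<zeta> - \<eta>))" "integrable lborel (\<lambda>\<eta>. v s \<eta> * flip (v' s) (\<zeta> - \<eta>))"
      using conv_kernel_integrable[OF continuous_v' continuous_flip[OF continuous_v] d(2)[OF s], of C s \<zeta>]
        conv_kernel_integrable[OF continuous_v continuous_flip[OF continuous_v'] d(1)[OF s], of E s \<zeta>] d[OF s] by auto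
    have "((\<lambda>s. LINT \<eta>|lborel. v s \<eta> * flip (v s) (\<zeta> - \<eta>)) has_vector_derivative
       (LINT \<eta>|lborel. v s \<eta> * flip (v' s) (\<zeta> - \<eta>) + v' s \<eta> * flip (v s) (\<zeta> - \<eta>))) (at s within {0..T})"
    proof (rule has_vector_derivative_LINT[where g="\<lambda>\<eta>. (C * E + E * C) / J \<eta> ^ 2"])
      fix q assume q: "q \<in> {0..T}"
      show "integrable lborel (\<lambda>\<eta>. v q \<eta> * flip (v q) (\<zeta> - \<eta>))"
        using d[OF q] by (auto intro!: conv_kernel_integrable[where A=C and B=C] continuous_v continuous_flip)
      fix \<eta>
      have "((\<lambda>q. flip (v q) (\<zeta> - \<eta>)) has_vector_derivative flip (v' q) (\<zeta> - \<eta>)) (at q within {0..T})"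
        unfolding flip_def by (rule bounded_linear.has_vector_derivative[OF bounded_linear_cnj v_deriv[OF q]])
      from has_vector_derivative_mult[OF v_deriv[OF q] this]
      show "((\<lambda>q. v q \<eta> * flip (v q) (\<zeta> - \<eta>)) has_vector_derivative
         (v q \<eta> * flip (v' q) (\<zeta> - \<eta>) + v' q \<eta> * flip (v q) (\<zeta> - \<eta>))) (at q within {0..T})" .
      have "cmod (v q \<eta> * flip (v' q) (\<zeta> - \<eta>)) \<le> (C / J \<eta> ^ 2) * E"
        unfolding norm_mult using d[OF q] nn decay_bounded[of 2 E "flip (v' q)"]
        by (intro mult_mono) (simp_all, simp add: decay_def)
      moreover have "cmod (v' q \<eta> * flip (v q) (\<zeta> - \<eta>)) \<le> (E / J \<eta> ^ 2) * C"
        unfolding norm_mult using d[OF q] E decay_bounded[of 2 C "flip (v q)"]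
        by (intro mult_mono) (simp_all, simp add: decay_def)
      ultimately show "cmod (v q \<eta> * flip (v' q) (\<zeta> - \<eta>) + v' q \<eta> * flip (v q) (\<zeta> - \<eta>)) \<le> (C * E + E * C) / J \<eta> ^ 2"
        unfolding add_divide_distrib by (intro order_trans[OF norm_triangle_ineq] add_mono) auto
    qed (use s int in \<open>auto intro: integrable_inverse_J\<close>)
    then show ?thesis using int by (simp add: r_def r'_def conv_def add.commute)
  qed
  have "((\<lambda>t. LINT \<zeta>|lborel. (cmod (r t \<zeta>))\<^sup>2) has_vector_derivative
     (LINT \<zeta>|lborel. 2 * inner (r t \<zeta>) (r' t \<zeta>))) (at t within {0..T})"
  proof (rule has_vector_derivative_LINT[where g="\<lambda>\<zeta>. (2 * (16 * C * C) * (4 * 2\<^sup>2 * E * C + 4 * 2\<^sup>2 * C * E)) / J \<zeta> ^ 2"])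
    fix s assume s: "s \<in> {0..T}"
    show "integrable lborel (\<lambda>\<zeta>. (cmod (r s \<zeta>))\<^sup>2)" by (rule mass_integrable[OF rc[OF s] rd[OF s]])
    fix \<zeta>
    have "((\<lambda>s. inner (r s \<zeta>) (r s \<zeta>)) has_vector_derivative (inner (r s \<zeta>) (r' s \<zeta>) + inner (r' s \<zeta>) (r s \<zeta>))) (at s within {0..T})"
      by (rule bounded_bilinear.has_vector_derivative[OF bounded_bilinear_inner rder[OF s] rder[OF s]])
    then show "((\<lambda>s. (cmod (r s \<zeta>))\<^sup>2) has_vector_derivative 2 * inner (r s \<zeta>) (r' s \<zeta>)) (at s within {0..T})"
      unfolding inner_commute[of "r' s \<zeta>"] by (simp add: power2_norm_eq_inner)
    have "\<bar>inner (r s \<zeta>) (r' s \<zeta>)\<bar> \<le> cmod (r s \<zeta>) * cmod (r' s \<zeta>)" by (rule Cauchy_Schwarz_ineq2)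
    also have "\<dots> \<le> ((16 * C * C) / J \<zeta> ^ 2) * (4 * 2\<^sup>2 * E * C + 4 * 2\<^sup>2 * C * E)"
      using rd[OF s] decay_bounded[OF r'd[OF s]] nn by (intro mult_mono) (auto simp: decay_def)
    finally show "norm (2 * inner (r s \<zeta>) (r' s \<zeta>)) \<le> (2 * (16 * C * C) * (4 * 2\<^sup>2 * E * C + 4 * 2\<^sup>2 * C * E)) / J \<zeta> ^ 2"
      by (simp add: abs_mult)
  qed (use t in \<open>auto intro!: continuous_borel continuous_intros rc r'c\<close>)
  moreover have "(LINT \<zeta>|lborel. 2 * inner (r t \<zeta>) (r' t \<zeta>)) = 4 * (LINT x|lborel. inner (cubic (v t) x) (v' t x))"
    unfolding r_def r'_def by (rule quartic_variation[OF continuous_v continuous_v' d[OF t]])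
  ultimately show ?thesis by (simp add: quartic_def r_def inner_cubic_v')
qed

lemma mass_conserved: assumes t: "t \<in> {0..T}" shows "mass (v t) = mass (v 0)"
proof -
  have "((\<lambda>t. mass (v t)) has_derivative (\<lambda>h. 0)) (at s within {0..T})" if s: "s \<in> {0..T}" for s
  proof -
    obtain C D where "decay 4 C (v s)" using bounds s by metis
    then have "(LINT x|lborel. Im (cnj (v s x) * cubic (v s) x)) = 0"
      by (intro Im_cubic_pairing[OF continuous_v decay_mono]) auto
    then show ?thesis using weighted_square_deriv[of "\<lambda>_. 1", OF _ _ s]
      by (simp add: mass_def has_vector_derivative_def)
  qed
  from has_derivative_zero_constant[OF _ this] obtain c where "\<forall>s\<in>{0..T}. mass (v s) = c" by auto
  then show ?thesis using t T by auto
qed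

text \<open>With I the weighted imaginary part, the kinetic term changes at rate 2 \<mu> I and the
  quartic term at rate -4 I, so the weight \<mu> / 2 makes the sum stationary.\<close>

lemma energy_conserved:
  assumes t: "t \<in> {0..T}"
  shows "kinetic (v t) + \<mu> / 2 * quartic (v t) = kinetic (v 0) + \<mu> / 2 * quartic (v 0)"
proof -
  have "((\<lambda>t. kinetic (v t) + \<mu> / 2 * quartic (v t)) has_derivative (\<lambda>h. 0)) (at s within {0..T})" if s: "s \<in> {0..T}" for s
  proof -
    let ?I = "LINT x|lborel. \<bar>x\<bar> * Im (cnj (v s x) * cubic (v s) x)"
    have "((\<lambda>t. kinetic (v t)) has_vector_derivative 2 * \<mu> * ?I) (at s within {0..T})"
      unfolding kinetic_def by (rule weighted_square_deriv[OF _ _ s]) (auto simp: J_def)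
    from has_vector_derivative_add[OF this bounded_linear.has_vector_derivative[OF bounded_linear_mult_right quartic_deriv[OF s], of "\<mu> / 2"]]
    show ?thesis by (simp add: has_vector_derivative_def)
  qed
  from has_derivative_zero_constant[OF _ this] obtain c where "\<forall>s\<in>{0..T}. kinetic (v s) + \<mu> / 2 * quartic (v s) = c" by auto
  then show ?thesis using t T by auto
qed

text \<open>For \<mu> = 1 both energy terms are nonnegative. For \<mu> = -1 small mass makes the
  quartic term at most the kinetic one, so the energy still dominates half of the kinetic
  energy.\<close>

lemma kinetic_bound:
  assumes t: "t \<in> {0..T}" and m: "mass (v 0) \<le> 1 / 8"
  shows "kinetic (v t) \<le> 2 * kinetic (v 0) + quartic (v 0)"
proof -
  note E = energy_conserved[OF t]
  have nn: "0 \<le> kinetic (v t)" "0 \<le> quartic (v t)" "0 \<le> kinetic (v 0)" "0 \<le> quartic (v 0)" by auto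
  show ?thesis
  proof (cases "\<mu> = 1 \<or> kinetic (v t) = 0")
    case True
    then show ?thesis
    proof
      assume "\<mu> = 1"
      show ?thesis using E nn unfolding \<open>\<mu> = 1\<close> by linarith
    qed (use nn in linarith)
  next
    case False
    then have \<mu>1: "\<mu> = -1" and H: "0 < kinetic (v t)" using \<mu> nn(1) by (auto simp: less_le)
    let ?H = "kinetic (v t)"
    obtain C D where "decay 4 C (v t)" using bounds t by metis
    \<comment> \<open>The scale l = 8 H, with H the current kinetic energy, balances l * mass
      against H when the mass is at most 1 / 8, and the right-hand side collapses to H.\<close>
    then have "quartic (v t) \<le> 2 / (8 * ?H) * ((8 * ?H) * mass (v t) + ?H)\<^sup>2"
      using H by (intro quartic_le[OF continuous_v decay_mono]) auto
    also have "\<dots> \<le> 2 / (8 * ?H) * (2 * ?H)\<^sup>2"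
    proof -
      have "(8 * ?H) * mass (v t) \<le> (8 * ?H) * (1 / 8)" using mass_conserved[OF t] m H by (intro mult_left_mono) auto
      then have "(8 * ?H) * mass (v t) + ?H \<le> 2 * ?H" by simp
      then have "((8 * ?H) * mass (v t) + ?H)\<^sup>2 \<le> (2 * ?H)\<^sup>2" using H by (intro power_mono) auto
      then show ?thesis using H by (intro mult_left_mono) auto
    qed
    also have "\<dots> = ?H" using H by (simp add: power2_eq_square)
    finally have "quartic (v t) \<le> ?H" .
    then show ?thesis using E nn unfolding \<mu>1 by linarith
  qed
qed

text \<open>The logarithm from \<open>L1norm_log_bound\<close> makes the differential inequality for the weighted
  supremum norm of Osgood type, so the norm stays finite on bounded time intervals.\<close>
lemma nrm_bound:
  assumes t: "t \<in> {0..T}" and m: "mass (v 0) \<le> 1 / 8"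
  shows "nrm k (w t) \<le> osgood_bound (nrm k (w 0))
     (4 * (2 ^ k * (2 * 2 ^ k + 1)) * (mass (v 0) + (2 * kinetic (v 0) + quartic (v 0)) + 2)) t"
proof -
  define c :: real where "c = 2 ^ k * (2 * 2 ^ k + 1)"
  define B where "B = mass (v 0) + (2 * kinetic (v 0) + quartic (v 0)) + 2"
  have c: "0 \<le> c" by (simp add: c_def)
  have B: "0 \<le> B" by (simp add: B_def)
  define y where "y t = nrm k (w t)" for t
  have wd: "decay k (y t) (w t)" for t unfolding y_def using ldecay_slice[OF ld] decay_nrm by blast
  have vd: "decay k (y t) (v t)" for t unfolding v_def using wd by (simp add: decay_phase)
  have y0: "0 \<le> y t" for t using wd decay_nonneg by blast
  have yc: "continuous_on {0..T} y"
    unfolding y_def by (rule continuous_nrm[OF jcont_flow_w ldecay_flow_w ld eq])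
  have Nd: "decay k (4 * c * B * (y s * (1 + ln (1 + y s)))) (flow \<mu> s (w s))" if s: "s \<in> {0..T}" for s
  proof -
    have \<mu>': "\<bar>\<mu>\<bar> = 1" using \<mu> by auto
    have ln0: "0 \<le> ln (1 + y s)" using y0 by simp
    have "decay k (c * y s * (L1norm (v s))\<^sup>2) (cubic (v s))"
      unfolding c_def using k by (intro decay_cubic_tame[OF continuous_v vd]) auto
    moreover have "c * y s * (L1norm (v s))\<^sup>2 \<le> 4 * c * B * (y s * (1 + ln (1 + y s)))"
    proof -
      have "(L1norm (v s))\<^sup>2 \<le> 2 * (2 * ln (1 + y s) + 1) * (mass (v s) + kinetic (v s) + 2)"
        using k by (intro L1norm_log_bound[OF continuous_v vd]) auto
      also have "\<dots> \<le> 4 * (1 + ln (1 + y s)) * B"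
      proof (rule mult_mono)
        show "2 * (2 * ln (1 + y s) + 1) \<le> 4 * (1 + ln (1 + y s))" by (simp add: algebra_simps)
        show "mass (v s) + kinetic (v s) + 2 \<le> B" using mass_conserved[OF s] kinetic_bound[OF s m] by (simp add: B_def)
        show "0 \<le> 4 * (1 + ln (1 + y s))" by (intro mult_nonneg_nonneg add_nonneg_nonneg ln0) auto
        show "0 \<le> mass (v s) + kinetic (v s) + 2" using mass_kinetic_nonneg[of "v s"] by linarith
      qed
      finally have "c * y s * (L1norm (v s))\<^sup>2 \<le> c * y s * (4 * (1 + ln (1 + y s)) * B)"
        using c y0[of s] by (intro mult_left_mono) auto
      then show ?thesis by (simp add: mult_ac)
    qed
    ultimately show ?thesis
      unfolding decay_flow_iff[OF \<mu>'] using decay_mono[OF _ order_refl] by (simp add: v_def[abs_def])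
  qed
  have "y t \<le> osgood_bound (y 0) (4 * c * B) t"
  proof (rule osgood[OF yc y0 _ y0 _ t])
    fix s assume s: "s \<in> {0..T}"
    have D: "continuous_on {0..s} (\<lambda>s. 4 * c * B * (y s * (1 + ln (1 + y s))))"
    proof -
      have "continuous_on {0..s} y" by (rule continuous_on_subset[OF yc]) (use s in auto)
      moreover have "1 + y r \<noteq> 0" for r using y0[of r] by linarith
      ultimately show ?thesis by (intro continuous_intros) auto
    qed
    have "decay k (integral {0..s} (\<lambda>s. 4 * c * B * (y s * (1 + ln (1 + y s))))) (\<lambda>\<xi>. integral {0..s} (\<lambda>r. flow \<mu> r (w r) \<xi>))"
      by (rule decay_integral[OF jcont_flow_w _ D]) (use s in \<open>auto intro!: Nd\<close>)
    from decay_add[OF wd[of 0] this]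
    have "decay k (y 0 + integral {0..s} (\<lambda>s. 4 * c * B * (y s * (1 + ln (1 + y s))))) (w s)"
      by (subst ext[OF eq[OF s]]) assumption
    then show "y s \<le> y 0 + integral {0..s} (\<lambda>s. 4 * c * B * (y s * (1 + ln (1 + y s))))"
      unfolding y_def[of s] by (rule nrm_le)
  qed (use c B in auto)
  then show ?thesis by (simp add: y_def c_def B_def)
qed

end

section \<open>Global flow on the Fourier side\<close>

text \<open>Nearest-point projection onto the disc of radius r, expressed through the fixed unit
  disc. Convexity makes it nonexpansive, and it stays continuous when the radius varies with the
  frequency.\<close>

definition clip :: "real \<Rightarrow> complex \<Rightarrow> complex" where
  "clip r z = r *\<^sub>R closest_point (cball 0 1) (z /\<^sub>R r)"

lemma norm_clip: "0 < r \<Longrightarrow> norm (clip r z) \<le> r"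
  using closest_point_in_set[of "cball 0 1" "z /\<^sub>R r"] by (simp add: clip_def mult_left_le)

lemma clip_id: "0 < r \<Longrightarrow> norm z \<le> r \<Longrightarrow> clip r z = z"
  by (simp add: clip_def closest_point_self field_simps)

lemma clip_lipschitz: assumes "0 < r" shows "norm (clip r z - clip r z') \<le> norm (z - z')"
proof -
  have "norm (clip r z - clip r z') = r * dist (closest_point (cball 0 1) (z /\<^sub>R r)) (closest_point (cball 0 1) (z' /\<^sub>R r))"
    using assms by (simp add: clip_def dist_norm flip: scaleR_diff_right)
  also have "\<dots> \<le> r * dist (z /\<^sub>R r) (z' /\<^sub>R r)"
    using assms by (intro mult_left_mono closest_point_lipschitz) auto
  also have "\<dots> = norm (z - z')" using assms by (simp add: dist_norm flip: scaleR_diff_right)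
  finally show ?thesis .
qed

text \<open>Truncating the values pointwise makes the cubic term globally Lipschitz and keeps joint
  continuity; it does not affect solutions whose weighted norm stays below \<open>R\<close>.\<close>
definition Clip :: "nat \<Rightarrow> real \<Rightarrow> (real \<Rightarrow> complex) \<Rightarrow> real \<Rightarrow> complex" where
  "Clip k R f \<xi> = clip (R / J \<xi> ^ k) (f \<xi>)"

lemma jcont_Clip: assumes "jcont w" "0 < R" shows "jcont (\<lambda>t. Clip k R (w t))"
  using assms(2)
  unfolding jcont_def Clip_def clip_def case_prod_beta'
  by (intro continuous_intros continuous_on_compose2[OF continuous_on_closest_point[of "cball 0 1" UNIV]] jcont_compose[OF assms(1)])
     auto

lemma decay_Clip: "0 < R \<Longrightarrow> decay k R (Clip k R f)"
  by (simp add: decay_def Clip_def norm_clip)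

lemma ldecay_Clip: "0 < R \<Longrightarrow> ldecay k (\<lambda>t. Clip k R (w t))"
  using decay_Clip unfolding ldecay_def by blast

lemma Clip_id: "0 < R \<Longrightarrow> decay k R f \<Longrightarrow> Clip k R f = f"
  by (rule ext) (simp add: decay_def Clip_def clip_id)

lemma decay_Clip_diff:
  assumes "0 < R" "decay k D (\<lambda>\<xi>. f \<xi> - g \<xi>)"
  shows "decay k D (\<lambda>\<xi>. Clip k R f \<xi> - Clip k R g \<xi>)"
  using assms(2) clip_lipschitz[of "R / J _ ^ k"] assms(1) unfolding decay_def Clip_def by (metis J_pos divide_pos_pos order_trans zero_less_power)

lemma continuous_Clip: "continuous_on UNIV f \<Longrightarrow> 0 < R \<Longrightarrow> continuous_on UNIV (Clip k R f)"
  using jcont_slice(1)[OF jcont_Clip[OF jcont_const]] by blast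

lemma decay_flow_diff:
  assumes \<mu>: "\<bar>\<mu>\<bar> = 1" and c: "continuous_on UNIV f" "continuous_on UNIV g" and k: "2 \<le> k"
    and d: "decay k A f" "decay k A g" "decay k D (\<lambda>x. f x - g x)"
  shows "decay k (48 * 4 ^ k * A\<^sup>2 * D) (\<lambda>x. flow \<mu> t f x - flow \<mu> t g x)"
proof -
  let ?f = "\<lambda>\<eta>. cis (- (t * \<bar>\<eta>\<bar>)) * f \<eta>" and ?g = "\<lambda>\<eta>. cis (- (t * \<bar>\<eta>\<bar>)) * g \<eta>"
  have "decay k D (\<lambda>x. ?f x - ?g x)"
    using d(3) decay_phase[of k D "\<lambda>\<eta>. - (t * \<bar>\<eta>\<bar>)" "\<lambda>x. f x - g x"] by (simp add: right_diff_distrib)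
  then have "decay k (48 * 4 ^ k * A\<^sup>2 * D) (\<lambda>x. cubic ?f x - cubic ?g x)"
    using c d k by (intro decay_cubic_diff continuous_phase) (simp_all add: decay_phase)
  moreover have "flow \<mu> t f x - flow \<mu> t g x = (- \<i> * of_real \<mu> * cis (t * \<bar>x\<bar>)) * (cubic ?f x - cubic ?g x)" for x
    by (simp add: flow_def algebra_simps)
  ultimately show ?thesis using \<mu> by (simp add: decay_def norm_mult)
qed

lemma flow_zero [simp]: "flow \<mu> t (\<lambda>_. 0) \<xi> = 0"
  by (simp add: flow_def cubic_def conv_def)

lemma osgood_bound_mono: "0 \<le> K \<Longrightarrow> s \<le> t \<Longrightarrow> osgood_bound a K s \<le> osgood_bound a K t"
  by (simp add: osgood_bound_def mult_left_mono)

lemma halfwave_profile_subset: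
  assumes "halfwave_profile \<mu> T k w" "0 \<le> T'" "T' \<le> T" "4 \<le> j" "j \<le> k"
  shows "halfwave_profile \<mu> T' j w"
proof -
  interpret halfwave_profile \<mu> T k w by fact
  show ?thesis
    using assms by (intro halfwave_profile.intro \<mu> jc ldecay_mono[OF ld] eq) auto
qed

text \<open>The truncated equation has a global solution by \<open>weighted_picard\<close>.
  Conservation laws hold only for the true equation, so they are applied up to the time when the
  norm could first reach R; the resulting bound shows that this never happens before T.\<close>

theorem halfwave_profile_exists:
  assumes \<mu>: "\<mu> \<in> {-1, 1}" and T: "0 \<le> T" and k: "4 \<le> k"
    and f: "continuous_on UNIV f" "decay k C f" "mass f \<le> 1 / 8"
  obtains w where "halfwave_profile \<mu> T k w" "w 0 = f"
proof -
  define K where "K = 4 * (2 ^ k * (2 * 2 ^ k + 1)) * (mass f + (2 * kinetic f + quartic f) + 2)"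
  have K: "0 \<le> K" by (simp add: K_def)
  \<comment> \<open>The a priori bound at the final time, which depends only on the datum, plus 1 to
    obtain the strict inequality of the bootstrap.\<close>
  define R where "R = osgood_bound (nrm k f) K T + 1"
  have R: "0 < R" by (simp add: R_def osgood_bound_def add_pos_pos)
  have \<mu>': "\<bar>\<mu>\<bar> = 1" using \<mu> by auto
  define G where "G t g = flow \<mu> t (Clip k R g)" for t g
  have Gj: "jcont (\<lambda>t. G t (w t))" if "jcont w" for w
    unfolding G_def using k R by (intro jcont_flow jcont_Clip that ldecay_mono[OF ldecay_Clip[of R k]]) auto
  have Gl: "ldecay k (\<lambda>t. G t (w t))" if "jcont w" for w
    unfolding G_def using k R by (intro ldecay_flow jcont_Clip that ldecay_Clip) auto
  obtain w where w: "jcont w" "ldecay k w" and eq: "\<And>t \<xi>. w t \<xi> = f \<xi> + integral {0..t} (\<lambda>s. G s (w s) \<xi>)"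
  proof (rule weighted_picard[where G=G and L="48 * 4 ^ k * R\<^sup>2" and k=k, OF _ _ _ Gj f(1,2)])
    fix t g h A B D
    assume *: "continuous_on UNIV g" "continuous_on UNIV h" "decay k D (\<lambda>\<xi>. g \<xi> - h \<xi>)"
    show "decay k (48 * 4 ^ k * R\<^sup>2 * D) (\<lambda>\<xi>. G t g \<xi> - G t h \<xi>)"
      unfolding G_def using k R * by (intro decay_flow_diff[OF \<mu>'] continuous_Clip decay_Clip decay_Clip_diff) auto
  next
    fix t \<xi> show "G t (\<lambda>_. 0) \<xi> = 0"
      using R by (simp add: G_def Clip_id decay_def less_imp_le)
  qed auto
  have w0: "w 0 = f" using eq[of 0] by (simp add: fun_eq_iff)
  have eq0: "w t \<xi> = w 0 \<xi> + integral {0..t} (\<lambda>s. G s (w s) \<xi>)" for t \<xi> using eq by (simp add: w0)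
  have wd: "decay k (nrm k (w t)) (w t)" for t using ldecay_slice[OF w(2)] decay_nrm by blast
  \<comment> \<open>While the norm is at most R the truncation is the identity, so all a priori
    estimates of the locale become available on {0..t}.\<close>
  have prof: "halfwave_profile \<mu> t k w" if t: "0 \<le> t" and le: "\<And>s. s \<in> {0..t} \<Longrightarrow> nrm k (w s) \<le> R" for t
  proof
    fix r \<xi> assume r: "r \<in> {0..t}"
    have "Clip k R (w s) = w s" if "s \<in> {0..r}" for s
      using Clip_id[OF R decay_mono[OF wd order_refl]] le r that by simp
    then have "integral {0..r} (\<lambda>s. G s (w s) \<xi>) = integral {0..r} (\<lambda>s. flow \<mu> s (w s) \<xi>)"
      unfolding G_def by (intro Henstock_Kurzweil_Integration.integral_cong) simp
    then show "w r \<xi> = w 0 \<xi> + integral {0..r} (\<lambda>s. flow \<mu> s (w s) \<xi>)" using eq0[of r \<xi>] by simp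
  qed (use \<mu> t k w in auto)
  have "nrm k (w t) < R" if t: "t \<in> {0..T}" for t
  proof (rule first_exit[where y="\<lambda>t. nrm k (w t)", OF _ _ _ t])
    show "continuous_on {0..T} (\<lambda>t. nrm k (w t))"
      by (rule continuous_nrm[OF Gj[OF w(1)] Gl[OF w(1)] w(2) eq0])
    have bd: "nrm k (w t) < R" if t: "t \<in> {0..T}" and le: "\<And>s. s \<in> {0..t} \<Longrightarrow> nrm k (w s) \<le> R" for t
    proof -
      interpret halfwave_profile \<mu> t k w using t by (intro prof le) auto
      have v0: "v 0 = f" by (simp add: v_def fun_eq_iff w0)
      have "nrm k (w t) \<le> osgood_bound (nrm k f) K t"
        using nrm_bound[of t] t f(3) by (simp add: v0 w0 K_def)
      also have "\<dots> \<le> osgood_bound (nrm k f) K T" using K t by (intro osgood_bound_mono) auto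
      finally show ?thesis by (simp add: R_def)
    qed
    then show "\<And>t. t \<in> {0..T} \<Longrightarrow> (\<And>s. s \<in> {0..t} \<Longrightarrow> nrm k (w s) \<le> R) \<Longrightarrow> nrm k (w t) < R" .
    have f0: "0 \<le> nrm k f" by (rule nrm_nonneg[OF f(2)])
    have "nrm k f \<le> osgood_bound (nrm k f) K 0"
    proof -
      have "1 + nrm k f \<le> osgood_bound (nrm k f) K 0"
        using f0 by (simp add: osgood_bound_def add_pos_nonneg exp_add mult_le_cancel_right1)
      then show ?thesis by simp
    qed
    also have "\<dots> \<le> osgood_bound (nrm k f) K T" using K T by (intro osgood_bound_mono) auto
    finally show "nrm k (w 0) < R" by (simp add: R_def w0)
  qed
  then have "halfwave_profile \<mu> T k w" using T by (intro prof) (auto intro: less_imp_le)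
  then show ?thesis using w0 that by blast
qed

text \<open>Gronwall for the difference in the norm of order 2, where both solutions are bounded on
  {0..T}. This is what glues solutions constructed for different horizons and decay orders.\<close>

lemma halfwave_profile_unique:
  assumes "halfwave_profile \<mu> T k w" "halfwave_profile \<mu> T k w'" "w 0 = w' 0" and t: "t \<in> {0..T}"
  shows "w t = w' t"
proof -
  interpret a: halfwave_profile \<mu> T k w by fact
  interpret b: halfwave_profile \<mu> T k w' by fact
  have \<mu>: "\<bar>\<mu>\<bar> = 1" using a.\<mu> by auto
  have k2: "2 \<le> k" using a.k by simp
  obtain A where A: "\<And>s. \<bar>s\<bar> \<le> T \<Longrightarrow> decay 2 A (w s)" using ldecayE[OF ldecay_mono[OF a.ld k2]] by metis
  obtain B where B: "\<And>s. \<bar>s\<bar> \<le> T \<Longrightarrow> decay 2 B (w' s)" using ldecayE[OF ldecay_mono[OF b.ld k2]] by metis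
  define E where "E = max A B"
  have E: "decay 2 E (w s)" "decay 2 E (w' s)" if "s \<in> {0..T}" for s
    using decay_mono[OF A, of s 2 E] decay_mono[OF B, of s 2 E] that by (auto simp: E_def)
  define z where "z s \<xi> = w s \<xi> - w' s \<xi>" for s \<xi>
  define h where "h s \<xi> = flow \<mu> s (w s) \<xi> - flow \<mu> s (w' s) \<xi>" for s \<xi>
  have hj: "jcont h" "ldecay 2 h"
    unfolding h_def by (intro jcont_diff ldecay_diff a.jcont_flow_w b.jcont_flow_w ldecay_mono[OF a.ldecay_flow_w k2]
        ldecay_mono[OF b.ldecay_flow_w k2])+
  have zl: "ldecay 2 z" unfolding z_def by (intro ldecay_diff ldecay_mono[OF a.ld k2] ldecay_mono[OF b.ld k2])
  have zeq: "z s \<xi> = integral {0..s} (\<lambda>r. h r \<xi>)" if s: "s \<in> {0..T}" for s \<xi>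
    using a.eq[OF s, of \<xi>] b.eq[OF s, of \<xi>] assms(3) unfolding z_def h_def
    by (subst Henstock_Kurzweil_Integration.integral_diff)
       (auto intro!: integrable_continuous_interval jcont_slice(2) a.jcont_flow_w b.jcont_flow_w)
  define y where "y s = nrm 2 (z s)" for s
  have zd: "decay 2 (y s) (z s)" for s unfolding y_def using ldecay_slice[OF zl] decay_nrm by blast
  have yc: "continuous_on {0..T} y"
    unfolding y_def by (rule continuous_nrm[OF hj zl]) (use zeq assms(3) in \<open>auto simp: z_def\<close>)
  define L where "L = 48 * 4 ^ 2 * E\<^sup>2"
  have "y t \<le> 0 * exp (L * t)"
  proof (rule gronwall[OF yc _ _ t])
    fix s assume s: "s \<in> {0..T}"
    have "decay 2 (integral {0..s} (\<lambda>r. L * y r)) (\<lambda>\<xi>. integral {0..s} (\<lambda>r. h r \<xi>))"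
    proof (rule decay_integral[OF hj(1)])
      fix r assume "r \<in> {0..s}"
      then have r: "r \<in> {0..T}" using s by auto
      show "decay 2 (L * y r) (h r)"
        using zd[of r] unfolding h_def L_def z_def
        by (intro decay_flow_diff[OF \<mu>] E[OF r] jcont_slice(1)[OF a.jc] jcont_slice(1)[OF b.jc]) auto
    next
      show "continuous_on {0..s} (\<lambda>r. L * y r)"
        using s by (intro continuous_intros continuous_on_subset[OF yc]) auto
    qed
    then have "decay 2 (integral {0..s} (\<lambda>r. L * y r)) (z s)" by (subst ext[OF zeq[OF s]]) assumption
    then show "y s \<le> 0 + integral {0..s} (\<lambda>r. L * y r)" unfolding y_def[of s] using nrm_le by simp
  qed (simp add: L_def)
  then have "decay 2 0 (z t)" using zd[of t] decay_mono[of 2 "y t" "z t" 2 0] by simp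
  then show ?thesis by (simp add: decay_def z_def fun_eq_iff)
qed

text \<open>A single index n is both the time horizon and the decay order, so one quantifier
  expresses existence for all times with decay of all orders.\<close>

definition halfwave_flow :: "real \<Rightarrow> (real \<Rightarrow> real \<Rightarrow> complex) \<Rightarrow> bool" where
  "halfwave_flow \<mu> W \<longleftrightarrow> (\<forall>n\<ge>4. \<exists>w. halfwave_profile \<mu> (real n) n w \<and> (\<forall>t\<in>{0..real n}. W t = w t))"

text \<open>Each n yields its own solution on {0..n} with decay of order n. Any two of them agree on
  the common interval by uniqueness at order 4, so a diagonal choice of n defines the flow.\<close>

theorem halfwave_flow_exists:
  assumes \<mu>: "\<mu> \<in> {-1, 1}" and f: "continuous_on UNIV f" "\<And>k. \<exists>C. decay k C f" "mass f \<le> 1 / 8"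
  obtains W where "halfwave_flow \<mu> W" "W 0 = f"
proof -
  have "\<exists>w. halfwave_profile \<mu> (real n) n w \<and> w 0 = f" if "4 \<le> n" for n
    using halfwave_profile_exists[OF \<mu> _ that f(1) _ f(3), of "real n"] f(2)[of n] by auto
  then obtain w where w: "\<And>n. 4 \<le> n \<Longrightarrow> halfwave_profile \<mu> (real n) n (w n)" "\<And>n. 4 \<le> n \<Longrightarrow> w n 0 = f"
    by metis
  have agree: "w m t = w n t" if mn: "4 \<le> m" "m \<le> n" and t: "t \<in> {0..real m}" for m n t
  proof (rule halfwave_profile_unique[OF _ _ _ t])
    show "halfwave_profile \<mu> (real m) 4 (w m)" "halfwave_profile \<mu> (real m) 4 (w n)"
      using mn halfwave_profile_subset[OF w(1)[of m], of "real m" 4] halfwave_profile_subset[OF w(1)[of n], of "real m" 4] by simp_all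
    show "w m 0 = w n 0" using mn w(2) by simp
  qed
  \<comment> \<open>Rounding t up covers t itself, and adding 4 keeps the index within the range
    where solutions exist.\<close>
  define W where "W t = w (nat \<lceil>t\<rceil> + 4) t" for t
  have "W t = w n t" if "4 \<le> n" "t \<in> {0..real n}" for n t
  proof -
    define m where "m = nat \<lceil>t\<rceil> + 4"
    have "t \<in> {0..real m}" using that by (auto simp: m_def) linarith
    moreover have "4 \<le> m" by (simp add: m_def)
    ultimately have "w m t = w n t"
      using that by (cases "m \<le> n") (blast intro: agree, metis agree nle_le)
    then show ?thesis by (simp add: W_def m_def)
  qed
  then have "\<forall>t\<in>{0..real n}. W t = w n t" if "4 \<le> n" for n using that by blast
  then have "halfwave_flow \<mu> W" unfolding halfwave_flow_def using w(1) by meson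
  moreover have "W 0 = f" using w(2) by (simp add: W_def)
  ultimately show ?thesis using that by blast
qed

section \<open>The Fourier transform and Plancherel's theorem\<close>

definition ft :: "(real \<Rightarrow> complex) \<Rightarrow> real \<Rightarrow> complex" where
  "ft f \<xi> = (LINT x|lborel. cis (- (x * \<xi>)) * f x)"

text \<open>Left without the factor 1 / (2 * pi), so that convolutions become products exactly; the
  price is the factor 2 * pi in \<open>fourier_invF\<close> and in Plancherel's identity.\<close>

definition invF :: "(real \<Rightarrow> complex) \<Rightarrow> real \<Rightarrow> complex" where
  "invF f x = (LINT \<xi>|lborel. cis (x * \<xi>) * f \<xi>)"

lemma invF_eq_ft: "invF f x = ft f (- x)"
  by (simp add: invF_def ft_def mult.commute)

lemma cis_measurable [measurable]: "cis \<in> borel_measurable borel"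
  by (intro borel_measurable_continuous_onI continuous_intros)

lemma integrable_phase: "integrable lborel f \<Longrightarrow> integrable lborel (\<lambda>x. cis (a * x) * f x)"
  for f :: "real \<Rightarrow> complex"
  using integrable_mult_bounded[of lborel f "\<lambda>x. cis (a * x)" 1] by (simp add: mult.commute)

lemma continuous_ft:
  assumes f: "integrable lborel f" shows "continuous_on UNIV (ft f)"
  unfolding ft_def[abs_def]
proof (rule continuous_on_LINT_dominated)
  fix \<xi> show "\<exists>e>0. \<exists>g. integrable lborel g \<and> (\<forall>y\<in>ball \<xi> e. \<forall>x. norm (cis (- (x * y)) * f x) \<le> g x)"
    using f by (intro exI[of _ 1] conjI exI[of _ "\<lambda>x. cmod (f x)"]) (auto simp: norm_mult)
qed (use f in \<open>auto intro!: continuous_intros\<close>)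

lemma continuous_invF: "integrable lborel f \<Longrightarrow> continuous_on UNIV (invF f)"
  unfolding invF_eq_ft[abs_def]
  by (rule continuous_on_compose2[OF continuous_ft]) (auto intro: continuous_intros)

lemma norm_ft_le: "cmod (ft f \<xi>) \<le> L1norm f"
  unfolding ft_def L1norm_def using integral_norm_bound[of lborel "\<lambda>x. cis (- (x * \<xi>)) * f x"] by (simp add: norm_mult)

lemma norm_invF_le: "cmod (invF f \<xi>) \<le> L1norm f"
  unfolding invF_eq_ft by (rule norm_ft_le)

lemma ft_conv:
  assumes f: "integrable lborel f" and g: "integrable lborel g"
  shows "ft (conv f g) \<xi> = ft f \<xi> * ft g \<xi>"
proof -
  have [measurable]: "f \<in> borel_measurable borel" "g \<in> borel_measurable borel" using f g by auto
  have "integrable (lborel \<Otimes>\<^sub>M lborel) (\<lambda>p. (case p of (x, y) \<Rightarrow> f x * g (y - x)) * cis (- (snd p * \<xi>)))"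
    by (rule integrable_mult_bounded[OF integrable_pair_shift[OF f g], where B=1]) auto
  then have I: "integrable (lborel \<Otimes>\<^sub>M lborel) (\<lambda>(x, y). cis (- (y * \<xi>)) * (f x * g (y - x)))"
    by (simp add: case_prod_beta' mult.commute)
  have "ft (conv f g) \<xi> = (LINT y|lborel. LINT x|lborel. cis (- (y * \<xi>)) * (f x * g (y - x)))"
    by (simp add: ft_def conv_def)
  also have "\<dots> = (LINT x|lborel. LINT y|lborel. cis (- (y * \<xi>)) * (f x * g (y - x)))"
    by (rule lborel_pair.Fubini_integral[OF I])
  also have "\<dots> = (LINT x|lborel. (cis (- (x * \<xi>)) * f x) * ft g \<xi>)"
  proof (rule Bochner_Integration.integral_cong)
    fix x
    have "cis (- (y * \<xi>)) = cis (- (x * \<xi>)) * cis (- ((y - x) * \<xi>))" for y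
      by (simp add: cis_mult algebra_simps)
    then have "(LINT y|lborel. cis (- (y * \<xi>)) * (f x * g (y - x)))
       = (LINT y|lborel. (\<lambda>z. (cis (- (x * \<xi>)) * f x) * (cis (- (z * \<xi>)) * g z)) (y - x))"
      by (intro Bochner_Integration.integral_cong) (simp_all add: mult_ac)
    also have "\<dots> = (LINT z|lborel. (cis (- (x * \<xi>)) * f x) * (cis (- (z * \<xi>)) * g z))"
      by (rule LINT_translate)
    finally show "(LINT y|lborel. cis (- (y * \<xi>)) * (f x * g (y - x))) = (cis (- (x * \<xi>)) * f x) * ft g \<xi>"
      by (simp add: ft_def)
  qed simp
  also have "\<dots> = ft f \<xi> * ft g \<xi>" by (simp add: ft_def)
  finally show ?thesis .
qed

lemma ft_flip: "ft (flip f) \<xi> = cnj (ft f \<xi>)"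
proof -
  have "ft (flip f) \<xi> = (LINT x|lborel. (\<lambda>x. cnj (cis (- (x * \<xi>)) * f x)) (0 - x))"
    unfolding ft_def flip_def by (rule Bochner_Integration.integral_cong) (auto simp: cis_cnj)
  also have "\<dots> = (LINT x|lborel. cnj (cis (- (x * \<xi>)) * f x))" by (rule LINT_reflect)
  also have "\<dots> = cnj (ft f \<xi>)" unfolding ft_def by (rule Bochner_Integration.integral_cnj)
  finally show ?thesis .
qed

lemma integrable_flip: "integrable lborel f \<Longrightarrow> integrable lborel (flip f)"
  unfolding flip_def[abs_def] using lborel_integrable_real_affine[of f "-1" 0] by simp

text \<open>The characteristic function of the standard normal law, after a dilation by e.\<close>

lemma ft_gaussian:
  assumes e: "0 < e"
  shows "(LINT \<xi>|lborel. cis (- (a * \<xi>)) * of_real (std_normal_density (e * \<xi>))) = of_real (exp (- (a / e)\<^sup>2 / 2) / e)"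
proof -
  have "(LINT x|lborel. of_real (std_normal_density x) * cis (t * x)) = complex_of_real (exp (- (t\<^sup>2) / 2))" for t
  proof -
    have "char std_normal_distribution t = (LINT x|lborel. std_normal_density x *\<^sub>R iexp (t * x))"
      unfolding char_def by (subst integral_density) (auto simp: normal_density_nonneg)
    then show ?thesis
      by (simp add: char_std_normal_distribution scaleR_conv_of_real cis_conv_exp)
  qed
  note c = this[of "- (a / e)"]
  have "(LINT x|lborel. of_real (std_normal_density x) * cis (- (a / e) * x))
    = \<bar>e\<bar> *\<^sub>R (LINT x|lborel. of_real (std_normal_density (0 + e * x)) * cis (- (a / e) * (0 + e * x)))"
    using e by (intro lborel_integral_real_affine) auto
  then have "complex_of_real (exp (- ((a / e)\<^sup>2) / 2)) = e *\<^sub>R (LINT \<xi>|lborel. cis (- (a * \<xi>)) * of_real (std_normal_density (e * \<xi>)))"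
    using c e by (simp add: mult.commute)
  then have "(LINT \<xi>|lborel. cis (- (a * \<xi>)) * of_real (std_normal_density (e * \<xi>))) = (1 / e) *\<^sub>R complex_of_real (exp (- ((a / e)\<^sup>2) / 2))"
    using e by simp
  then show ?thesis by (simp add: scaleR_conv_of_real)
qed

lemma std_normal_density_at: "sqrt (2 * pi) * std_normal_density x = exp (- x\<^sup>2 / 2)"
  by (simp add: std_normal_density_def)

text \<open>The function |ft f|^2 is the transform of the autocorrelation of f. Testing it against a
  Gaussian and applying Fubini moves the transform onto the Gaussian, where it is explicit; as e
  tends to 0 the right-hand side concentrates at the value of the autocorrelation at 0.\<close>

lemma gaussian_regularized_plancherel:
  assumes f: "integrable lborel f" and e: "0 < e"
  shows "integrable lborel (\<lambda>\<xi>. (cmod (ft f \<xi>))\<^sup>2 * exp (- (e * \<xi>)\<^sup>2 / 2))"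
    and "of_real (LINT \<xi>|lborel. (cmod (ft f \<xi>))\<^sup>2 * exp (- (e * \<xi>)\<^sup>2 / 2))
      = 2 * pi * (LINT z|lborel. conv f (flip f) (e * z) * of_real (std_normal_density z))"
proof -
  let ?n = "\<lambda>x. std_normal_density x"
  define \<rho> where "\<rho> = conv f (flip f)"
  note fl = integrable_flip[OF f]
  have \<rho>i: "integrable lborel \<rho>" unfolding \<rho>_def by (rule conv_integrable(1)[OF f fl])
  then have [measurable]: "\<rho> \<in> borel_measurable borel" by auto
  have \<rho>ft: "ft \<rho> \<xi> = of_real ((cmod (ft f \<xi>))\<^sup>2)" for \<xi>
    unfolding \<rho>_def ft_conv[OF f fl] ft_flip by (rule complex_norm_square[symmetric])
  have ni: "integrable lborel (\<lambda>\<xi>. complex_of_real (?n (e * \<xi>)))"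
  proof (rule integrable_of_real)
    have "integrable lborel (\<lambda>\<xi>. ?n (0 + e * \<xi>))"
      using e by (intro lborel_integrable_real_affine integrable_normal_density) auto
    then show "integrable lborel (\<lambda>\<xi>. ?n (e * \<xi>))" by (simp only: add_0)
  qed
  have "integrable (lborel \<Otimes>\<^sub>M lborel) (\<lambda>p. (case p of (a, \<xi>) \<Rightarrow> \<rho> a * complex_of_real (?n (e * \<xi>))) * cis (- (fst p * snd p)))"
    by (rule integrable_mult_bounded[OF integrable_pair_prod[OF \<rho>i ni], where B=1]) auto
  then have I: "integrable (lborel \<Otimes>\<^sub>M lborel) (\<lambda>(a, \<xi>). \<rho> a * (cis (- (a * \<xi>)) * complex_of_real (?n (e * \<xi>))))"
    by (simp add: case_prod_beta' mult_ac)
  have fm: "ft f \<in> borel_measurable borel" by (rule continuous_borel[OF continuous_ft[OF f]])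
  have "integrable lborel (\<lambda>\<xi>. ft \<rho> \<xi> * of_real (?n (e * \<xi>)))"
    using integrable_mult_bounded[OF ni, of "ft \<rho>" "L1norm \<rho>"] norm_ft_le[of \<rho>] continuous_borel[OF continuous_ft[OF \<rho>i]]
    by (simp add: mult.commute)
  from integrable_Re[OF this] have i1: "integrable lborel (\<lambda>\<xi>. (cmod (ft f \<xi>))\<^sup>2 * ?n (e * \<xi>))"
    by (simp add: \<rho>ft)
  have G: "(cmod (ft f \<xi>))\<^sup>2 * exp (- (e * \<xi>)\<^sup>2 / 2) = sqrt (2 * pi) * ((cmod (ft f \<xi>))\<^sup>2 * ?n (e * \<xi>))" for \<xi>
    using std_normal_density_at[of "e * \<xi>"] by (simp add: mult_ac)
  show "integrable lborel (\<lambda>\<xi>. (cmod (ft f \<xi>))\<^sup>2 * exp (- (e * \<xi>)\<^sup>2 / 2))"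
    unfolding G using i1 by simp
  have "complex_of_real (LINT \<xi>|lborel. (cmod (ft f \<xi>))\<^sup>2 * ?n (e * \<xi>)) = (LINT \<xi>|lborel. ft \<rho> \<xi> * of_real (?n (e * \<xi>)))"
    unfolding \<rho>ft of_real_mult[symmetric] by (rule integral_complex_of_real[symmetric])
  also have "\<dots> = (LINT \<xi>|lborel. LINT a|lborel. \<rho> a * (cis (- (a * \<xi>)) * complex_of_real (?n (e * \<xi>))))"
  proof (rule Bochner_Integration.integral_cong)
    fix \<xi>
    have "ft \<rho> \<xi> * of_real (?n (e * \<xi>)) = (LINT a|lborel. (cis (- (a * \<xi>)) * \<rho> a) * complex_of_real (?n (e * \<xi>)))"
      unfolding ft_def by simp
    also have "\<dots> = (LINT a|lborel. \<rho> a * (cis (- (a * \<xi>)) * complex_of_real (?n (e * \<xi>))))"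
      by (rule Bochner_Integration.integral_cong) (auto simp only: mult_ac)
    finally show "ft \<rho> \<xi> * of_real (?n (e * \<xi>)) = (LINT a|lborel. \<rho> a * (cis (- (a * \<xi>)) * complex_of_real (?n (e * \<xi>))))" .
  qed simp
  also have "\<dots> = (LINT a|lborel. LINT \<xi>|lborel. \<rho> a * (cis (- (a * \<xi>)) * complex_of_real (?n (e * \<xi>))))"
    by (rule lborel_pair.Fubini_integral[OF I])
  also have "\<dots> = (LINT a|lborel. \<rho> a * of_real (exp (- (a / e)\<^sup>2 / 2) / e))"
    using ft_gaussian[OF e] by simp
  also have "\<dots> = \<bar>e\<bar> *\<^sub>R (LINT z|lborel. \<rho> (0 + e * z) * of_real (exp (- ((0 + e * z) / e)\<^sup>2 / 2) / e))"
    using e by (intro lborel_integral_real_affine) auto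
  also have "\<dots> = e *\<^sub>R (LINT z|lborel. (sqrt (2 * pi) / e) *\<^sub>R (\<rho> (e * z) * of_real (?n z)))"
  proof -
    have "exp (- ((0 + e * z) / e)\<^sup>2 / 2) / e = sqrt (2 * pi) / e * ?n z" for z
      using e std_normal_density_at[of z] by simp
    then have "\<rho> (0 + e * z) * of_real (exp (- ((0 + e * z) / e)\<^sup>2 / 2) / e) = (sqrt (2 * pi) / e) *\<^sub>R (\<rho> (e * z) * of_real (?n z))" for z
      unfolding scaleR_conv_of_real add_0 by (simp only: of_real_mult) (simp add: mult_ac)
    then show ?thesis using e by simp
  qed
  also have "\<dots> = sqrt (2 * pi) *\<^sub>R (LINT z|lborel. \<rho> (e * z) * of_real (?n z))"
    using e by (simp only: integral_scaleR_right) simp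
  finally have *: "complex_of_real (LINT \<xi>|lborel. (cmod (ft f \<xi>))\<^sup>2 * ?n (e * \<xi>)) = sqrt (2 * pi) *\<^sub>R (LINT z|lborel. \<rho> (e * z) * of_real (?n z))" .
  have "complex_of_real (LINT \<xi>|lborel. (cmod (ft f \<xi>))\<^sup>2 * exp (- (e * \<xi>)\<^sup>2 / 2))
     = sqrt (2 * pi) * complex_of_real (LINT \<xi>|lborel. (cmod (ft f \<xi>))\<^sup>2 * ?n (e * \<xi>))"
    unfolding G by simp
  also have "\<dots> = (complex_of_real (sqrt (2 * pi)) * sqrt (2 * pi)) * (LINT z|lborel. \<rho> (e * z) * of_real (?n z))"
    unfolding * by (simp only: scaleR_conv_of_real mult.assoc)
  also have "complex_of_real (sqrt (2 * pi)) * sqrt (2 * pi) = 2 * pi"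
    by (simp flip: of_real_mult)
  finally show "complex_of_real (LINT \<xi>|lborel. (cmod (ft f \<xi>))\<^sup>2 * exp (- (e * \<xi>)\<^sup>2 / 2))
      = 2 * pi * (LINT z|lborel. conv f (flip f) (e * z) * of_real (?n z))"
    by (simp add: \<rho>_def)
qed

lemma autocorrelation_le:
  assumes f: "f \<in> borel_measurable borel" "integrable lborel (\<lambda>x. (cmod (f x))\<^sup>2)"
  shows "cmod (conv f (flip f) a) \<le> (LINT x|lborel. (cmod (f x))\<^sup>2)"
proof -
  note [measurable] = f(1)
  have t: "integrable lborel (\<lambda>x. (cmod (f (x - a)))\<^sup>2)" using integrable_translate[OF f(2), of a] .
  have le: "cmod (f x * flip f (a - x)) \<le> 1 / 2 * (cmod (f x))\<^sup>2 + 1 / 2 * (cmod (f (x - a)))\<^sup>2" for x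
    using sum_squares_bound[of "cmod (f x)" "cmod (f (x - a))"] by (simp add: flip_def norm_mult)
  have i: "integrable lborel (\<lambda>x. 1 / 2 * (cmod (f x))\<^sup>2 + 1 / 2 * (cmod (f (x - a)))\<^sup>2)" using f t by simp
  have [measurable]: "flip f \<in> borel_measurable borel" unfolding flip_def[abs_def] by measurable
  have "cmod (conv f (flip f) a) \<le> (LINT x|lborel. cmod (f x * flip f (a - x)))"
    unfolding conv_def by (rule integral_norm_bound)
  also have "\<dots> \<le> (LINT x|lborel. 1 / 2 * (cmod (f x))\<^sup>2 + 1 / 2 * (cmod (f (x - a)))\<^sup>2)"
    using le by (intro integral_mono i integrable_norm_le[OF i]) auto
  also have "\<dots> = (LINT x|lborel. (cmod (f x))\<^sup>2)"
    using f t LINT_translate[of "\<lambda>x. (cmod (f x))\<^sup>2" a] by simp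
  finally show ?thesis .
qed

text \<open>Fatou's lemma gives only an inequality, but for every f in L1 and L2, including the
  discontinuous truncations in the definition of \<open>is_fourier\<close>.\<close>

lemma ft_bessel:
  assumes f: "integrable lborel f" and f2: "integrable lborel (\<lambda>x. (cmod (f x))\<^sup>2)"
  shows "integrable lborel (\<lambda>\<xi>. (cmod (ft f \<xi>))\<^sup>2)"
    and "(LINT \<xi>|lborel. (cmod (ft f \<xi>))\<^sup>2) \<le> 2 * pi * (LINT x|lborel. (cmod (f x))\<^sup>2)"
proof -
  let ?B = "2 * pi * (LINT x|lborel. (cmod (f x))\<^sup>2)"
  have [measurable]: "f \<in> borel_measurable borel" "ft f \<in> borel_measurable borel"
    using f continuous_borel[OF continuous_ft[OF f]] by auto
  define g where "g n \<xi> = (cmod (ft f \<xi>))\<^sup>2 * exp (- (1 / real (Suc n) * \<xi>)\<^sup>2 / 2)" for n \<xi>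
  have gi: "integrable lborel (g n)" for n unfolding g_def by (rule gaussian_regularized_plancherel(1)[OF f]) simp
  have gnn: "0 \<le> g n \<xi>" for n \<xi> by (simp add: g_def)
  have gB: "(LINT \<xi>|lborel. g n \<xi>) \<le> ?B" for n
  proof -
    let ?I = "LINT z|lborel. conv f (flip f) (1 / real (Suc n) * z) * of_real (std_normal_density z)"
    have "integrable lborel (conv f (flip f))" by (rule conv_integrable(1)[OF f integrable_flip[OF f]])
    then have [measurable]: "conv f (flip f) \<in> borel_measurable borel" by auto
    have "(LINT \<xi>|lborel. g n \<xi>) = cmod (of_real (LINT \<xi>|lborel. g n \<xi>))"
      by (simp add: g_def Bochner_Integration.integral_nonneg)
    also have "\<dots> = cmod (2 * pi * ?I)"
      unfolding g_def by (subst gaussian_regularized_plancherel(2)[OF f]) auto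
    also have "\<dots> = 2 * pi * cmod ?I" by (simp add: norm_mult)
    also have "cmod ?I \<le> (LINT z|lborel. cmod (conv f (flip f) (1 / real (Suc n) * z) * of_real (std_normal_density z)))"
      by (rule integral_norm_bound)
    also have "\<dots> \<le> (LINT z|lborel. (LINT x|lborel. (cmod (f x))\<^sup>2) * std_normal_density z)"
    proof (rule integral_mono)
      show i: "integrable lborel (\<lambda>z. (LINT x|lborel. (cmod (f x))\<^sup>2) * std_normal_density z)" by simp
      show le: "cmod (conv f (flip f) (1 / real (Suc n) * z) * of_real (std_normal_density z)) \<le> (LINT x|lborel. (cmod (f x))\<^sup>2) * std_normal_density z" for z
        unfolding norm_mult using autocorrelation_le[OF _ f2] by (auto intro!: mult_right_mono simp: normal_density_nonneg)
      show "integrable lborel (\<lambda>z. cmod (conv f (flip f) (1 / real (Suc n) * z) * of_real (std_normal_density z)))"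
        by (rule integrable_norm, rule integrable_norm_le[OF i _ le]) measurable
    qed
    finally have "(LINT \<xi>|lborel. g n \<xi>) \<le> 2 * pi * (LINT z|lborel. (LINT x|lborel. (cmod (f x))\<^sup>2) * std_normal_density z)"
      by simp
    then show ?thesis by (simp only: integral_mult_right_zero integral_normal_density mult_1_right)
  qed
  have lim: "(\<lambda>n. g n \<xi>) \<longlonglongrightarrow> (cmod (ft f \<xi>))\<^sup>2" for \<xi>
  proof -
    have "(\<lambda>n. exp (- (1 / real (Suc n) * \<xi>)\<^sup>2 / 2)) \<longlonglongrightarrow> exp (- (0 * \<xi>)\<^sup>2 / 2)"
      by (intro tendsto_intros LIMSEQ_inverse_real_of_nat[unfolded inverse_eq_divide]) auto
    from tendsto_mult[OF tendsto_const this] show ?thesis by (simp add: g_def)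
  qed
  have "(\<integral>\<^sup>+\<xi>. ennreal ((cmod (ft f \<xi>))\<^sup>2) \<partial>lborel) = (\<integral>\<^sup>+\<xi>. liminf (\<lambda>n. ennreal (g n \<xi>)) \<partial>lborel)"
    by (intro nn_integral_cong lim_imp_Liminf[symmetric] tendsto_ennrealI lim) simp
  also have "\<dots> \<le> liminf (\<lambda>n. \<integral>\<^sup>+\<xi>. ennreal (g n \<xi>) \<partial>lborel)"
    by (rule nn_integral_liminf) (auto simp: g_def)
  also have "\<dots> \<le> ennreal ?B"
  proof -
    have "(\<integral>\<^sup>+\<xi>. ennreal (g n \<xi>) \<partial>lborel) \<le> ennreal ?B" for n
      using gB[of n] nn_integral_eq_integral[OF gi[of n]] by (simp add: gnn ennreal_leI)
    then show ?thesis by (intro Liminf_le) auto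
  qed
  finally have le: "(\<integral>\<^sup>+\<xi>. ennreal ((cmod (ft f \<xi>))\<^sup>2) \<partial>lborel) \<le> ennreal ?B" .
  show i: "integrable lborel (\<lambda>\<xi>. (cmod (ft f \<xi>))\<^sup>2)"
    by (rule integrableI_bounded) (use le in \<open>auto simp: ennreal_less_top intro: le_less_trans\<close>)
  show "(LINT \<xi>|lborel. (cmod (ft f \<xi>))\<^sup>2) \<le> ?B"
    using le unfolding nn_integral_eq_integral[OF i AE_I2[OF zero_le_power2]] by (simp add: ennreal_le_iff Bochner_Integration.integral_nonneg)
qed

text \<open>For continuous f of order 2 the autocorrelation is continuous, so both sides of the
  regularized identity converge by dominated convergence and equality holds.\<close>

lemma ft_plancherel:
  assumes c: "continuous_on UNIV f" and d: "decay 2 A f"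
  shows "(LINT \<xi>|lborel. (cmod (ft f \<xi>))\<^sup>2) = 2 * pi * mass f"
proof -
  have f: "integrable lborel f" by (rule decay_integrable(1)[OF continuous_borel[OF c] d order_refl])
  have f2: "integrable lborel (\<lambda>x. (cmod (f x))\<^sup>2)" by (rule mass_integrable[OF c d])
  have fl: "continuous_on UNIV (flip f)" "decay 2 A (flip f)" using c d by (auto intro: continuous_flip)
  define \<rho> where "\<rho> = conv f (flip f)"
  have \<rho>c: "continuous_on UNIV \<rho>" unfolding \<rho>_def by (rule continuous_conv[OF c fl(1) d fl(2)])
  note [measurable] = continuous_borel[OF c] continuous_borel[OF \<rho>c] continuous_borel[OF continuous_ft[OF f]]
  have \<rho>0: "\<rho> 0 = of_real (mass f)"
  proof -
    have "\<rho> 0 = (LINT x|lborel. complex_of_real ((cmod (f x))\<^sup>2))"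
      unfolding \<rho>_def conv_def flip_def by (rule Bochner_Integration.integral_cong) (simp_all add: complex_norm_square del: of_real_power)
    also have "\<dots> = of_real (mass f)" unfolding mass_def by (rule integral_complex_of_real)
    finally show ?thesis .
  qed
  have \<rho>b: "cmod (\<rho> a) \<le> mass f" for a unfolding \<rho>_def mass_def by (rule autocorrelation_le[OF _ f2]) simp
  define e where "e n = 1 / real (Suc n)" for n
  have e: "0 < e n" for n by (simp add: e_def)
  have el: "e \<longlonglongrightarrow> 0" unfolding e_def using LIMSEQ_inverse_real_of_nat by (simp add: inverse_eq_divide)
  have "(\<lambda>n. LINT \<xi>|lborel. (cmod (ft f \<xi>))\<^sup>2 * exp (- (e n * \<xi>)\<^sup>2 / 2)) \<longlonglongrightarrow> (LINT \<xi>|lborel. (cmod (ft f \<xi>))\<^sup>2)"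
  proof (rule integral_dominated_convergence[where w="\<lambda>\<xi>. (cmod (ft f \<xi>))\<^sup>2"])
    show "AE \<xi> in lborel. (\<lambda>n. (cmod (ft f \<xi>))\<^sup>2 * exp (- (e n * \<xi>)\<^sup>2 / 2)) \<longlonglongrightarrow> (cmod (ft f \<xi>))\<^sup>2"
    proof (rule AE_I2)
      fix \<xi>
      have "(\<lambda>n. (cmod (ft f \<xi>))\<^sup>2 * exp (- (e n * \<xi>)\<^sup>2 / 2)) \<longlonglongrightarrow> (cmod (ft f \<xi>))\<^sup>2 * exp (- (0 * \<xi>)\<^sup>2 / 2)"
        by (intro tendsto_intros el) auto
      then show "(\<lambda>n. (cmod (ft f \<xi>))\<^sup>2 * exp (- (e n * \<xi>)\<^sup>2 / 2)) \<longlonglongrightarrow> (cmod (ft f \<xi>))\<^sup>2" by simp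
    qed
  qed (use ft_bessel(1)[OF f f2] in \<open>auto simp: abs_mult mult_left_le\<close>)
  then have 1: "(\<lambda>n. complex_of_real (LINT \<xi>|lborel. (cmod (ft f \<xi>))\<^sup>2 * exp (- (e n * \<xi>)\<^sup>2 / 2))) \<longlonglongrightarrow> of_real (LINT \<xi>|lborel. (cmod (ft f \<xi>))\<^sup>2)"
    by (rule tendsto_of_real)
  have "(\<lambda>n. LINT z|lborel. \<rho> (e n * z) * of_real (std_normal_density z)) \<longlonglongrightarrow> (LINT z|lborel. \<rho> 0 * of_real (std_normal_density z))"
  proof (rule integral_dominated_convergence[where w="\<lambda>z. mass f * std_normal_density z"])
    show "AE z in lborel. (\<lambda>n. \<rho> (e n * z) * of_real (std_normal_density z)) \<longlonglongrightarrow> \<rho> 0 * of_real (std_normal_density z)"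
    proof (rule AE_I2)
      fix z
      have "(\<lambda>n. e n * z) \<longlonglongrightarrow> 0 * z" by (intro tendsto_intros el)
      then have "(\<lambda>n. \<rho> (e n * z)) \<longlonglongrightarrow> \<rho> 0"
        using continuous_on_tendsto_compose[OF \<rho>c, of "\<lambda>n. e n * z" 0] by simp
      then show "(\<lambda>n. \<rho> (e n * z) * of_real (std_normal_density z)) \<longlonglongrightarrow> \<rho> 0 * of_real (std_normal_density z)"
        by (intro tendsto_intros)
    qed
    show "AE z in lborel. norm (\<rho> (e n * z) * of_real (std_normal_density z)) \<le> mass f * std_normal_density z" for n
      using \<rho>b by (auto simp: norm_mult normal_density_nonneg intro!: mult_right_mono)
  qed auto
  moreover have "(LINT z|lborel. \<rho> 0 * of_real (std_normal_density z)) = of_real (mass f)"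
  proof -
    have "(LINT z|lborel. complex_of_real (std_normal_density z)) = 1"
      unfolding integral_complex_of_real by simp
    then show ?thesis by (simp add: \<rho>0)
  qed
  ultimately have "(\<lambda>n. complex_of_real (2 * pi) * (LINT z|lborel. \<rho> (e n * z) * of_real (std_normal_density z))) \<longlonglongrightarrow> complex_of_real (2 * pi) * of_real (mass f)"
    by (intro tendsto_intros) simp
  then have 2: "(\<lambda>n. complex_of_real (LINT \<xi>|lborel. (cmod (ft f \<xi>))\<^sup>2 * exp (- (e n * \<xi>)\<^sup>2 / 2))) \<longlonglongrightarrow> complex_of_real (2 * pi) * of_real (mass f)"
    unfolding gaussian_regularized_plancherel(2)[OF f e] \<rho>_def by simp
  have "complex_of_real (LINT \<xi>|lborel. (cmod (ft f \<xi>))\<^sup>2) = of_real (2 * pi * mass f)"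
    using LIMSEQ_unique[OF 1 2] by simp
  then show ?thesis by (simp only: of_real_eq_iff)
qed

lemma invF_bessel:
  assumes "integrable lborel f" "integrable lborel (\<lambda>x. (cmod (f x))\<^sup>2)"
  shows "integrable lborel (\<lambda>x. (cmod (invF f x))\<^sup>2)" "mass (invF f) \<le> 2 * pi * mass f"
  using lborel_integrable_real_affine[OF ft_bessel(1)[OF assms], of "-1" 0] ft_bessel(2)[OF assms]
    LINT_reflect[of "\<lambda>\<xi>. (cmod (ft f \<xi>))\<^sup>2" 0] by (simp_all add: invF_eq_ft mass_def)

lemma invF_plancherel: "continuous_on UNIV f \<Longrightarrow> decay 2 A f \<Longrightarrow> mass (invF f) = 2 * pi * mass f"
  using ft_plancherel[of f A] LINT_reflect[of "\<lambda>\<xi>. (cmod (ft f \<xi>))\<^sup>2" 0] by (simp add: invF_eq_ft mass_def)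

lemma invF_conv: "integrable lborel f \<Longrightarrow> integrable lborel g \<Longrightarrow> invF (conv f g) x = invF f x * invF g x"
  unfolding invF_eq_ft by (rule ft_conv)

lemma invF_flip: "invF (flip f) x = cnj (invF f x)"
  unfolding invF_eq_ft by (rule ft_flip)

section \<open>The truncated Fourier integral\<close>

lemma continuous_AE_eq:
  fixes f g :: "real \<Rightarrow> complex"
  assumes "continuous_on UNIV f" "continuous_on UNIV g" and ae: "AE x in lborel. f x = g x"
  shows "f x = g x"
proof -
  have "closed {x. f x = g x}" using assms(1,2) by (rule closed_Collect_eq)
  moreover have "AE x in lebesgue. x \<in> {x. f x = g x}" using AE_completion[OF ae] by simp
  ultimately show ?thesis using mem_closed_if_AE_lebesgue by blast
qed

text \<open>Plancherel makes the difference vanish almost everywhere, continuity everywhere. It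
  serves to verify identities between Fourier profiles on the physical side.\<close>

lemma invF_injective:
  assumes c: "continuous_on UNIV f" "continuous_on UNIV g" and d: "decay 2 A f" "decay 2 B g"
    and eq: "\<And>x. invF f x = invF g x"
  shows "f = g"
proof -
  have i: "integrable lborel f" "integrable lborel g"
    using decay_integrable(1)[OF continuous_borel[OF c(1)] d(1)] decay_integrable(1)[OF continuous_borel[OF c(2)] d(2)] by auto
  define h where "h \<xi> = f \<xi> - g \<xi>" for \<xi>
  have hc: "continuous_on UNIV h" unfolding h_def by (intro continuous_intros c)
  have hd: "decay 2 (A + B) h" unfolding h_def by (rule decay_diff[OF d])
  have "invF h x = invF f x - invF g x" for x
    using integrable_phase[OF i(1), of x] integrable_phase[OF i(2), of x] by (simp add: invF_def h_def right_diff_distrib)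
  then have "invF h = (\<lambda>x. 0)" using eq by (simp add: fun_eq_iff)
  then have "mass h = 0" using invF_plancherel[OF hc hd] by (simp add: mass_def)
  then have "AE x in lborel. (cmod (h x))\<^sup>2 = 0"
    unfolding mass_def using integral_nonneg_eq_0_iff_AE[OF mass_integrable[OF hc hd]] by simp
  then have "AE x in lborel. f x = g x" by (simp add: h_def)
  then show ?thesis using continuous_AE_eq[OF c] by blast
qed

lemma L2I: "f \<in> borel_measurable borel \<Longrightarrow> integrable lborel (\<lambda>x. (cmod (f x))\<^sup>2) \<Longrightarrow> L2 f"
  unfolding L2_def integrable_iff_bounded by simp

definition trunc_ft :: "(real \<Rightarrow> complex) \<Rightarrow> real \<Rightarrow> real \<Rightarrow> complex" where
  "trunc_ft f R \<xi> = (LINT x:{-R..R}|lborel. cis (-(x * \<xi>)) * f x)"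

lemma trunc_ft_eq: "trunc_ft f R = ft (\<lambda>x. indicator {-R..R} x * f x)"
  unfolding trunc_ft_def ft_def set_lebesgue_integral_def
  by (intro ext Bochner_Integration.integral_cong) (auto simp: indicator_def)

text \<open>Since \<open>fourier\<close> is defined by choice, computing it on a concrete function
  means identifying any admissible candidate up to a null set.\<close>

lemma is_fourier_unique:
  assumes 1: "is_fourier f g" and 2: "is_fourier f h"
  shows "AE \<xi> in lborel. g \<xi> = h \<xi>"
proof -
  have [measurable]: "f \<in> borel_measurable borel" "g \<in> borel_measurable borel" "h \<in> borel_measurable borel"
    using 1 2 by (auto simp: is_fourier_def L2_def)
  have [measurable]: "trunc_ft f R \<in> borel_measurable borel" for R
    unfolding trunc_ft_eq ft_def[abs_def] by measurable
  let ?D = "\<lambda>g R. \<integral>\<^sup>+\<xi>. ennreal ((cmod (g \<xi> - trunc_ft f R \<xi>))\<^sup>2) \<partial>lborel"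
  have lim: "(?D g \<longlongrightarrow> 0) at_top" "(?D h \<longlongrightarrow> 0) at_top"
    using 1 2 by (auto simp: is_fourier_def trunc_ft_def)
  have "(\<integral>\<^sup>+\<xi>. ennreal ((cmod (g \<xi> - h \<xi>))\<^sup>2) \<partial>lborel) \<le> 2 * ?D g R + 2 * ?D h R" for R
  proof -
    have "(cmod (g \<xi> - h \<xi>))\<^sup>2 \<le> 2 * (cmod (g \<xi> - trunc_ft f R \<xi>))\<^sup>2 + 2 * (cmod (h \<xi> - trunc_ft f R \<xi>))\<^sup>2" for \<xi>
    proof -
      let ?a = "cmod (g \<xi> - trunc_ft f R \<xi>)" and ?b = "cmod (h \<xi> - trunc_ft f R \<xi>)"
      have "cmod (g \<xi> - h \<xi>) \<le> ?a + ?b"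
        using norm_triangle_ineq4[of "g \<xi> - trunc_ft f R \<xi>" "h \<xi> - trunc_ft f R \<xi>"] by simp
      then have "(cmod (g \<xi> - h \<xi>))\<^sup>2 \<le> (?a + ?b)\<^sup>2" by (rule power_mono) simp
      also have "\<dots> \<le> 2 * ?a\<^sup>2 + 2 * ?b\<^sup>2" using sum_squares_bound[of ?a ?b] by (simp add: power2_sum)
      finally show ?thesis .
    qed
    then have "(\<integral>\<^sup>+\<xi>. ennreal ((cmod (g \<xi> - h \<xi>))\<^sup>2) \<partial>lborel) \<le>
       (\<integral>\<^sup>+\<xi>. 2 * ennreal ((cmod (g \<xi> - trunc_ft f R \<xi>))\<^sup>2) + 2 * ennreal ((cmod (h \<xi> - trunc_ft f R \<xi>))\<^sup>2) \<partial>lborel)"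
      by (intro nn_integral_mono) (simp add: ennreal_leI flip: ennreal_plus ennreal_mult' ennreal_numeral)
    also have "\<dots> = 2 * ?D g R + 2 * ?D h R" by (simp add: nn_integral_add nn_integral_cmult)
    finally show ?thesis .
  qed
  moreover have "((\<lambda>R. 2 * ?D g R + 2 * ?D h R) \<longlongrightarrow> 2 * 0 + 2 * 0) at_top"
    by (intro tendsto_add ennreal_tendsto_cmult lim) auto
  ultimately have "(\<integral>\<^sup>+\<xi>. ennreal ((cmod (g \<xi> - h \<xi>))\<^sup>2) \<partial>lborel) \<le> 0"
    by (intro tendsto_lowerbound[where F="at_top::real filter"]) auto
  then have "AE \<xi> in lborel. ennreal ((cmod (g \<xi> - h \<xi>))\<^sup>2) = 0"
    by (subst nn_integral_0_iff_AE[symmetric]) auto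
  then show ?thesis by eventually_elim simp
qed

text \<open>The squared L2 distance between 2 * pi * f and the truncated transform is expanded.
  Fubini evaluates the cross term as the mass of u on the truncation interval, Bessel bounds the
  last term, and what is left is 2 * pi times the mass of u outside that interval.\<close>

lemma is_fourier_invF:
  fixes f :: "real \<Rightarrow> complex"
  assumes c: "continuous_on UNIV f" and d: "decay 2 A f"
  shows "is_fourier (invF f) (\<lambda>\<xi>. 2 * pi * f \<xi>)"
proof -
  define u where "u = invF f"
  have fi: "integrable lborel f" by (rule decay_integrable(1)[OF continuous_borel[OF c] d order_refl])
  have f2: "integrable lborel (\<lambda>x. (cmod (f x))\<^sup>2)" by (rule mass_integrable[OF c d])
  have uc: "continuous_on UNIV u" unfolding u_def by (rule continuous_invF[OF fi])
  note [measurable] = continuous_borel[OF c] continuous_borel[OF uc]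
  have u2: "integrable lborel (\<lambda>x. (cmod (u x))\<^sup>2)" unfolding u_def by (rule invF_bessel(1)[OF fi f2])
  have um: "mass u = 2 * pi * mass f" unfolding u_def by (rule invF_plancherel[OF c d])
  define g where "g R x = indicator {-R..R} x * u x" for R x
  define I where "I R = (LINT x|lborel. indicator {-R..R} x * (cmod (u x))\<^sup>2)" for R
  have g2: "(cmod (g R x))\<^sup>2 = indicator {-R..R} x * (cmod (u x))\<^sup>2" for R x by (simp add: g_def indicator_def)
  have g2i: "integrable lborel (\<lambda>x. (cmod (g R x))\<^sup>2)" for R
    unfolding g2 by (rule integrable_norm_le[OF u2]) (auto simp: indicator_def)
  have gi: "integrable lborel (g R)" for R
  proof -
    have "integrable lborel (\<lambda>x. indicator {-R..R} x *\<^sub>R u x)"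
      by (rule borel_integrable_compact) (auto intro: continuous_on_subset[OF uc])
    moreover have "g R = (\<lambda>x. indicator {-R..R} x *\<^sub>R u x)"
      by (simp add: g_def fun_eq_iff indicator_def)
    ultimately show ?thesis by simp
  qed
  have hc: "continuous_on UNIV (ft (g R))" for R by (rule continuous_ft[OF gi])
  note [measurable] = continuous_borel[OF hc]
  \<comment> \<open>Inserting the definition of the transform and exchanging integrals reproduces
    \<open>invF f\<close>, here called u, inside the interval.\<close>
  have cross: "(LINT \<xi>|lborel. f \<xi> * cnj (ft (g R) \<xi>)) = of_real (I R)"
    and crossi: "integrable lborel (\<lambda>\<xi>. f \<xi> * cnj (ft (g R) \<xi>))" for R
  proof -
    have gci: "integrable lborel (\<lambda>x. cnj (g R x))" using gi by simp
    have "integrable (lborel \<Otimes>\<^sub>M lborel) (\<lambda>p. (case p of (\<xi>, x) \<Rightarrow> f \<xi> * cnj (g R x)) * cis (fst p * snd p))"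
      by (rule integrable_mult_bounded[OF integrable_pair_prod[OF fi gci], where B=1]) auto
    then have J: "integrable (lborel \<Otimes>\<^sub>M lborel) (\<lambda>(\<xi>, x). f \<xi> * (cis (x * \<xi>) * cnj (g R x)))"
      by (simp add: case_prod_beta' mult_ac)
    have "f \<xi> * cnj (ft (g R) \<xi>) = (LINT x|lborel. f \<xi> * (cis (x * \<xi>) * cnj (g R x)))" for \<xi>
    proof -
      have "cnj (ft (g R) \<xi>) = (LINT x|lborel. cnj (cis (- (x * \<xi>)) * g R x))"
        unfolding ft_def by (rule Bochner_Integration.integral_cnj[symmetric])
      then show ?thesis by (simp add: cis_cnj)
    qed
    then have "(LINT \<xi>|lborel. f \<xi> * cnj (ft (g R) \<xi>)) = (LINT \<xi>|lborel. LINT x|lborel. f \<xi> * (cis (x * \<xi>) * cnj (g R x)))" by (simp only:)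
    also have "\<dots> = (LINT x|lborel. LINT \<xi>|lborel. f \<xi> * (cis (x * \<xi>) * cnj (g R x)))"
      by (rule lborel_pair.Fubini_integral[OF J, symmetric])
    also have "\<dots> = (LINT x|lborel. cnj (g R x) * u x)"
    proof (rule Bochner_Integration.integral_cong)
      fix x
      have "(LINT \<xi>|lborel. f \<xi> * (cis (x * \<xi>) * cnj (g R x))) = (LINT \<xi>|lborel. cnj (g R x) * (cis (x * \<xi>) * f \<xi>))"
        by (rule Bochner_Integration.integral_cong) (simp_all add: mult_ac)
      then show "(LINT \<xi>|lborel. f \<xi> * (cis (x * \<xi>) * cnj (g R x))) = cnj (g R x) * u x"
        by (simp add: u_def invF_def)
    qed simp
    also have "\<dots> = (LINT x|lborel. complex_of_real (indicator {-R..R} x * (cmod (u x))\<^sup>2))"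
      by (rule Bochner_Integration.integral_cong)
         (simp_all add: g_def indicator_def complex_norm_square mult.commute del: of_real_power)
    also have "\<dots> = of_real (I R)" unfolding I_def by (rule integral_complex_of_real)
    finally show "(LINT \<xi>|lborel. f \<xi> * cnj (ft (g R) \<xi>)) = of_real (I R)" .
    show "integrable lborel (\<lambda>\<xi>. f \<xi> * cnj (ft (g R) \<xi>))"
      by (rule integrable_mult_bounded[OF fi, where B="L1norm (g R)"]) (auto simp: norm_ft_le)
  qed
  have Ilim: "(I \<longlongrightarrow> mass u) at_top"
    unfolding I_def mass_def
  proof (rule integral_dominated_convergence_at_top[where w="\<lambda>x. (cmod (u x))\<^sup>2"])
    show "AE x in lborel. ((\<lambda>R. indicator {-R..R} x * (cmod (u x))\<^sup>2) \<longlongrightarrow> (cmod (u x))\<^sup>2) at_top"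
    proof (rule AE_I2)
      fix x :: real
      have "\<forall>\<^sub>F R in at_top. indicator {-R..R} x * (cmod (u x))\<^sup>2 = (cmod (u x))\<^sup>2"
        using eventually_ge_at_top[of "\<bar>x\<bar>"] by eventually_elim (auto simp: indicator_def abs_le_iff)
      then show "((\<lambda>R. indicator {-R..R} x * (cmod (u x))\<^sup>2) \<longlongrightarrow> (cmod (u x))\<^sup>2) at_top"
        by (rule tendsto_eventually)
    qed
  qed (use u2 in \<open>auto simp: indicator_def\<close>)
  have bound: "(\<integral>\<^sup>+\<xi>. ennreal ((cmod (2 * pi * f \<xi> - ft (g R) \<xi>))\<^sup>2) \<partial>lborel) \<le> ennreal (2 * pi * (mass u - I R))" for R
  proof -
    note B = ft_bessel[OF gi g2i, of R]
    have expand: "(cmod (2 * pi * f \<xi> - ft (g R) \<xi>))\<^sup>2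
       = 4 * pi\<^sup>2 * (cmod (f \<xi>))\<^sup>2 - 4 * pi * Re (f \<xi> * cnj (ft (g R) \<xi>)) + (cmod (ft (g R) \<xi>))\<^sup>2" for \<xi>
      unfolding cmod_power2 by (simp add: power2_eq_square algebra_simps)
    have i: "integrable lborel (\<lambda>\<xi>. (cmod (2 * pi * f \<xi> - ft (g R) \<xi>))\<^sup>2)"
      unfolding expand using f2 B(1) integrable_Re[OF crossi] by (intro Bochner_Integration.integrable_add Bochner_Integration.integrable_diff integrable_mult_right)
    have "(LINT \<xi>|lborel. (cmod (2 * pi * f \<xi> - ft (g R) \<xi>))\<^sup>2)
      = 4 * pi\<^sup>2 * mass f - 4 * pi * (LINT \<xi>|lborel. Re (f \<xi> * cnj (ft (g R) \<xi>))) + (LINT \<xi>|lborel. (cmod (ft (g R) \<xi>))\<^sup>2)"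
      unfolding expand mass_def
      by (subst Bochner_Integration.integral_add Bochner_Integration.integral_diff,
          (intro Bochner_Integration.integrable_diff integrable_mult_right f2 B(1) integrable_Re[OF crossi])+)+ 
         (simp only: integral_mult_right_zero)
    also have "(LINT \<xi>|lborel. Re (f \<xi> * cnj (ft (g R) \<xi>))) = I R"
      using integral_Re[OF crossi[of R]] cross[of R] by simp
    also have "4 * pi\<^sup>2 * mass f - 4 * pi * I R + (LINT \<xi>|lborel. (cmod (ft (g R) \<xi>))\<^sup>2) \<le> 2 * pi * (mass u - I R)"
      using B(2) unfolding g2 I_def[symmetric] um by (simp add: algebra_simps power2_eq_square)
    finally show ?thesis by (subst nn_integral_eq_integral[OF i]) (auto intro: ennreal_leI)
  qed
  have "((\<lambda>R. \<integral>\<^sup>+\<xi>. ennreal ((cmod (2 * pi * f \<xi> - trunc_ft u R \<xi>))\<^sup>2) \<partial>lborel) \<longlongrightarrow> 0) at_top"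
  proof (rule tendsto_sandwich[OF _ _ tendsto_const])
    have "((\<lambda>R. ennreal (2 * pi * (mass u - I R))) \<longlongrightarrow> ennreal (2 * pi * (mass u - mass u))) at_top"
      by (intro tendsto_ennrealI tendsto_intros Ilim)
    then show "((\<lambda>R. ennreal (2 * pi * (mass u - I R))) \<longlongrightarrow> 0) at_top" by simp
    show "\<forall>\<^sub>F R in at_top. (\<integral>\<^sup>+\<xi>. ennreal ((cmod (2 * pi * f \<xi> - trunc_ft u R \<xi>))\<^sup>2) \<partial>lborel) \<le> ennreal (2 * pi * (mass u - I R))"
      using bound by (intro always_eventually) (simp add: trunc_ft_eq g_def[abs_def])
  qed auto
  moreover have "L2 (\<lambda>\<xi>. 2 * pi * f \<xi>)"
    using f2 by (intro L2I) (auto simp: norm_mult power_mult_distrib)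
  moreover have "L2 u" using u2 by (intro L2I) auto
  ultimately show ?thesis by (simp add: is_fourier_def trunc_ft_def u_def)
qed

lemma fourier_invF:
  fixes f :: "real \<Rightarrow> complex"
  assumes "continuous_on UNIV f" "decay 2 A f"
  shows "AE \<xi> in lborel. fourier (invF f) \<xi> = 2 * pi * f \<xi>"
proof -
  have "is_fourier (invF f) (fourier (invF f))"
    unfolding fourier_def by (rule someI[where P="is_fourier (invF f)", OF is_fourier_invF[OF assms]])
  then show ?thesis using is_fourier_unique is_fourier_invF[OF assms] by blast
qed

text \<open>\<open>nonlin_hat\<close> is an absolutely convergent integral rather than a value of
  \<open>fourier\<close>, so pointwise inversion is required. Truncated transforms converge to
  \<open>ft (invF f)\<close> pointwise and to 2 * pi * f in L2; Fatou identifies the limits almost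
  everywhere and continuity removes the null set.\<close>

lemma ft_invF:
  fixes f :: "real \<Rightarrow> complex"
  assumes c: "continuous_on UNIV f" and d: "decay 2 A f" and u: "integrable lborel (invF f)"
  shows "ft (invF f) \<xi> = 2 * pi * f \<xi>"
proof -
  have fi: "integrable lborel f" by (rule decay_integrable(1)[OF continuous_borel[OF c] d order_refl])
  have uc: "continuous_on UNIV (invF f)" by (rule continuous_invF[OF fi])
  have hc: "continuous_on UNIV (ft (invF f))" by (rule continuous_ft[OF u])
  note [measurable] = continuous_borel[OF c] continuous_borel[OF uc] continuous_borel[OF hc]
  have [measurable]: "trunc_ft (invF f) R \<in> borel_measurable borel" for R
    unfolding trunc_ft_eq ft_def[abs_def] by measurable
  have lim: "(\<lambda>n. trunc_ft (invF f) (real n) \<xi>) \<longlonglongrightarrow> ft (invF f) \<xi>" for \<xi>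
    unfolding trunc_ft_eq ft_def
  proof (rule integral_dominated_convergence[where w="\<lambda>x. cmod (invF f x)"])
    show "AE x in lborel. (\<lambda>n. cis (- (x * \<xi>)) * (indicator {- real n..real n} x * invF f x)) \<longlonglongrightarrow> cis (- (x * \<xi>)) * invF f x"
    proof (rule AE_I2)
      fix x :: real
      obtain N :: nat where N: "\<bar>x\<bar> \<le> real N" using real_arch_simple by blast
      have "\<forall>\<^sub>F n in sequentially. cis (- (x * \<xi>)) * (indicator {- real n..real n} x * invF f x) = cis (- (x * \<xi>)) * invF f x"
        using eventually_ge_at_top[of N]
      proof eventually_elim
        fix n assume "N \<le> n"
        then have "\<bar>x\<bar> \<le> real n" using N by linarith
        then have "x \<in> {- real n..real n}" by auto
        then show "cis (- (x * \<xi>)) * (indicator {- real n..real n} x * invF f x) = cis (- (x * \<xi>)) * invF f x" by simp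
      qed
      then show "(\<lambda>n. cis (- (x * \<xi>)) * (indicator {- real n..real n} x * invF f x)) \<longlonglongrightarrow> cis (- (x * \<xi>)) * invF f x"
        by (rule tendsto_eventually)
    qed
  qed (use u in \<open>auto simp: norm_mult indicator_def\<close>)
  let ?D = "\<lambda>R. \<integral>\<^sup>+\<xi>. ennreal ((cmod (2 * pi * f \<xi> - trunc_ft (invF f) R \<xi>))\<^sup>2) \<partial>lborel"
  have "(?D \<longlongrightarrow> 0) at_top" using is_fourier_invF[OF c d] by (simp add: is_fourier_def trunc_ft_def)
  then have D: "(\<lambda>n. ?D (real n)) \<longlonglongrightarrow> 0" by (rule filterlim_compose[OF _ filterlim_real_sequentially])
  have "(\<integral>\<^sup>+\<xi>. ennreal ((cmod (2 * pi * f \<xi> - ft (invF f) \<xi>))\<^sup>2) \<partial>lborel)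
     = (\<integral>\<^sup>+\<xi>. liminf (\<lambda>n. ennreal ((cmod (2 * pi * f \<xi> - trunc_ft (invF f) (real n) \<xi>))\<^sup>2)) \<partial>lborel)"
    by (intro nn_integral_cong lim_imp_Liminf[symmetric] tendsto_ennrealI tendsto_intros lim) simp
  also have "\<dots> \<le> liminf (\<lambda>n. ?D (real n))" by (rule nn_integral_liminf) auto
  also have "\<dots> = 0" by (rule lim_imp_Liminf[OF _ D]) simp
  finally have "AE \<xi> in lborel. ennreal ((cmod (2 * pi * f \<xi> - ft (invF f) \<xi>))\<^sup>2) = 0"
    by (subst nn_integral_0_iff_AE[symmetric]) auto
  then have "AE \<xi> in lborel. ft (invF f) \<xi> = 2 * pi * f \<xi>" by eventually_elim simp
  then show ?thesis by (rule continuous_AE_eq[rotated 2]) (intro hc continuous_intros c)+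
qed

section \<open>Global solutions\<close>

definition Hs_int :: "real \<Rightarrow> (real \<Rightarrow> complex) \<Rightarrow> real" where
  "Hs_int \<sigma> f = (LINT \<xi>|lborel. jbr \<xi> powr (2 * \<sigma>) * (cmod (f \<xi>))\<^sup>2)"

definition rapid :: "(real \<Rightarrow> complex) \<Rightarrow> bool" where
  "rapid f \<longleftrightarrow> continuous_on UNIV f \<and> (\<forall>k. \<exists>C. decay k C f)"

lemma rapid_diff:
  assumes "rapid f" "rapid g" shows "rapid (\<lambda>x. f x - g x)"
  unfolding rapid_def
proof (intro conjI allI)
  show "continuous_on UNIV (\<lambda>x. f x - g x)" using assms by (auto simp: rapid_def intro!: continuous_intros)
  fix k
  obtain A B where "decay k A f" "decay k B g" using assms by (meson rapid_def)
  from decay_diff[OF this] show "\<exists>C. decay k C (\<lambda>x. f x - g x)" by blast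
qed

lemma jbr_measurable [measurable]: "jbr \<in> borel_measurable borel"
  unfolding jbr_def[abs_def] by measurable

lemma jbr_pos: "0 < jbr \<xi>" and jbr_le_J: "jbr \<xi> \<le> J \<xi>"
proof -
  show "0 < jbr \<xi>" by (simp add: jbr_def add_pos_nonneg)
  have "1 + \<xi>\<^sup>2 \<le> (1 + \<bar>\<xi>\<bar>)\<^sup>2" by (simp add: power2_sum)
  then show "jbr \<xi> \<le> J \<xi>" unfolding jbr_def J_def by (rule real_le_lsqrt[rotated 1]) simp
qed

lemma jbr_weight_le: "\<exists>m. \<forall>\<xi>. jbr \<xi> powr (2 * \<sigma>) \<le> J \<xi> ^ m"
proof (intro exI allI)
  fix \<xi>
  have "jbr \<xi> powr (2 * \<sigma>) \<le> jbr \<xi> powr real (nat \<lceil>2 * \<sigma>\<rceil>)"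
    by (rule powr_mono) (auto simp: jbr_def real_nat_ceiling_ge)
  also have "\<dots> \<le> J \<xi> powr real (nat \<lceil>2 * \<sigma>\<rceil>)"
    using jbr_pos jbr_le_J by (intro powr_mono2) (auto simp: less_imp_le)
  also have "\<dots> = J \<xi> ^ nat \<lceil>2 * \<sigma>\<rceil>" by (simp add: powr_realpow)
  finally show "jbr \<xi> powr (2 * \<sigma>) \<le> J \<xi> ^ nat \<lceil>2 * \<sigma>\<rceil>" .
qed

lemma Hs_integrand_le:
  assumes "jbr \<xi> powr (2 * \<sigma>) \<le> J \<xi> ^ m" "decay (m + 2) C f"
  shows "jbr \<xi> powr (2 * \<sigma>) * (cmod (f \<xi>))\<^sup>2 \<le> C\<^sup>2 / J \<xi> ^ 2"
proof -
  have "cmod (f \<xi>) \<le> C / J \<xi> ^ (m + 2)" using assms(2) by (simp add: decay_def)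
  then have "(cmod (f \<xi>))\<^sup>2 \<le> (C / J \<xi> ^ (m + 2))\<^sup>2" by (rule power_mono) simp
  then have "jbr \<xi> powr (2 * \<sigma>) * (cmod (f \<xi>))\<^sup>2 \<le> J \<xi> ^ m * (C / J \<xi> ^ (m + 2))\<^sup>2"
    using assms(1) by (intro mult_mono) auto
  also have "\<dots> = C\<^sup>2 / J \<xi> ^ (m + 4)" by (simp add: power_divide power_add field_simps power2_eq_square eval_nat_numeral)
  also have "\<dots> \<le> C\<^sup>2 / J \<xi> ^ 2" by (intro divide_left_mono power_increasing) auto
  finally show ?thesis .
qed

lemma Hs_integrable:
  assumes "rapid f" shows "integrable lborel (\<lambda>\<xi>. jbr \<xi> powr (2 * \<sigma>) * (cmod (f \<xi>))\<^sup>2)"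
proof -
  obtain m where m: "\<And>\<xi>. jbr \<xi> powr (2 * \<sigma>) \<le> J \<xi> ^ m" using jbr_weight_le by blast
  obtain C where C: "decay (m + 2) C f" using assms by (auto simp: rapid_def)
  have [measurable]: "f \<in> borel_measurable borel" using assms by (auto simp: rapid_def continuous_borel)
  show ?thesis
    by (rule integrable_norm_le[OF integrable_inverse_J2[of "C\<^sup>2"]]) (use Hs_integrand_le[OF m C] in auto)
qed

lemma Hs_nn_integral:
  assumes f: "rapid f"
  shows "(\<integral>\<^sup>+ \<xi>. ennreal (jbr \<xi> powr (2 * \<sigma>) * (cmod (fourier (invF f) \<xi>))\<^sup>2) \<partial>lborel) = ennreal (4 * pi\<^sup>2 * Hs_int \<sigma> f)"
proof -
  obtain A where "continuous_on UNIV f" "decay 2 A f" using f by (auto simp: rapid_def)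
  from fourier_invF[OF this]
  have "(\<integral>\<^sup>+ \<xi>. ennreal (jbr \<xi> powr (2 * \<sigma>) * (cmod (fourier (invF f) \<xi>))\<^sup>2) \<partial>lborel)
     = (\<integral>\<^sup>+ \<xi>. ennreal (4 * pi\<^sup>2 * (jbr \<xi> powr (2 * \<sigma>) * (cmod (f \<xi>))\<^sup>2)) \<partial>lborel)"
    by (intro nn_integral_cong_AE, elim eventually_mono) (simp add: norm_mult power_mult_distrib mult_ac)
  also have "\<dots> = ennreal (LINT \<xi>|lborel. 4 * pi\<^sup>2 * (jbr \<xi> powr (2 * \<sigma>) * (cmod (f \<xi>))\<^sup>2))"
    using Hs_integrable[OF f] by (intro nn_integral_eq_integral) auto
  finally show ?thesis by (simp add: Hs_int_def)
qed

lemma Hs_int_nonneg: "0 \<le> Hs_int \<sigma> f"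
  unfolding Hs_int_def by (intro Bochner_Integration.integral_nonneg) auto

text \<open>The square of the factor 2 * pi from \<open>fourier_invF\<close>, divided by the 2 * pi
  of the norm, leaves one such factor under the root.\<close>

lemma Hs_norm_invF:
  assumes f: "rapid f"
  shows "Hs_norm \<sigma> (invF f) = sqrt (2 * pi * Hs_int \<sigma> f)"
proof -
  have "1 / sqrt (2 * pi) * sqrt (4 * pi\<^sup>2 * Hs_int \<sigma> f) = sqrt (4 * pi\<^sup>2 * Hs_int \<sigma> f / (2 * pi))"
    by (subst real_sqrt_divide) (simp only: mult_1_left times_divide_eq_left)
  also have "4 * pi\<^sup>2 * Hs_int \<sigma> f / (2 * pi) = 2 * pi * Hs_int \<sigma> f" by (simp add: field_simps power2_eq_square)
  finally show ?thesis unfolding Hs_norm_def Hs_nn_integral[OF f] using Hs_int_nonneg by simp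
qed

lemma in_Hs_invF:
  assumes f: "rapid f" shows "in_Hs \<sigma> (invF f)"
proof -
  obtain A where "continuous_on UNIV f" "decay 2 A f" using f by (auto simp: rapid_def)
  then have "L2 (invF f)" using is_fourier_invF by (auto simp: is_fourier_def)
  then show ?thesis unfolding in_Hs_def Hs_nn_integral[OF f] by simp
qed

lemma rapid_integrable: "rapid f \<Longrightarrow> integrable lborel f"
  unfolding rapid_def by (meson continuous_borel decay_integrable(1) order_refl)

lemma invF_diff:
  assumes "rapid f" "rapid g"
  shows "invF (\<lambda>\<xi>. f \<xi> - g \<xi>) = (\<lambda>x. invF f x - invF g x)"
  using integrable_phase[OF rapid_integrable[OF assms(1)]] integrable_phase[OF rapid_integrable[OF assms(2)]]
  by (simp add: invF_def right_diff_distrib fun_eq_iff)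

lemma Hs_norm_diff:
  "rapid f \<Longrightarrow> rapid g \<Longrightarrow> Hs_norm \<sigma> (\<lambda>x. invF f x - invF g x) = sqrt (2 * pi * Hs_int \<sigma> (\<lambda>\<xi>. f \<xi> - g \<xi>))"
  using Hs_norm_invF[OF rapid_diff] invF_diff by metis

text \<open>Conjugating the Fourier side is u(x) -> cnj (u(- x)) on the physical side, under which
  the nonlinearity is equivariant. Combined with reversal of time it is a symmetry of the
  equation.\<close>

lemma cubic_cnj: "cubic (\<lambda>\<xi>. cnj (f \<xi>)) = (\<lambda>\<xi>. cnj (cubic f \<xi>))"
proof -
  have c: "conv (\<lambda>\<xi>. cnj (f \<xi>)) (\<lambda>\<xi>. cnj (g \<xi>)) = (\<lambda>\<xi>. cnj (conv f g \<xi>))" for f g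
    unfolding conv_def complex_cnj_mult[symmetric] by (intro ext Bochner_Integration.integral_cnj)
  have fl: "flip (\<lambda>\<xi>. cnj (f \<xi>)) = (\<lambda>\<xi>. cnj (flip f \<xi>))" by (rule ext) (simp add: flip_def)
  show ?thesis unfolding cubic_def fl c ..
qed

lemma invF_cubic:
  assumes c: "continuous_on UNIV f" and d: "decay 2 A f"
  shows "invF (cubic f) x = complex_of_real ((cmod (invF f x))\<^sup>2) * invF f x"
proof -
  have i: "integrable lborel f" by (rule decay_integrable(1)[OF continuous_borel[OF c] d order_refl])
  have ci: "integrable lborel (conv f (flip f))" by (rule conv_integrable(1)[OF i integrable_flip[OF i]])
  show ?thesis
    unfolding cubic_def complex_norm_square
    by (simp only: invF_conv[OF ci i] invF_conv[OF i integrable_flip[OF i]] invF_flip)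
qed

text \<open>Reality of the data on the Fourier side makes the forward solution and its conjugated
  reflection agree at time 0.\<close>

locale global_halfwave =
  fixes \<mu> :: real and W :: "real \<Rightarrow> real \<Rightarrow> complex"
  assumes flow: "halfwave_flow \<mu> W" and real0: "\<And>\<xi>. cnj (W 0 \<xi>) = W 0 \<xi>"
begin

definition Vp where "Vp t \<xi> = cis (- (t * \<bar>\<xi>\<bar>)) * W t \<xi>"

text \<open>For real data, complex conjugation continues the forward solution to negative times.\<close>
definition V where "V t \<xi> = (if 0 \<le> t then Vp t \<xi> else cnj (Vp (- t) \<xi>))"

lemma profile:
  "\<exists>n w. 4 \<le> n \<and> m \<le> n \<and> T \<le> real n \<and> halfwave_profile \<mu> (real n) n w \<and> (\<forall>t\<in>{0..real n}. W t = w t)"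
proof -
  define n where "n = max 4 (max m (nat \<lceil>T\<rceil>))"
  have n: "4 \<le> n" "m \<le> n" "T \<le> real n" by (auto simp: n_def) linarith
  then show ?thesis using flow unfolding halfwave_flow_def by blast
qed

lemma \<mu>: "\<mu> \<in> {-1, 1}"
  using profile[of 0 0] halfwave_profile.\<mu> by blast

lemma Vp_eq: assumes "halfwave_profile \<mu> T n w" "W t = w t" shows "Vp t = halfwave_profile.v w t"
  using assms by (simp add: Vp_def fun_eq_iff halfwave_profile.v_def)

lemma Vp_uniform: "\<exists>C. \<forall>t\<in>{0..T}. decay k C (Vp t)"
proof -
  obtain n w where nw: "4 \<le> n" "k \<le> n" "T \<le> real n" "halfwave_profile \<mu> (real n) n w" "\<And>t. t \<in> {0..real n} \<Longrightarrow> W t = w t"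
    using profile[of k T] by blast
  interpret halfwave_profile \<mu> "real n" n w by fact
  obtain C where "\<And>t. \<bar>t\<bar> \<le> T \<Longrightarrow> decay k C (v t)" using ldecayE[OF ldecay_mono[OF ldecay_v nw(2)]] by metis
  then show ?thesis using Vp_eq[OF nw(4)] nw(3,5) by (intro exI[of _ C]) simp
qed

lemma V_uniform: "\<exists>C. \<forall>t. \<bar>t\<bar> \<le> T \<longrightarrow> decay k C (V t)"
proof -
  obtain C where C: "\<And>t. t \<in> {0..T} \<Longrightarrow> decay k C (Vp t)" using Vp_uniform by blast
  have "decay k C (V t)" if "\<bar>t\<bar> \<le> T" for t
    using C[of t] C[of "- t"] that by (cases "0 \<le> t") (auto simp: V_def[abs_def] decay_def)
  then show ?thesis by blast
qed

lemma Vp_continuous: assumes "0 \<le> t" shows "continuous_on UNIV (Vp t)"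
proof -
  obtain n w where nw: "4 \<le> n" "0 \<le> n" "t \<le> real n" "halfwave_profile \<mu> (real n) n w" "\<And>t. t \<in> {0..real n} \<Longrightarrow> W t = w t"
    using profile[of 0 t] by blast
  then show ?thesis using Vp_eq[OF nw(4)] halfwave_profile.continuous_v[OF nw(4)] assms by simp
qed

lemma V_rapid: "rapid (V t)"
proof -
  have "continuous_on UNIV (V t)"
    using Vp_continuous[of t] Vp_continuous[of "- t"] by (cases "0 \<le> t") (auto simp: V_def[abs_def] intro!: continuous_intros)
  moreover have "\<exists>C. decay k C (V t)" for k using V_uniform[of "\<bar>t\<bar>" k] by (metis order_refl)
  ultimately show ?thesis by (simp add: rapid_def)
qed

lemma continuous_V: "continuous_on UNIV (V t)" and decay_V: "\<exists>C. decay k C (V t)"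
  using V_rapid by (auto simp: rapid_def)

lemma Vp0: "Vp 0 = W 0"
  by (simp add: Vp_def fun_eq_iff)

lemma V0: "V 0 = W 0"
  by (simp add: V_def[abs_def] Vp0)

lemma continuous_on_halfline:
  fixes c :: "real \<Rightarrow> complex"
  assumes "\<And>n. 4 \<le> n \<Longrightarrow> continuous_on {0..real n} c" shows "continuous_on {0..} c"
  unfolding continuous_on_eq_continuous_within
proof
  fix x :: real assume x: "x \<in> {0..}"
  define n where "n = max 4 (nat \<lceil>x\<rceil> + 1)"
  have n: "4 \<le> n" "x < real n" by (auto simp: n_def) linarith
  have "at x within {0..} = at x within {0..real n}"
    by (rule at_within_nhd[of x "{..<real n}"]) (use n in auto)
  moreover have "continuous (at x within {0..real n}) c"
    using assms[OF n(1)] x n(2) by (auto simp: continuous_on_eq_continuous_within)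
  ultimately show "continuous (at x within {0..}) c" by (simp add: continuous_within)
qed

lemma continuous_on_reflect:
  fixes c :: "real \<Rightarrow> complex"
  assumes c: "continuous_on {0..} c" and r: "cnj (c 0) = c 0"
  shows "continuous_on UNIV (\<lambda>t. if 0 \<le> t then c t else cnj (c (- t)))"
proof -
  have "continuous_on ({0..} \<union> {..0}) (\<lambda>t. if 0 \<le> t then c t else cnj (c (- t)))"
    using c r by (intro continuous_on_If continuous_intros continuous_on_compose2[OF c]) auto
  moreover have "{0..} \<union> {..0} = (UNIV :: real set)" by auto
  ultimately show ?thesis by simp
qed

lemma V_continuous_time: "continuous_on UNIV (\<lambda>t. V t \<xi>)"
  unfolding V_def
proof (rule continuous_on_reflect[OF continuous_on_halfline])
  fix n :: nat assume n: "4 \<le> n"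
  obtain w where w: "halfwave_profile \<mu> (real n) n w" "\<And>t. t \<in> {0..real n} \<Longrightarrow> W t = w t"
    using flow n unfolding halfwave_flow_def by blast
  have "continuous_on {0..real n} (\<lambda>t. halfwave_profile.v w t \<xi>)"
    by (rule jcont_slice(2)[OF halfwave_profile.jcont_v[OF w(1)]])
  then show "continuous_on {0..real n} (\<lambda>t. Vp t \<xi>)"
    by (rule continuous_on_eq) (use Vp_eq[OF w(1) w(2)] in simp)
qed (simp add: Vp0 real0)

lemma cubic_V: "cubic (V t) \<xi> = (if 0 \<le> t then cubic (Vp t) \<xi> else cnj (cubic (Vp (- t)) \<xi>))"
  using cubic_cnj[of "Vp (- t)"] by (simp add: V_def[abs_def])

lemma cubic_V_continuous_time: "continuous_on UNIV (\<lambda>t. cubic (V t) \<xi>)"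
  unfolding cubic_V
proof (rule continuous_on_reflect[OF continuous_on_halfline])
  fix n :: nat assume n: "4 \<le> n"
  obtain w where w: "halfwave_profile \<mu> (real n) n w" "\<And>t. t \<in> {0..real n} \<Longrightarrow> W t = w t"
    using flow n unfolding halfwave_flow_def by blast
  have "continuous_on {0..real n} (\<lambda>t. cubic (halfwave_profile.v w t) \<xi>)"
    by (rule jcont_slice(2)[OF halfwave_profile.jcont_cubic_v[OF w(1)]])
  then show "continuous_on {0..real n} (\<lambda>t. cubic (Vp t) \<xi>)"
    by (rule continuous_on_eq) (use Vp_eq[OF w(1) w(2)] in simp)
next
  have "(\<lambda>\<xi>. cnj (W 0 \<xi>)) = W 0" using real0 by (rule ext)
  then show "cnj (cubic (Vp 0) \<xi>) = cubic (Vp 0) \<xi>"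
    using cubic_cnj[of "W 0"] unfolding Vp0 by metis
qed

lemma W_deriv:
  assumes t: "t \<in> {0..T}"
  shows "((\<lambda>t. W t \<xi>) has_vector_derivative - \<i> * of_real \<mu> * (cis (t * \<bar>\<xi>\<bar>) * cubic (Vp t) \<xi>)) (at t within {0..T})"
proof -
  obtain n w where nw: "4 \<le> n" "0 \<le> n" "T \<le> real n" "halfwave_profile \<mu> (real n) n w" "\<And>t. t \<in> {0..real n} \<Longrightarrow> W t = w t"
    using profile[of 0 T] by blast
  interpret halfwave_profile \<mu> "real n" n w by fact
  have tn: "t \<in> {0..real n}" using t nw by auto
  have "((\<lambda>t. w t \<xi>) has_vector_derivative - \<i> * of_real \<mu> * (cis (t * \<bar>\<xi>\<bar>) * cubic (Vp t) \<xi>)) (at t within {0..T})"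
    using has_vector_derivative_within_subset[OF w_deriv[OF tn, of \<xi>], of "{0..T}"] nw(3) Vp_eq[OF nw(4) nw(5)[OF tn]]
    by (simp add: flow_w)
  then show ?thesis
    by (rule has_vector_derivative_transform[OF t, rotated]) (use nw in auto)
qed

text \<open>Stated on the unoriented interval between 0 and t, as the fundamental theorem for
  interval integrals expects. For t < 0 the sign from reversing time and the sign from conjugating
  \<i> cancel, so the same equation holds on both sides.\<close>

lemma V_duhamel_deriv:
  assumes s: "s \<in> {min 0 t..max 0 t}"
  shows "((\<lambda>s. cis (s * \<bar>\<xi>\<bar>) * V s \<xi>) has_vector_derivative - \<i> * of_real \<mu> * (cis (s * \<bar>\<xi>\<bar>) * cubic (V s) \<xi>))
    (at s within {min 0 t..max 0 t})"
proof (cases "0 \<le> t")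
  case True
  then have S: "{min 0 t..max 0 t} = {0..t}" by auto
  have "cis (r * \<bar>\<xi>\<bar>) * V r \<xi> = W r \<xi>" if "r \<in> {0..t}" for r
    using that by (simp add: V_def Vp_def cis_mult flip: mult.assoc)
  then show ?thesis
    using s W_deriv[of s t \<xi>] unfolding S cubic_V by (auto intro: has_vector_derivative_transform[rotated])
next
  case False
  then have S: "{min 0 t..max 0 t} = {t..0}" by auto
  have eq: "cis (r * \<bar>\<xi>\<bar>) * V r \<xi> = cnj (W (- r) \<xi>)" if "r \<in> {t..0}" for r
  proof (cases "r = 0")
    case True
    then show ?thesis by (simp add: V0 real0)
  next
    case False
    then show ?thesis using that by (simp add: V_def Vp_def cis_cnj cis_mult flip: mult.assoc)
  qed
  have s': "- s \<in> {0..-t}" using s unfolding S by auto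
  have im: "uminus ` {t..0} \<subseteq> {0..- t}" by auto
  let ?g = "- \<i> * of_real \<mu> * (cis (- s * \<bar>\<xi>\<bar>) * cubic (Vp (- s)) \<xi>)"
  have "(((\<lambda>r. W r \<xi>) \<circ> uminus) has_vector_derivative (-1) *\<^sub>R ?g) (at s within {t..0})"
  proof (rule vector_diff_chain_within)
    show "((\<lambda>r. W r \<xi>) has_vector_derivative ?g) (at (- s) within uminus ` {t..0})"
      by (rule has_vector_derivative_within_subset[OF W_deriv[OF s'] im])
  qed (auto intro!: derivative_eq_intros)
  from bounded_linear.has_vector_derivative[OF bounded_linear_cnj this]
  have "((\<lambda>r. cnj (W (- r) \<xi>)) has_vector_derivative cnj ((-1) *\<^sub>R ?g)) (at s within {t..0})" by (simp add: comp_def)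
  moreover have "cnj ((-1) *\<^sub>R ?g) = - \<i> * of_real \<mu> * (cis (s * \<bar>\<xi>\<bar>) * cubic (V s) \<xi>)"
  proof -
    have "cnj (cubic (Vp (- s)) \<xi>) = cubic (V s) \<xi>"
    proof (cases "s = 0")
      case True
      have "(\<lambda>\<xi>. cnj (W 0 \<xi>)) = W 0" using real0 by (rule ext)
      then show ?thesis using True cubic_cnj[of "W 0"] by (simp add: cubic_V Vp0) metis
    next
      case False
      then show ?thesis using s unfolding S by (simp add: cubic_V)
    qed
    then show ?thesis by (simp add: cis_cnj)
  qed
  ultimately have D: "((\<lambda>r. cnj (W (- r) \<xi>)) has_vector_derivative - \<i> * of_real \<mu> * (cis (s * \<bar>\<xi>\<bar>) * cubic (V s) \<xi>)) (at s within {t..0})"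
    by (simp only:)
  show ?thesis
    unfolding S by (rule has_vector_derivative_transform[OF _ eq D]) (use s S in auto)
qed

definition u where "u t x = invF (V t) x"

lemma nonlinearity_integrable: "integrable lborel (\<lambda>x. complex_of_real ((cmod (u t x))\<^sup>2) * u t x)"
proof -
  obtain A where A: "decay 2 A (V t)" using decay_V by blast
  have i: "integrable lborel (V t)" by (rule rapid_integrable[OF V_rapid])
  have "integrable lborel (\<lambda>x. (cmod (u t x))\<^sup>2)"
    unfolding u_def by (rule invF_bessel(1)[OF i mass_integrable[OF continuous_V A]])
  then show ?thesis
    by (intro integrable_mult_bounded[where B="L1norm (V t)"] integrable_of_real)
       (auto simp: u_def[abs_def] norm_invF_le intro!: continuous_borel continuous_invF i)
qed

lemma nonlin_hat_u: "nonlin_hat u t \<xi> = 2 * pi * cubic (V t) \<xi>"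
proof -
  obtain A where A: "decay 2 A (V t)" using decay_V by blast
  have eq: "invF (cubic (V t)) = (\<lambda>x. complex_of_real ((cmod (u t x))\<^sup>2) * u t x)"
    using invF_cubic[OF continuous_V A] by (simp add: u_def fun_eq_iff)
  have "ft (invF (cubic (V t))) \<xi> = 2 * pi * cubic (V t) \<xi>"
    using nonlinearity_integrable by (intro ft_invF[OF continuous_cubic[OF continuous_V A] decay_cubic[OF continuous_V A]]) (simp add: eq)
  then show ?thesis unfolding eq by (simp add: nonlin_hat_def ft_def)
qed

lemma duhamel:
  fixes t \<xi> :: real
  defines "g \<equiv> \<lambda>\<tau>. cis (- ((t - \<tau>) * \<bar>\<xi>\<bar>)) * nonlin_hat u \<tau> \<xi>"
  shows "interval_lebesgue_integrable lborel 0 (ereal t) g"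
    and "2 * pi * V t \<xi> = cis (- (t * \<bar>\<xi>\<bar>)) * (2 * pi * V 0 \<xi>) - \<i> * of_real \<mu> * (LBINT \<tau>=0..t. g \<tau>)"
proof -
  have gc: "continuous_on UNIV g"
    unfolding g_def nonlin_hat_u by (intro continuous_intros cubic_V_continuous_time)
  have "interval_lebesgue_integrable lborel (ereal 0) (ereal t) g"
    using gc by (intro interval_integrable_isCont) (auto simp: continuous_on_eq_continuous_at)
  then show "interval_lebesgue_integrable lborel 0 (ereal t) g" by (simp add: zero_ereal_def)
  \<comment> \<open>The integrating factor exp (i s |\<xi>|), normalised so that F t is the
    transform at time t and F 0 is the free evolution of the datum.\<close>
  define F where "F s = 2 * pi * cis (- (t * \<bar>\<xi>\<bar>)) * (cis (s * \<bar>\<xi>\<bar>) * V s \<xi>)" for s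
  have "(LBINT \<tau>=ereal 0..ereal t. - \<i> * of_real \<mu> * g \<tau>) = F t - F 0"
  proof (rule interval_integral_FTC_finite)
    show "continuous_on {min 0 t..max 0 t} (\<lambda>\<tau>. - \<i> * of_real \<mu> * g \<tau>)"
      by (intro continuous_intros continuous_on_subset[OF gc]) auto
    fix s assume s: "min 0 t \<le> s" "s \<le> max 0 t"
    have "(F has_vector_derivative (2 * pi * cis (- (t * \<bar>\<xi>\<bar>))) * (- \<i> * of_real \<mu> * (cis (s * \<bar>\<xi>\<bar>) * cubic (V s) \<xi>)))
       (at s within {min 0 t..max 0 t})"
      unfolding F_def using s by (intro has_vector_derivative_mult_right V_duhamel_deriv) auto
    moreover have "cis (- ((t - s) * \<bar>\<xi>\<bar>)) = cis (- (t * \<bar>\<xi>\<bar>)) * cis (s * \<bar>\<xi>\<bar>)"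
      by (simp add: cis_mult algebra_simps)
    ultimately show "(F has_vector_derivative - \<i> * of_real \<mu> * g s) (at s within {min 0 t..max 0 t})"
      by (simp add: g_def nonlin_hat_u mult_ac)
  qed
  then have "- \<i> * of_real \<mu> * (LBINT \<tau>=0..t. g \<tau>) = F t - F 0"
    by (simp only: interval_lebesgue_integral_mult_right zero_ereal_def)
  moreover have "F t = 2 * pi * V t \<xi>"
    by (simp add: F_def cis_mult flip: mult.assoc)
  moreover have "F 0 = cis (- (t * \<bar>\<xi>\<bar>)) * (2 * pi * V 0 \<xi>)" by (simp add: F_def)
  ultimately show "2 * pi * V t \<xi> = cis (- (t * \<bar>\<xi>\<bar>)) * (2 * pi * V 0 \<xi>) - \<i> * of_real \<mu> * (LBINT \<tau>=0..t. g \<tau>)"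
    by (simp add: algebra_simps)
qed

lemma Hs_continuous: "((\<lambda>t. Hs_norm \<sigma> (\<lambda>x. u t x - u t0 x)) \<longlongrightarrow> 0) (at t0)"
proof -
  obtain m where m: "\<And>\<xi>. jbr \<xi> powr (2 * \<sigma>) \<le> J \<xi> ^ m" using jbr_weight_le by blast
  have "continuous_on UNIV (\<lambda>t. LINT \<xi>|lborel. jbr \<xi> powr (2 * \<sigma>) * (cmod (V t \<xi> - V t0 \<xi>))\<^sup>2)"
  proof (rule continuous_on_LINT_dominated)
    fix t :: real
    show "(\<lambda>\<xi>. jbr \<xi> powr (2 * \<sigma>) * (cmod (V t \<xi> - V t0 \<xi>))\<^sup>2) \<in> borel_measurable lborel"
      using continuous_borel[OF continuous_V] by simp
    obtain C where C: "\<And>s. \<bar>s\<bar> \<le> \<bar>t\<bar> + 1 \<Longrightarrow> decay (m + 2) C (V s)" using V_uniform by blast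
    obtain D where D: "decay (m + 2) D (V t0)" using decay_V by blast
    show "\<exists>e>0. \<exists>g. integrable lborel g \<and> (\<forall>y\<in>ball t e. \<forall>\<xi>. norm (jbr \<xi> powr (2 * \<sigma>) * (cmod (V y \<xi> - V t0 \<xi>))\<^sup>2) \<le> g \<xi>)"
    proof (intro exI[of _ 1] conjI exI[of _ "\<lambda>\<xi>. (C + D)\<^sup>2 / J \<xi> ^ 2"] ballI allI)
      fix s \<xi> assume "s \<in> ball t 1"
      then have "\<bar>s\<bar> \<le> \<bar>t\<bar> + 1" by (auto simp: dist_real_def)
      from Hs_integrand_le[OF m decay_diff[OF C[OF this] D]]
      show "norm (jbr \<xi> powr (2 * \<sigma>) * (cmod (V s \<xi> - V t0 \<xi>))\<^sup>2) \<le> (C + D)\<^sup>2 / J \<xi> ^ 2" by simp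
    qed auto
  qed (intro continuous_intros V_continuous_time)
  then have "continuous_on UNIV (\<lambda>t. sqrt (2 * pi * Hs_int \<sigma> (\<lambda>\<xi>. V t \<xi> - V t0 \<xi>)))"
    unfolding Hs_int_def by (intro continuous_intros)
  then have "((\<lambda>t. sqrt (2 * pi * Hs_int \<sigma> (\<lambda>\<xi>. V t \<xi> - V t0 \<xi>))) \<longlongrightarrow> sqrt (2 * pi * Hs_int \<sigma> (\<lambda>\<xi>. V t0 \<xi> - V t0 \<xi>))) (at t0)"
    unfolding continuous_on_def by blast
  moreover have "sqrt (2 * pi * Hs_int \<sigma> (\<lambda>\<xi>. V t0 \<xi> - V t0 \<xi>)) = 0" by (simp add: Hs_int_def)
  ultimately show ?thesis unfolding u_def Hs_norm_diff[OF V_rapid V_rapid] by simp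
qed

theorem global_solution: "half_wave_global_solution \<mu> u"
proof -
  have hat: "AE \<xi> in lborel. fourier (u t) \<xi> = 2 * pi * V t \<xi>" for t
  proof -
    obtain A where "decay 2 A (V t)" using decay_V by blast
    from fourier_invF[OF continuous_V this] show ?thesis by (simp add: u_def[abs_def])
  qed
  have "in_Hs \<sigma> (u t)" for \<sigma> t unfolding u_def[abs_def] by (rule in_Hs_invF[OF V_rapid])
  moreover have "AE \<xi> in lborel.
        interval_lebesgue_integrable lborel 0 (ereal t) (\<lambda>\<tau>. cis (-((t - \<tau>) * \<bar>\<xi>\<bar>)) * nonlin_hat u \<tau> \<xi>) \<and>
        fourier (u t) \<xi> = cis (-(t * \<bar>\<xi>\<bar>)) * fourier (u 0) \<xi>
          - \<i> * complex_of_real \<mu> * (LBINT \<tau>=0..t. cis (-((t - \<tau>) * \<bar>\<xi>\<bar>)) * nonlin_hat u \<tau> \<xi>)" for t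
    using hat[of t] hat[of 0]
  proof eventually_elim
    fix \<xi> assume "fourier (u t) \<xi> = 2 * pi * V t \<xi>" "fourier (u 0) \<xi> = 2 * pi * V 0 \<xi>"
    then show "interval_lebesgue_integrable lborel 0 (ereal t) (\<lambda>\<tau>. cis (-((t - \<tau>) * \<bar>\<xi>\<bar>)) * nonlin_hat u \<tau> \<xi>) \<and>
        fourier (u t) \<xi> = cis (-(t * \<bar>\<xi>\<bar>)) * fourier (u 0) \<xi>
          - \<i> * complex_of_real \<mu> * (LBINT \<tau>=0..t. cis (-((t - \<tau>) * \<bar>\<xi>\<bar>)) * nonlin_hat u \<tau> \<xi>)"
      using duhamel[of t \<xi>] by simp
  qed
  ultimately show ?thesis
    unfolding half_wave_global_solution_def using Hs_continuous nonlinearity_integrable by blast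
qed

end

section \<open>Transport profiles and comparison\<close>

lemma conv_cmult_left: "conv (\<lambda>x. a * f x) g \<xi> = a * conv f g \<xi>"
  by (simp add: conv_def mult.assoc)

lemma conv_cmult_right: "conv f (\<lambda>x. a * g x) \<xi> = a * conv f g \<xi>"
  unfolding conv_commute[of f] by (rule conv_cmult_left)

lemma cubic_real_scale: "cubic (\<lambda>x. of_real a * f x) \<xi> = of_real (a ^ 3) * cubic f \<xi>"
proof -
  have fl: "flip (\<lambda>x. of_real a * f x) = (\<lambda>x. of_real a * flip f x)" by (simp add: flip_def fun_eq_iff)
  have "conv (\<lambda>x. of_real a * f x) (\<lambda>x. of_real a * flip f x) = (\<lambda>x. of_real (a * a) * conv f (flip f) x)"
    by (simp add: conv_cmult_left conv_cmult_right fun_eq_iff)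
  then show ?thesis unfolding cubic_def fl
    by (simp add: conv_cmult_left conv_cmult_right power3_eq_cube)
qed

lemma conv_modulate: "conv (\<lambda>x. cis (t * x) * f x) (\<lambda>x. cis (t * x) * g x) \<xi> = cis (t * \<xi>) * conv f g \<xi>"
proof -
  have "cis (t * \<eta>) * cis (t * (\<xi> - \<eta>)) = cis (t * \<xi>)" for \<eta> by (simp add: cis_mult algebra_simps)
  then have "cis (t * \<eta>) * f \<eta> * (cis (t * (\<xi> - \<eta>)) * g (\<xi> - \<eta>)) = cis (t * \<xi>) * (f \<eta> * g (\<xi> - \<eta>))" for \<eta>
    by (metis (no_types, opaque_lifting) mult.assoc mult.left_commute)
  then have "(LINT \<eta>|lborel. cis (t * \<eta>) * f \<eta> * (cis (t * (\<xi> - \<eta>)) * g (\<xi> - \<eta>))) = (LINT \<eta>|lborel. cis (t * \<xi>) * (f \<eta> * g (\<xi> - \<eta>)))"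
    by (simp only:)
  then show ?thesis by (simp add: conv_def)
qed

text \<open>Equivariance under spatial translation, seen on the Fourier side; it permits passing to
  the frame moving with speed one.\<close>

lemma cubic_modulate: "cubic (\<lambda>x. cis (t * x) * f x) \<xi> = cis (t * \<xi>) * cubic f \<xi>"
proof -
  have fl: "flip (\<lambda>x. cis (t * x) * f x) = (\<lambda>x. cis (t * x) * flip f x)" by (simp add: flip_def fun_eq_iff cis_cnj)
  have "conv (\<lambda>x. cis (t * x) * f x) (\<lambda>x. cis (t * x) * flip f x) = (\<lambda>x. cis (t * x) * conv f (flip f) x)"
    by (simp add: conv_modulate fun_eq_iff)
  then show ?thesis unfolding cubic_def fl by (simp add: conv_modulate)
qed

lemma conv_affine:
  assumes "0 < d"
  shows "conv (\<lambda>x. f ((a + x) / d)) (\<lambda>x. g ((b + x) / d)) \<xi> = d * conv f g ((a + b + \<xi>) / d)"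
proof -
  have "(LINT y|lborel. f y * g ((a + b + \<xi>) / d - y))
     = \<bar>1 / d\<bar> *\<^sub>R (LINT x|lborel. f (a / d + (1 / d) * x) * g ((a + b + \<xi>) / d - (a / d + (1 / d) * x)))"
    using assms by (intro lborel_integral_real_affine) auto
  also have "(\<lambda>x. f (a / d + (1 / d) * x) * g ((a + b + \<xi>) / d - (a / d + (1 / d) * x)))
     = (\<lambda>x. f ((a + x) / d) * g ((b + (\<xi> - x)) / d))"
    using assms by (simp add: add_divide_distrib diff_divide_distrib algebra_simps)
  finally show ?thesis using assms by (simp add: conv_def scaleR_conv_of_real)
qed

text \<open>\<open>flip\<close> reverses the shift m, so it cancels in the autocorrelation and
  reappears once in the last factor; each of the two convolutions contributes one d. On the physical
  side this is equivariance under frequency shift and dilation.\<close>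

lemma cubic_affine:
  assumes "0 < d"
  shows "cubic (\<lambda>x. f ((m + x) / d)) \<xi> = d\<^sup>2 * cubic f ((m + \<xi>) / d)"
proof -
  have fl: "flip (\<lambda>x. f ((m + x) / d)) = (\<lambda>x. flip f ((- m + x) / d))"
  proof
    fix x
    have "- ((- m + x) / d) = (m + - x) / d" by (simp add: minus_divide_left)
    then show "flip (\<lambda>x. f ((m + x) / d)) x = flip f ((- m + x) / d)" by (simp only: flip_def)
  qed
  have r: "conv (\<lambda>x. f ((m + x) / d)) (\<lambda>x. flip f ((- m + x) / d)) = (\<lambda>x. of_real d * conv f (flip f) ((0 + x) / d))"
    using conv_affine[OF assms, of f m "flip f" "- m"] by (simp add: fun_eq_iff)
  show ?thesis unfolding cubic_def fl r conv_cmult_left conv_affine[OF assms]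
    by (simp add: power2_eq_square)
qed

lemma decay_affine:
  assumes f: "decay k C f" and d: "0 < d"
  shows "decay k (C * (1 + \<bar>m\<bar> + d) ^ k) (\<lambda>x. f ((m + x) / d))"
  unfolding decay_def
proof
  fix x
  have "\<bar>x\<bar> \<le> \<bar>m + x\<bar> + \<bar>m\<bar>" by linarith
  also have "\<bar>m + x\<bar> = d * \<bar>(m + x) / d\<bar>" using d by (simp add: abs_divide)
  finally have "J x \<le> 1 + \<bar>m\<bar> + d * \<bar>(m + x) / d\<bar>" by (simp add: J_def)
  also have "\<dots> \<le> (1 + \<bar>m\<bar> + d) * J ((m + x) / d)"
    using d unfolding J_def distrib_left distrib_right by (simp add: add_increasing2)
  finally have "J x ^ k \<le> ((1 + \<bar>m\<bar> + d) * J ((m + x) / d)) ^ k" by (rule power_mono) simp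
  then have *: "J x ^ k \<le> (1 + \<bar>m\<bar> + d) ^ k * J ((m + x) / d) ^ k" by (simp only: power_mult_distrib)
  have "cmod (f ((m + x) / d)) \<le> C / J ((m + x) / d) ^ k" using f by (simp add: decay_def)
  also have "\<dots> \<le> C * (1 + \<bar>m\<bar> + d) ^ k / J x ^ k"
    using mult_left_mono[OF * decay_nonneg[OF f]] by (simp add: field_simps)
  finally show "cmod (f ((m + x) / d)) \<le> C * (1 + \<bar>m\<bar> + d) ^ k / J x ^ k" .
qed

text \<open>With the autocorrelation frozen at time 0 the equation is linear, and on the physical
  side it is multiplication by - \<i> \<mu> |invF f|^2 at each point y. The solution is therefore
  the datum times a pure phase.\<close>

lemma linear_profile_invF:
  assumes f: "continuous_on UNIV f" "decay 2 A f"
    and Z: "jcont Z" "ldecay 2 Z"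
    and eq: "\<And>t \<xi>. Z t \<xi> = f \<xi> + integral {0..t} (\<lambda>s. - \<i> * of_real \<mu> * conv (conv f (flip f)) (Z s) \<xi>)"
    and t: "0 \<le> t"
  shows "invF (Z t) y = cis (- (\<mu> * (cmod (invF f y))\<^sup>2 * t)) * invF f y"
proof -
  define \<rho> where "\<rho> = conv f (flip f)"
  define p where "p = (cmod (invF f y))\<^sup>2"
  have \<rho>: "continuous_on UNIV \<rho>" "decay 2 (16 * A * A) \<rho>"
    unfolding \<rho>_def using continuous_conv[OF f(1) continuous_flip[OF f(1)] f(2)] f decay_autocorrelation[OF f] by auto
  define h where "h s \<xi> = - \<i> * of_real \<mu> * conv \<rho> (Z s) \<xi>" for s \<xi>
  have hj: "jcont h" unfolding h_def
    by (intro jcont_cmult jcont_conv jcont_const ldecay_const[OF \<rho>(2)] \<rho>(1) Z)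
  have hl: "ldecay 2 h" unfolding h_def
    by (intro ldecay_cmult ldecay_conv jcont_const ldecay_const[OF \<rho>(2)] \<rho>(1) Z) simp
  obtain C where C: "\<And>s. \<bar>s\<bar> \<le> t \<Longrightarrow> decay 2 C (h s)" using ldecayE[OF hl] by metis
  have Zd: "((\<lambda>s. Z s \<xi>) has_vector_derivative h s \<xi>) (at s within {0..t})" if s: "s \<in> {0..t}" for s \<xi>
  proof -
    have "((\<lambda>s. f \<xi> + integral {0..s} (\<lambda>s. h s \<xi>)) has_vector_derivative h s \<xi>) (at s within {0..t})"
      by (subst add.commute, subst has_vector_derivative_add_const, rule integral_has_vector_derivative[OF jcont_slice(2)[OF hj] s])
    then show ?thesis using eq by (simp add: h_def \<rho>_def)
  qed
  have fi: "integrable lborel f" by (rule decay_integrable(1)[OF continuous_borel[OF f(1)] f(2) order_refl])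
  have \<rho>i: "integrable lborel \<rho>" by (rule decay_integrable(1)[OF continuous_borel[OF \<rho>(1)] \<rho>(2) order_refl])
  have Zi: "integrable lborel (Z s)" for s
    using ldecay_slice[OF Z(2)] decay_integrable(1)[OF continuous_borel[OF jcont_slice(1)[OF Z(1)]]] by blast
  have \<rho>F: "invF \<rho> y = of_real p"
    unfolding \<rho>_def invF_conv[OF fi integrable_flip[OF fi]] invF_flip p_def by (rule complex_norm_square[symmetric])
  have Ud: "((\<lambda>s. invF (Z s) y) has_vector_derivative - \<i> * of_real (\<mu> * p) * invF (Z s) y) (at s within {0..t})"
    if s: "s \<in> {0..t}" for s
  proof -
    have "((\<lambda>s. LINT \<xi>|lborel. cis (y * \<xi>) * Z s \<xi>) has_vector_derivative (LINT \<xi>|lborel. cis (y * \<xi>) * h s \<xi>)) (at s within {0..t})"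
    proof (rule has_vector_derivative_LINT[where g="\<lambda>\<xi>. C / J \<xi> ^ 2"])
      fix r assume r: "r \<in> {0..t}"
      show "integrable lborel (\<lambda>\<xi>. cis (y * \<xi>) * Z r \<xi>)" by (rule integrable_phase[OF Zi])
      fix \<xi>
      show "((\<lambda>s. cis (y * \<xi>) * Z s \<xi>) has_vector_derivative cis (y * \<xi>) * h r \<xi>) (at r within {0..t})"
        by (rule has_vector_derivative_mult_right[OF Zd[OF r]])
      show "norm (cis (y * \<xi>) * h r \<xi>) \<le> C / J \<xi> ^ 2"
        using C[of r] r by (simp add: norm_mult decay_def)
    qed (use s in \<open>auto intro!: continuous_borel continuous_intros jcont_slice(1)[OF hj]\<close>)
    moreover have "(LINT \<xi>|lborel. cis (y * \<xi>) * h s \<xi>) = - \<i> * of_real \<mu> * invF (conv \<rho> (Z s)) y"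
    proof -
      have "(LINT \<xi>|lborel. cis (y * \<xi>) * h s \<xi>) = (LINT \<xi>|lborel. (- \<i> * of_real \<mu>) * (cis (y * \<xi>) * conv \<rho> (Z s) \<xi>))"
        unfolding h_def by (rule Bochner_Integration.integral_cong) (simp_all add: mult_ac)
      then show ?thesis by (simp add: invF_def)
    qed
    ultimately show ?thesis unfolding invF_conv[OF \<rho>i Zi] \<rho>F by (simp add: invF_def mult_ac)
  qed
  \<comment> \<open>Integrating factor of the scalar equation at y; its product with the solution
    has derivative 0.\<close>
  define q where "q s = exp (s *\<^sub>R (\<i> * of_real (\<mu> * p)))" for s
  have qd: "(q has_vector_derivative q s * (\<i> * of_real (\<mu> * p))) (at s within {0..t})" for s
    unfolding q_def[abs_def] by (rule exp_scaleR_has_vector_derivative_right)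
  have "((\<lambda>s. q s * invF (Z s) y) has_derivative (\<lambda>h. 0)) (at s within {0..t})" if s: "s \<in> {0..t}" for s
    using has_vector_derivative_mult[OF qd Ud[OF s]] by (simp add: has_vector_derivative_def algebra_simps)
  from has_derivative_zero_constant[OF _ this] obtain c where c: "\<And>s. s \<in> {0..t} \<Longrightarrow> q s * invF (Z s) y = c" by auto
  have Z0: "Z 0 = f" using eq[of 0] by (simp add: fun_eq_iff)
  have "q t * invF (Z t) y = invF f y" using c[of 0] c[of t] t by (simp add: Z0 q_def)
  moreover have "cis (- (\<mu> * p * t)) * q t = 1"
    by (simp add: q_def cis_conv_exp scaleR_conv_of_real mult_ac flip: exp_add)
  ultimately show ?thesis unfolding p_def[symmetric] by (metis mult.assoc mult_1)
qed

text \<open>The dispersionless cubic equation conserves |invF (Z t)| pointwise, so it is solved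
  through the linear equation with frozen potential, which is globally Lipschitz at every decay
  order. Working on the Fourier side yields decay of Z of all orders directly from
  \<open>weighted_picard\<close>.\<close>

lemma transport_profile_exists:
  assumes f: "rapid f"
  obtains Z where "jcont Z" "\<And>k. ldecay k Z" "Z 0 = f"
    "\<And>t y. 0 \<le> t \<Longrightarrow> invF (Z t) y = cis (- (\<mu> * (cmod (invF f y))\<^sup>2 * t)) * invF f y"
    "\<And>t T \<xi>. t \<in> {0..T} \<Longrightarrow> ((\<lambda>t. Z t \<xi>) has_vector_derivative - \<i> * of_real \<mu> * cubic (Z t) \<xi>) (at t within {0..T})"
proof -
  define \<rho> where "\<rho> = conv f (flip f)"
  have fc: "continuous_on UNIV f" using f by (simp add: rapid_def)
  obtain A where A: "decay 2 A f" using f by (auto simp: rapid_def)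
  have \<rho>c: "continuous_on UNIV \<rho>"
    unfolding \<rho>_def using continuous_conv[OF fc continuous_flip[OF fc] A] A by simp
  have \<rho>d: "\<exists>B. decay k B \<rho>" if "2 \<le> k" for k
  proof -
    obtain B where "decay k B f" using f by (auto simp: rapid_def)
    then show ?thesis unfolding \<rho>_def
      using decay_conv[OF continuous_borel[OF fc] continuous_borel[OF continuous_flip[OF fc]], of k B B] that by auto
  qed
  define G where "G t g \<xi> = - \<i> * of_real \<mu> * conv \<rho> g \<xi>" for t :: real and g \<xi>
  have ex: "\<exists>w. jcont w \<and> ldecay k w \<and> (\<forall>t \<xi>. w t \<xi> = f \<xi> + integral {0..t} (\<lambda>s. G s (w s) \<xi>))" if k: "2 \<le> k" for k
  proof -
    obtain B where B: "decay k B \<rho>" using \<rho>d[OF k] by blast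
    obtain C0 where C0: "decay k C0 f" using f by (auto simp: rapid_def)
    have B2: "decay 2 B \<rho>" by (rule decay_mono[OF B k order_refl])
    let ?L = "\<bar>\<mu>\<bar> * (4 * 2 ^ k * B)"
    show ?thesis
    proof (rule weighted_picard[where G=G and L="?L" and k=k and ?w0.0=f and ?C0.0=C0])
      show "0 \<le> ?L" using decay_nonneg[OF B] by simp
      fix t :: real and g h :: "real \<Rightarrow> complex" and D E F
      assume g: "continuous_on UNIV g" "decay k D g" and h: "continuous_on UNIV h" "decay k E h"
        and d: "decay k F (\<lambda>\<xi>. g \<xi> - h \<xi>)"
      have gh: "decay 2 D g" "decay 2 E h" using g h k by (auto intro: decay_mono)
      have "G t g \<xi> - G t h \<xi> = - \<i> * of_real \<mu> * conv \<rho> (\<lambda>\<xi>. g \<xi> - h \<xi>) \<xi>" for \<xi>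
      proof -
        have "conv \<rho> g \<xi> - conv \<rho> h \<xi> = conv (\<lambda>x. \<rho> x - \<rho> x) g \<xi> + conv \<rho> (\<lambda>x. g x - h x) \<xi>"
          by (rule conv_diff[OF \<rho>c g(1) \<rho>c h(1) B2 gh(1) B2 gh(2)])
        moreover have "conv (\<lambda>x. \<rho> x - \<rho> x) g \<xi> = 0" by (simp add: conv_def)
        ultimately have "conv \<rho> g \<xi> = conv \<rho> (\<lambda>\<xi>. g \<xi> - h \<xi>) \<xi> + conv \<rho> h \<xi>" by (simp only: diff_eq_eq add_0)
        then show ?thesis by (simp add: G_def distrib_left)
      qed
      moreover have "decay k (cmod (- \<i> * of_real \<mu>) * (4 * 2 ^ k * B * F)) (\<lambda>\<xi>. - \<i> * of_real \<mu> * conv \<rho> (\<lambda>\<xi>. g \<xi> - h \<xi>) \<xi>)"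
        using g(1) h(1) by (intro decay_cmult decay_conv[OF _ _ B d k] continuous_borel \<rho>c continuous_intros)
      ultimately show "decay k (?L * F) (\<lambda>\<xi>. G t g \<xi> - G t h \<xi>)" by (simp add: norm_mult mult_ac)
    next
      show "G t (\<lambda>_. 0) \<xi> = 0" for t \<xi> by (simp add: G_def conv_def)
      fix w assume "jcont w" "ldecay k w"
      then show "jcont (\<lambda>t. G t (w t))"
        unfolding G_def using ldecay_mono[OF _ k] by (intro jcont_cmult jcont_conv jcont_const \<rho>c ldecay_const[OF B2]) auto
    qed (use fc C0 in blast)+
  qed
  obtain Z where Z: "jcont Z" "ldecay 2 Z" and eq: "\<And>t \<xi>. Z t \<xi> = f \<xi> + integral {0..t} (\<lambda>s. G s (Z s) \<xi>)"
    using ex[of 2] by auto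
  have F: "invF (Z t) y = cis (- (\<mu> * (cmod (invF f y))\<^sup>2 * t)) * invF f y" if "0 \<le> t" for t y
    using linear_profile_invF[OF fc A Z eq[unfolded G_def \<rho>_def] that] .
  have Zl: "ldecay k Z" for k
  proof -
    obtain w where w: "jcont w" "ldecay (k + 2) w" and weq: "\<And>t \<xi>. w t \<xi> = f \<xi> + integral {0..t} (\<lambda>s. G s (w s) \<xi>)"
      using ex[of "k + 2"] by auto
    have w2: "ldecay 2 w" by (rule ldecay_mono[OF w(2)]) simp
    have "Z t = w t" for t
    proof (cases "0 \<le> t")
      case True
      obtain B C where BC: "decay 2 B (Z t)" "decay 2 C (w t)" using ldecay_slice[OF Z(2)] ldecay_slice[OF w2] by metis
      show ?thesis
        by (rule invF_injective[OF jcont_slice(1)[OF Z(1)] jcont_slice(1)[OF w(1)] BC])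
           (simp add: F[OF True] linear_profile_invF[OF fc A w(1) w2 weq[unfolded G_def \<rho>_def] True])
    next
      case False
      then show ?thesis using eq[of t] weq[of t] by (simp add: fun_eq_iff)
    qed
    then have "Z = w" by (rule ext)
    then show ?thesis using ldecay_mono[OF w(2), of k] by simp
  qed
  have fi: "integrable lborel f" by (rule rapid_integrable[OF f])
  have \<rho>i: "integrable lborel \<rho>" unfolding \<rho>_def by (rule conv_integrable(1)[OF fi integrable_flip[OF fi]])
  have cub: "cubic (Z t) = conv \<rho> (Z t)" if t: "0 \<le> t" for t
  proof -
    obtain B where B: "decay 2 B (Z t)" using ldecay_slice[OF Z(2)] by blast
    obtain D where D: "decay 2 D \<rho>" using \<rho>d[of 2] by auto
    note c = jcont_slice(1)[OF Z(1)]
    have Zi: "integrable lborel (Z t)" by (rule decay_integrable(1)[OF continuous_borel[OF c] B order_refl])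
    show ?thesis
    proof (rule invF_injective[OF continuous_cubic[OF c B] continuous_conv[OF \<rho>c c D B] decay_cubic[OF c B]])
      show "decay 2 (4 * 2\<^sup>2 * D * B) (conv \<rho> (Z t))"
        by (rule decay_conv[OF continuous_borel[OF \<rho>c] continuous_borel[OF c] D B order_refl])
      fix y
      have "invF \<rho> y = of_real ((cmod (invF f y))\<^sup>2)"
        unfolding \<rho>_def invF_conv[OF fi integrable_flip[OF fi]] invF_flip by (rule complex_norm_square[symmetric])
      moreover have "cmod (invF (Z t) y) = cmod (invF f y)" unfolding F[OF t] by (simp add: norm_mult)
      ultimately show "invF (cubic (Z t)) y = invF (conv \<rho> (Z t)) y"
        unfolding invF_cubic[OF c B] invF_conv[OF \<rho>i Zi] by simp
    qed
  qed
  have der: "((\<lambda>t. Z t \<xi>) has_vector_derivative - \<i> * of_real \<mu> * cubic (Z t) \<xi>) (at t within {0..T})"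
    if t: "t \<in> {0..T}" for t T \<xi>
  proof -
    obtain D where D: "decay 2 D \<rho>" using \<rho>d[of 2] by auto
    have Gj: "jcont (\<lambda>s. G s (Z s))" unfolding G_def
      by (intro jcont_cmult jcont_conv jcont_const \<rho>c ldecay_const[OF D] Z)
    have "((\<lambda>t. f \<xi> + integral {0..t} (\<lambda>s. G s (Z s) \<xi>)) has_vector_derivative G t (Z t) \<xi>) (at t within {0..T})"
      by (subst add.commute, subst has_vector_derivative_add_const, rule integral_has_vector_derivative[OF jcont_slice(2)[OF Gj] t])
    then show ?thesis using eq cub[of t] t by (simp add: G_def)
  qed
  have "Z 0 = f" using eq[of 0] by (simp add: fun_eq_iff)
  then show ?thesis using that[OF Z(1) Zl _ F der] by blast
qed

text \<open>After removing the phase generated by \<Lambda>, the difference solves an equation with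
  Lipschitz cubic part and the single source term \<Lambda> Z, of size \<beta>. Gronwall bounds it
  as long as it stays below 1, and \<open>small\<close> makes that bound itself less than 1, which
  closes the bootstrap.\<close>

lemma comparison:
  assumes \<mu>: "\<bar>\<mu>\<bar> = 1" and T: "0 \<le> T"
    and z: "jcont z" "ldecay 2 z" and Z: "jcont Z" "ldecay 3 Z" and init: "z 0 = Z 0"
    and \<Lambda>: "continuous_on UNIV \<Lambda>" "\<And>\<eta>. \<bar>\<Lambda> \<eta>\<bar> \<le> B * J \<eta>"
    and zd: "\<And>t \<eta>. t \<in> {0..T} \<Longrightarrow> ((\<lambda>t. cis (t * \<Lambda> \<eta>) * z t \<eta>) has_vector_derivative
        - \<i> * of_real \<mu> * (cis (t * \<Lambda> \<eta>) * cubic (z t) \<eta>)) (at t within {0..T})"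
    and Zd: "\<And>t \<eta>. t \<in> {0..T} \<Longrightarrow> ((\<lambda>t. Z t \<eta>) has_vector_derivative - \<i> * of_real \<mu> * cubic (Z t) \<eta>) (at t within {0..T})"
    and C: "\<And>t. t \<in> {0..T} \<Longrightarrow> decay 2 C (Z t)"
    and \<beta>: "\<And>t. t \<in> {0..T} \<Longrightarrow> decay 2 \<beta> (\<lambda>\<eta>. of_real (\<Lambda> \<eta>) * Z t \<eta>)"
    and small: "\<beta> * T * exp (48 * 4 ^ 2 * (C + 1)\<^sup>2 * T) < 1" and t: "t \<in> {0..T}"
  shows "decay 2 (\<beta> * T * exp (48 * 4 ^ 2 * (C + 1)\<^sup>2 * T)) (\<lambda>\<eta>. z t \<eta> - Z t \<eta>)"
proof -
  define L where "L = 48 * 4 ^ 2 * (C + 1)\<^sup>2"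
  have L: "0 \<le> L" by (simp add: L_def)
  have C0: "0 \<le> C" using C[of 0] T decay_nonneg by force
  have \<beta>0: "0 \<le> \<beta>" using \<beta>[of 0] T decay_nonneg by force
  define E where "E s \<eta> = cis (s * \<Lambda> \<eta>) * (z s \<eta> - Z s \<eta>)" for s \<eta>
  define h where "h s \<eta> = cis (s * \<Lambda> \<eta>) * (- \<i> * of_real \<mu> * (cubic (z s) \<eta> - cubic (Z s) \<eta>) - \<i> * (of_real (\<Lambda> \<eta>) * Z s \<eta>))" for s \<eta>
  have Z2: "ldecay 2 Z" by (rule ldecay_mono[OF Z(2)]) simp
  have ph: "continuous_on UNIV (\<lambda>(s, \<eta>). s * \<Lambda> \<eta>)" and \<Lambda>c: "continuous_on UNIV (\<lambda>p::real \<times> real. \<Lambda> (snd p))"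
    unfolding case_prod_beta' by (intro continuous_intros continuous_on_compose2[OF \<Lambda>(1)]; auto)+
  have \<Lambda>Zj: "jcont (\<lambda>s \<eta>. of_real (\<Lambda> \<eta>) * Z s \<eta>)"
    using Z(1) \<Lambda>c unfolding jcont_def case_prod_beta' by (intro continuous_intros)
  have \<Lambda>Zl: "ldecay 2 (\<lambda>s \<eta>. of_real (\<Lambda> \<eta>) * Z s \<eta>)"
    unfolding ldecay_def
  proof
    fix T'
    obtain D where D: "\<And>s. \<bar>s\<bar> \<le> T' \<Longrightarrow> decay 3 D (Z s)" using ldecayE[OF Z(2)] by metis
    have "decay 2 (B * D) (\<lambda>\<eta>. of_real (\<Lambda> \<eta>) * Z s \<eta>)" if "\<bar>s\<bar> \<le> T'" for s
      unfolding decay_def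
    proof
      fix \<eta>
      have "B \<ge> 0" using \<Lambda>(2)[of 0] by (simp add: J_def)
      then have "\<bar>\<Lambda> \<eta>\<bar> * cmod (Z s \<eta>) \<le> (B * J \<eta>) * (D / J \<eta> ^ 3)"
        using \<Lambda>(2)[of \<eta>] D[OF that] by (intro mult_mono) (auto simp: decay_def)
      also have "\<dots> = B * D / J \<eta> ^ 2" by (simp add: field_simps eval_nat_numeral)
      finally show "cmod (of_real (\<Lambda> \<eta>) * Z s \<eta>) \<le> B * D / J \<eta> ^ 2" by (simp add: norm_mult)
    qed
    then show "\<exists>C. \<forall>s. \<bar>s\<bar> \<le> T' \<longrightarrow> decay 2 C (\<lambda>\<eta>. of_real (\<Lambda> \<eta>) * Z s \<eta>)" by blast
  qed
  have hj: "jcont h" unfolding h_def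
    by (intro jcont_phase[OF _ ph] jcont_diff jcont_cmult jcont_cubic z Z Z2 \<Lambda>Zj)
  have hl: "ldecay 2 h" unfolding h_def
    by (intro ldecay_phase ldecay_diff ldecay_cmult ldecay_cubic z Z Z2 \<Lambda>Zl) simp_all
  have El: "ldecay 2 E" unfolding E_def by (intro ldecay_phase ldecay_diff z Z2)
  have Ed: "((\<lambda>s. E s \<eta>) has_vector_derivative h s \<eta>) (at s within {0..T})" if s: "s \<in> {0..T}" for s \<eta>
  proof -
    have "((\<lambda>s. cis (s * \<Lambda> \<eta>)) has_vector_derivative cis (s * \<Lambda> \<eta>) * (\<i> * of_real (\<Lambda> \<eta>))) (at s within {0..T})"
      using exp_scaleR_has_vector_derivative_right[of "\<i> * of_real (\<Lambda> \<eta>)" s "{0..T}"]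
      by (simp add: cis_conv_exp scaleR_conv_of_real mult_ac)
    from has_vector_derivative_diff[OF zd[OF s] has_vector_derivative_mult[OF this Zd[OF s]]]
    show ?thesis unfolding E_def h_def
      by (auto simp: algebra_simps elim!: has_vector_derivative_eq_rhs)
  qed
  have E0: "E 0 \<eta> = 0" for \<eta> by (simp add: E_def init)
  have Eeq: "E s \<eta> = integral {0..s} (\<lambda>r. h r \<eta>)" if s: "s \<in> {0..T}" for s \<eta>
  proof -
    have "((\<lambda>r. h r \<eta>) has_integral (E s \<eta> - E 0 \<eta>)) {0..s}"
      by (rule fundamental_theorem_of_calculus) (use s in \<open>auto intro!: has_vector_derivative_within_subset[OF Ed]\<close>)
    then show ?thesis by (simp add: E0 integral_unique)
  qed
  define y where "y s = nrm 2 (E s)" for s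
  have yd: "decay 2 (y s) (\<lambda>\<eta>. z s \<eta> - Z s \<eta>)" for s
  proof -
    have "decay 2 (y s) (E s)" unfolding y_def using ldecay_slice[OF El] decay_nrm by blast
    then show ?thesis unfolding E_def[abs_def] decay_phase .
  qed
  have yc: "continuous_on {0..T} y"
    unfolding y_def by (rule continuous_nrm[OF hj hl El]) (use Eeq E0 in auto)
  have bound: "y r \<le> \<beta> * T * exp (L * r)" if r: "r \<in> {0..T}" and le: "\<And>s. s \<in> {0..r} \<Longrightarrow> y s \<le> 1" for r
  proof (rule gronwall[where y=y and T=r])
    show yr: "continuous_on {0..r} y" by (rule continuous_on_subset[OF yc]) (use r in auto)
    fix s assume s: "s \<in> {0..r}"
    have hd: "decay 2 (L * y q + \<beta>) (h q)" if q: "q \<in> {0..s}" for q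
    proof -
      have qT: "q \<in> {0..T}" and q1: "y q \<le> 1" using q s r le by auto
      \<comment> \<open>The bootstrap assumption keeps z within distance 1 of Z, so both have size
        at most C + 1; this is the origin of C + 1 in the exponential rate.\<close>
      have dz: "decay 2 (C + 1) (z q)"
        using decay_mono[OF decay_add[OF C[OF qT] yd[of q]] order_refl, of "C + 1"] q1 by simp
      have dZ: "decay 2 (C + 1) (Z q)" by (rule decay_mono[OF C[OF qT]]) auto
      have "decay 2 (L * y q) (\<lambda>\<eta>. cubic (z q) \<eta> - cubic (Z q) \<eta>)"
        unfolding L_def by (rule decay_cubic_diff[OF jcont_slice(1)[OF z(1)] jcont_slice(1)[OF Z(1)] dz dZ yd]) simp
      from decay_cmult[OF this, of "- \<i> * of_real \<mu>"]
      have 1: "decay 2 (L * y q) (\<lambda>\<eta>. - \<i> * of_real \<mu> * (cubic (z q) \<eta> - cubic (Z q) \<eta>))" using \<mu> by (simp add: norm_mult)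
      from decay_cmult[OF \<beta>[OF qT], of \<i>]
      have 2: "decay 2 \<beta> (\<lambda>\<eta>. \<i> * (of_real (\<Lambda> \<eta>) * Z q \<eta>))" by simp
      show ?thesis unfolding h_def using decay_diff[OF 1 2] by (simp add: decay_phase)
    qed
    have ys: "continuous_on {0..s} y" by (rule continuous_on_subset[OF yr]) (use s in auto)
    have "decay 2 (integral {0..s} (\<lambda>q. L * y q + \<beta>)) (\<lambda>\<eta>. integral {0..s} (\<lambda>q. h q \<eta>))"
      by (rule decay_integral[OF hj hd]) (auto intro!: continuous_intros ys)
    then have "decay 2 (integral {0..s} (\<lambda>q. L * y q + \<beta>)) (E s)"
      using Eeq[of s] s r by (simp add: decay_def)
    then have "y s \<le> integral {0..s} (\<lambda>q. L * y q + \<beta>)" unfolding y_def[of s] by (rule nrm_le)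
    also have "\<dots> = integral {0..s} (\<lambda>q. L * y q) + \<beta> * s"
      using s by (subst Henstock_Kurzweil_Integration.integral_add)
        (auto intro!: integrable_continuous_interval continuous_intros ys)
    also have "\<dots> \<le> \<beta> * T + integral {0..s} (\<lambda>q. L * y q)"
      using s r \<beta>0 by (simp add: mult_left_mono)
    finally show "y s \<le> \<beta> * T + integral {0..s} (\<lambda>q. L * y q)" .
  qed (use L r in auto)
  have exp_le: "\<beta> * T * exp (L * r) \<le> \<beta> * T * exp (L * T)" if "r \<in> {0..T}" for r
    using that L \<beta>0 T by (intro mult_left_mono) (auto simp: mult_left_mono)
  have lt: "y r < 1" if r: "r \<in> {0..T}" for r
  proof (rule first_exit[OF yc _ _ r])
    show "y 0 < 1" using bound[of 0] T exp_le[of 0] small E0 unfolding L_def[symmetric]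
      by (auto simp: y_def nrm_def)
    show "\<And>r. r \<in> {0..T} \<Longrightarrow> (\<And>s. s \<in> {0..r} \<Longrightarrow> y s \<le> 1) \<Longrightarrow> y r < 1"
      using bound exp_le small unfolding L_def[symmetric] by (meson le_less_trans order_trans)
  qed
  have "y t \<le> \<beta> * T * exp (L * T)"
    using bound[OF t] lt exp_le[OF t] t by (meson atLeastAtMost_iff less_imp_le order_trans)
  then show ?thesis using decay_mono[OF yd order_refl] unfolding L_def by blast
qed

section \<open>Rescaled wave packets\<close>

text \<open>The data are rescaled by amplitude \<kappa>, shift m, width d and time unit 1 /
  \<alpha>. The relation \<kappa>^2 = \<alpha> d^2 balances the d^2 of the two convolutions and the
  cube of \<kappa> against the change of time, so that the rescaled cubic term has coefficient \<mu>
  again.\<close>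

lemma rescaled_comparison:
  assumes prof: "halfwave_profile \<mu> (T / \<alpha>) 4 w"
    and pos: "0 < \<alpha>" "0 < d" "0 \<le> m" "0 \<le> T" "0 < \<kappa>" and \<kappa>: "\<kappa>\<^sup>2 = \<alpha> * d\<^sup>2"
    and init: "\<And>\<eta>. w 0 ((m + \<eta>) / d) = of_real \<kappa> * Z 0 \<eta>"
    and Z: "jcont Z" "ldecay 3 Z"
    and Zd: "\<And>t \<eta>. t \<in> {0..T} \<Longrightarrow> ((\<lambda>t. Z t \<eta>) has_vector_derivative - \<i> * of_real \<mu> * cubic (Z t) \<eta>) (at t within {0..T})"
    and \<Lambda>: "\<And>\<eta>. \<Lambda> \<eta> = 2 / (\<alpha> * d) * max 0 (- (m + \<eta>))"
    and C: "\<And>t. t \<in> {0..T} \<Longrightarrow> decay 2 C (Z t)"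
    and \<beta>: "\<And>t. t \<in> {0..T} \<Longrightarrow> decay 2 \<beta> (\<lambda>\<eta>. of_real (\<Lambda> \<eta>) * Z t \<eta>)"
    and small: "\<beta> * T * exp (48 * 4 ^ 2 * (C + 1)\<^sup>2 * T) < 1"
  shows "decay 2 (\<beta> * T * exp (48 * 4 ^ 2 * (C + 1)\<^sup>2 * T))
    (\<lambda>\<eta>. of_real (1 / \<kappa>) * (cis (- (T * \<Lambda> \<eta>)) * w (T / \<alpha>) ((m + \<eta>) / d)) - Z T \<eta>)"
proof -
  interpret halfwave_profile \<mu> "T / \<alpha>" 4 w by fact
  define X where "X \<eta> = (m + \<eta>) / d" for \<eta>
  define z where "z \<tau> \<eta> = of_real (1 / \<kappa>) * (cis (- (\<tau> * \<Lambda> \<eta>)) * w (\<tau> / \<alpha>) (X \<eta>))" for \<tau> \<eta>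
  \<comment> \<open>Since |x| = x + 2 max 0 (- x), removing the transport with speed one leaves a
    multiplier \<Lambda> that lives on negative frequencies only.\<close>
  have \<Lambda>X: "\<tau> * \<Lambda> \<eta> = \<tau> / \<alpha> * \<bar>X \<eta>\<bar> - \<tau> / \<alpha> * X \<eta>" for \<tau> \<eta>
  proof -
    have "max 0 (- (m + \<eta>)) = d * max 0 (- X \<eta>)" using pos by (simp add: X_def max_def field_simps)
    then have "\<Lambda> \<eta> = (2 * max 0 (- X \<eta>)) / \<alpha>" unfolding \<Lambda> using pos by simp
    also have "2 * max 0 (- X \<eta>) = \<bar>X \<eta>\<bar> - X \<eta>" by (simp add: max_def)
    finally show ?thesis by (simp add: diff_divide_distrib right_diff_distrib)
  qed
  have \<Lambda>c: "continuous_on UNIV \<Lambda>" unfolding \<Lambda> by (intro continuous_intros)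
  have Xc: "continuous_on S (\<lambda>p. X (g p))" if "continuous_on S g" for S and g :: "real \<times> real \<Rightarrow> real"
    unfolding X_def using that pos by (intro continuous_intros) auto
  have wj: "jcont (\<lambda>\<tau> \<eta>. w (\<tau> / \<alpha>) (X \<eta>))"
    unfolding jcont_def[of "\<lambda>\<tau> \<eta>. w (\<tau> / \<alpha>) (X \<eta>)"] case_prod_beta'
    using pos by (intro jcont_compose[OF jc] Xc continuous_intros) auto
  have zj: "jcont z" unfolding z_def
    by (intro jcont_cmult jcont_phase[OF wj]) (auto simp: case_prod_beta' intro!: continuous_intros continuous_on_compose2[OF \<Lambda>c])
  have wl: "ldecay 2 (\<lambda>\<tau> \<eta>. w (\<tau> / \<alpha>) (X \<eta>))"
    unfolding ldecay_def
  proof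
    fix T'
    obtain D where D: "\<And>t. \<bar>t\<bar> \<le> T' / \<alpha> \<Longrightarrow> decay 2 D (w t)" using ldecayE[OF ldecay_mono[OF ld, of 2]] by auto
    have "decay 2 (D * (1 + \<bar>m\<bar> + d)\<^sup>2) (\<lambda>\<eta>. w (\<tau> / \<alpha>) (X \<eta>))" if "\<bar>\<tau>\<bar> \<le> T'" for \<tau>
      unfolding X_def using that pos by (intro decay_affine D) (auto simp: divide_right_mono)
    then show "\<exists>D. \<forall>\<tau>. \<bar>\<tau>\<bar> \<le> T' \<longrightarrow> decay 2 D (\<lambda>\<eta>. w (\<tau> / \<alpha>) (X \<eta>))" by blast
  qed
  have zl: "ldecay 2 z" unfolding z_def by (intro ldecay_cmult ldecay_phase wl)
  have \<mu>1: "\<bar>\<mu>\<bar> = 1" using \<mu> by auto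
  have cubz: "cubic (z \<tau>) \<eta> = of_real (1 / (\<kappa> * \<alpha>)) * (cis (\<tau> / \<alpha> * X \<eta>) * cubic (v (\<tau> / \<alpha>)) (X \<eta>))" for \<tau> \<eta>
  proof -
    define g where "g x = of_real (1 / \<kappa>) * (cis (\<tau> / \<alpha> * x) * v (\<tau> / \<alpha>) x)" for x
    have "z \<tau> \<eta>' = g ((m + \<eta>') / d)" for \<eta>'
    proof -
      have "cis (- (\<tau> * \<Lambda> \<eta>')) = cis (\<tau> / \<alpha> * X \<eta>') * cis (- (\<tau> / \<alpha> * \<bar>X \<eta>'\<bar>))"
        unfolding \<Lambda>X by (simp add: cis_mult)
      then show ?thesis by (simp add: z_def g_def v_def X_def)
    qed
    then have "z \<tau> = (\<lambda>x. g ((m + x) / d))" by (rule ext)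
    then have "cubic (z \<tau>) \<eta> = d\<^sup>2 * cubic g (X \<eta>)" by (simp add: cubic_affine[OF pos(2)] X_def)
    also have "cubic g (X \<eta>) = of_real ((1 / \<kappa>) ^ 3) * (cis (\<tau> / \<alpha> * X \<eta>) * cubic (v (\<tau> / \<alpha>)) (X \<eta>))"
      unfolding g_def[abs_def] cubic_real_scale cubic_modulate ..
    also have "complex_of_real (d\<^sup>2) * (of_real ((1 / \<kappa>) ^ 3) * (cis (\<tau> / \<alpha> * X \<eta>) * cubic (v (\<tau> / \<alpha>)) (X \<eta>)))
       = of_real (d\<^sup>2 * (1 / \<kappa>) ^ 3) * (cis (\<tau> / \<alpha> * X \<eta>) * cubic (v (\<tau> / \<alpha>)) (X \<eta>))" by simp
    also have "d\<^sup>2 * (1 / \<kappa>) ^ 3 = 1 / (\<kappa> * \<alpha>)"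
    proof -
      have "d\<^sup>2 = \<kappa>\<^sup>2 / \<alpha>" using \<kappa> pos by simp
      then show ?thesis using pos by (simp add: power2_eq_square power3_eq_cube)
    qed
    finally show ?thesis .
  qed
  have phase_cancel: "cis (\<tau> * \<Lambda> \<eta>) * z \<tau> \<eta> = of_real (1 / \<kappa>) * w (\<tau> / \<alpha>) (X \<eta>)" for \<tau> \<eta>
  proof -
    have "cis (\<tau> * \<Lambda> \<eta>) * cis (- (\<tau> * \<Lambda> \<eta>)) = 1" by (simp add: cis_mult)
    moreover have "cis (\<tau> * \<Lambda> \<eta>) * z \<tau> \<eta> = (cis (\<tau> * \<Lambda> \<eta>) * cis (- (\<tau> * \<Lambda> \<eta>))) * (of_real (1 / \<kappa>) * w (\<tau> / \<alpha>) (X \<eta>))"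
      unfolding z_def by (simp only: mult_ac)
    ultimately show ?thesis by (simp only: mult_1)
  qed
  have zd: "((\<lambda>\<tau>. cis (\<tau> * \<Lambda> \<eta>) * z \<tau> \<eta>) has_vector_derivative
        - \<i> * of_real \<mu> * (cis (\<tau> * \<Lambda> \<eta>) * cubic (z \<tau>) \<eta>)) (at \<tau> within {0..T})" if \<tau>: "\<tau> \<in> {0..T}" for \<tau> \<eta>
  proof -
    have \<tau>': "\<tau> / \<alpha> \<in> {0..T / \<alpha>}" using \<tau> pos by (auto simp: divide_right_mono)
    have im: "(\<lambda>\<tau>. \<tau> / \<alpha>) ` {0..T} \<subseteq> {0..T / \<alpha>}" using pos by (auto simp: divide_right_mono)
    have "(((\<lambda>t. w t (X \<eta>)) \<circ> (\<lambda>\<tau>. \<tau> / \<alpha>)) has_vector_derivative (1 / \<alpha>) *\<^sub>R flow \<mu> (\<tau> / \<alpha>) (w (\<tau> / \<alpha>)) (X \<eta>)) (at \<tau> within {0..T})"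
    proof (rule vector_diff_chain_within)
      show "((\<lambda>t. w t (X \<eta>)) has_vector_derivative flow \<mu> (\<tau> / \<alpha>) (w (\<tau> / \<alpha>)) (X \<eta>)) (at (\<tau> / \<alpha>) within (\<lambda>\<tau>. \<tau> / \<alpha>) ` {0..T})"
        by (rule has_vector_derivative_within_subset[OF w_deriv[OF \<tau>'] im])
    qed (use pos in \<open>auto intro!: derivative_eq_intros simp flip: has_real_derivative_iff_has_vector_derivative\<close>)
    from has_vector_derivative_mult_right[OF this, of "of_real (1 / \<kappa>)"]
    have "((\<lambda>\<tau>. cis (\<tau> * \<Lambda> \<eta>) * z \<tau> \<eta>) has_vector_derivative
       of_real (1 / \<kappa>) * ((1 / \<alpha>) *\<^sub>R flow \<mu> (\<tau> / \<alpha>) (w (\<tau> / \<alpha>)) (X \<eta>))) (at \<tau> within {0..T})"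
      unfolding phase_cancel comp_def .
    moreover have "of_real (1 / \<kappa>) * ((1 / \<alpha>) *\<^sub>R flow \<mu> (\<tau> / \<alpha>) (w (\<tau> / \<alpha>)) (X \<eta>))
       = - \<i> * of_real \<mu> * (cis (\<tau> * \<Lambda> \<eta>) * cubic (z \<tau>) \<eta>)"
    proof -
      have "cis (\<tau> / \<alpha> * \<bar>X \<eta>\<bar>) = cis (\<tau> * \<Lambda> \<eta>) * cis (\<tau> / \<alpha> * X \<eta>)" unfolding \<Lambda>X by (simp add: cis_mult)
      then show ?thesis unfolding flow_w cubz by (simp add: scaleR_conv_of_real)
    qed
    ultimately show ?thesis by simp
  qed
  have "decay 2 (\<beta> * T * exp (48 * 4 ^ 2 * (C + 1)\<^sup>2 * T)) (\<lambda>\<eta>. z T \<eta> - Z T \<eta>)"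
  proof (rule comparison[OF \<mu>1 pos(4) zj zl Z _ \<Lambda>c _ zd Zd C \<beta> small])
    show "z 0 = Z 0" using init pos by (simp add: z_def X_def fun_eq_iff)
    show "\<bar>\<Lambda> \<eta>\<bar> \<le> 2 / (\<alpha> * d) * J \<eta>" for \<eta>
    proof -
      have "max 0 (- (m + \<eta>)) \<le> J \<eta>" using pos by (auto simp: J_def max_def abs_if)
      then have "2 / (\<alpha> * d) * max 0 (- (m + \<eta>)) \<le> 2 / (\<alpha> * d) * J \<eta>" using pos by (intro mult_left_mono) auto
      moreover have "0 \<le> \<Lambda> \<eta>" unfolding \<Lambda> using pos by simp
      ultimately show ?thesis unfolding \<Lambda> by simp
    qed
  qed (use pos in auto)
  then show ?thesis by (simp add: z_def X_def)
qed

lemma LINT_scale: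
  fixes F :: "real \<Rightarrow> real"
  assumes "0 < d"
  shows "(LINT x|lborel. F (d * x - a)) = (LINT x|lborel. F x) / d"
  using lborel_integral_real_affine[of d F "- a"] assms by simp

lemma rapid_scale:
  assumes f: "rapid f" and d: "0 < d"
  shows "rapid (\<lambda>x. a * f (d * x - b))"
  unfolding rapid_def
proof (intro conjI allI)
  show "continuous_on UNIV (\<lambda>x. a * f (d * x - b))"
  proof (rule continuous_on_mult[OF continuous_on_const])
    show "continuous_on UNIV (\<lambda>x. f (d * x - b))"
      by (rule continuous_on_compose2[of UNIV f]) (use f in \<open>auto simp: rapid_def intro!: continuous_intros\<close>)
  qed
  fix k
  obtain C where "decay k C f" using f by (auto simp: rapid_def)
  from decay_cmult[OF decay_affine[OF this, of "1 / d" "- b / d"]] d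
  have "decay k (cmod a * (C * (1 + \<bar>- b / d\<bar> + 1 / d) ^ k)) (\<lambda>x. a * f ((- b / d + x) / (1 / d)))" by simp
  moreover have "(- b / d + x) / (1 / d) = d * x - b" for x using d by (simp add: field_simps)
  ultimately show "\<exists>C. decay k C (\<lambda>x. a * f (d * x - b))" by auto
qed

text \<open>Spatial scale of the wave packets: amplitude \<open>1 / \<epsilon>\<close>, frequency \<open>N\<close> and squared
  \<open>L2\<close> norm of order \<open>N powr (- 2 * s)\<close>, so that the \<open>Hs\<close> norm is of order one.\<close>
definition width :: "real \<Rightarrow> real \<Rightarrow> real \<Rightarrow> real" where
  "width s \<epsilon> N = N powr (- 2 * s) * \<epsilon>\<^sup>2"

lemma width_facts:
  assumes "0 < N" "0 < \<epsilon>"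
  shows "0 < width s \<epsilon> N" "N * width s \<epsilon> N = N powr (1 - 2 * s) * \<epsilon>\<^sup>2"
    "1 / (1 / \<epsilon>\<^sup>2 * width s \<epsilon> N) = N powr (2 * s)" "width s \<epsilon> N / \<epsilon>\<^sup>2 = N powr (- 2 * s)"
    "N powr (2 * s) * N powr (- 2 * s) = 1"
proof -
  show "0 < width s \<epsilon> N" using assms by (simp add: width_def)
  show "N * width s \<epsilon> N = N powr (1 - 2 * s) * \<epsilon>\<^sup>2"
    using assms powr_add[of N 1 "- 2 * s"] by (simp add: width_def)
  show 5: "N powr (2 * s) * N powr (- 2 * s) = 1" using assms by (simp flip: powr_add)
  show "width s \<epsilon> N / \<epsilon>\<^sup>2 = N powr (- 2 * s)" using assms by (simp add: width_def)
  show "1 / (1 / \<epsilon>\<^sup>2 * width s \<epsilon> N) = N powr (2 * s)"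
    using assms 5 by (simp add: width_def field_simps)
qed

text \<open>Formally, the physical function is exp (i N x) * invF f (x / width) / \<epsilon>: the
  prefactor width / \<epsilon> compensates the dilation and leaves amplitude 1 / \<epsilon>.\<close>

definition packet :: "real \<Rightarrow> real \<Rightarrow> real \<Rightarrow> (real \<Rightarrow> complex) \<Rightarrow> real \<Rightarrow> complex" where
  "packet s \<epsilon> N f \<xi> = of_real (width s \<epsilon> N / \<epsilon>) * f (width s \<epsilon> N * \<xi> - N * width s \<epsilon> N)"

text \<open>Undoes the scaling of \<open>packet\<close> at time \<open>\<epsilon>\<close>, in the frame moving with speed one.\<close>
definition comoving :: "real \<Rightarrow> real \<Rightarrow> real \<Rightarrow> (real \<Rightarrow> complex) \<Rightarrow> real \<Rightarrow> complex" where
  "comoving s \<epsilon> N V \<eta> = of_real (\<epsilon> / width s \<epsilon> N) *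
     (cis (\<epsilon> * ((N * width s \<epsilon> N + \<eta>) / width s \<epsilon> N)) * V ((N * width s \<epsilon> N + \<eta>) / width s \<epsilon> N))"

text \<open>Where the multiplier is nonzero, J \<eta> exceeds m. Of the p + 3 powers of decay, one
  absorbs the multiplier, two remain as decay, and p are traded for m ^ p.\<close>

lemma frequency_tail:
  assumes f: "decay (p + 3) C f" and m: "0 < m" and b: "0 \<le> b"
  shows "decay 2 (b * C / m ^ p) (\<lambda>\<eta>. of_real (b * max 0 (- (m + \<eta>))) * f \<eta>)"
  unfolding decay_def
proof
  fix \<eta>
  have C: "0 \<le> C" by (rule decay_nonneg[OF f])
  show "cmod (of_real (b * max 0 (- (m + \<eta>))) * f \<eta>) \<le> b * C / m ^ p / J \<eta> ^ 2"
  proof (cases "- m \<le> \<eta>")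
    case True
    then show ?thesis using b C m by (simp add: max_def)
  next
    case False
    then have mJ: "m \<le> J \<eta>" and le: "max 0 (- (m + \<eta>)) \<le> J \<eta>" using m by (auto simp: J_def max_def abs_if)
    have "cmod (of_real (b * max 0 (- (m + \<eta>))) * f \<eta>) = b * max 0 (- (m + \<eta>)) * cmod (f \<eta>)"
      using b by (simp add: norm_mult)
    also have "\<dots> \<le> b * J \<eta> * (C / J \<eta> ^ (p + 3))"
      using f le b by (intro mult_mono) (auto simp: decay_def)
    also have "\<dots> = b * C / (J \<eta> ^ p * J \<eta> ^ 2)" by (simp add: power_add field_simps eval_nat_numeral)
    also have "\<dots> \<le> b * C / (m ^ p * J \<eta> ^ 2)"
      using m mJ b C by (intro divide_left_mono mult_right_mono power_mono) auto
    finally show ?thesis by simp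
  qed
qed

text \<open>With \<epsilon> fixed, the time T = 1 / \<epsilon> and all constants of the profile on
  {0..T} are fixed too. Only \<beta> depends on N, and it tends to 0, so the comparison error falls
  below any \<theta>.\<close>

lemma scaled_solution:
  assumes s: "0 < s" "s < 1/2" and \<mu>: "\<mu> \<in> {-1, 1}" and \<epsilon>: "0 < \<epsilon>" and \<theta>: "0 < \<theta>"
    and f: "rapid f" and Z: "jcont Z" "\<And>k. ldecay k Z" "Z 0 = f"
    and Zd: "\<And>t T \<xi>. t \<in> {0..T} \<Longrightarrow> ((\<lambda>t. Z t \<xi>) has_vector_derivative - \<i> * of_real \<mu> * cubic (Z t) \<xi>) (at t within {0..T})"
  shows "\<forall>\<^sub>F N in at_top. \<exists>W. halfwave_flow \<mu> W \<and> W 0 = packet s \<epsilon> N f \<and>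
     (\<forall>\<eta>. cmod (comoving s \<epsilon> N (\<lambda>x. cis (- (\<epsilon> * \<bar>x\<bar>)) * W \<epsilon> x) \<eta> - Z (1 / \<epsilon>) \<eta>) \<le> \<theta> / J \<eta> ^ 2)"
proof -
  define T where "T = 1 / \<epsilon>"
  have T: "0 < T" using \<epsilon> by (simp add: T_def)
  obtain C where C: "\<And>t. \<bar>t\<bar> \<le> T \<Longrightarrow> decay 2 C (Z t)" using ldecayE[OF Z(2)] by metis
  \<comment> \<open>The multiplier has size \<open>N powr (2 * s)\<close> and the tail gains p
    powers of \<open>N powr (1 - 2 * s)\<close>; p is taken so large that the gain wins, which is
    possible exactly because 1 - 2 * s > 0.\<close>
  obtain p :: nat where "2 * s / (1 - 2 * s) < real p" using reals_Archimedean2 by blast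
  then have p: "2 * s - real p * (1 - 2 * s) < 0" using s by (simp add: pos_divide_less_eq)
  obtain D where D: "\<And>t. \<bar>t\<bar> \<le> T \<Longrightarrow> decay (p + 3) D (Z t)" using ldecayE[OF Z(2)] by metis
  define E where "E = T * exp (48 * 4 ^ 2 * (C + 1)\<^sup>2 * T)"
  define \<beta> where "\<beta> N = 2 * N powr (2 * s) * D / (N * width s \<epsilon> N) ^ p" for N
  have \<beta>eq: "\<beta> N = (2 * D / \<epsilon> ^ (2 * p)) * N powr (2 * s - real p * (1 - 2 * s))" if "0 < N" for N
  proof -
    have "(N * width s \<epsilon> N) ^ p = N powr (real p * (1 - 2 * s)) * \<epsilon> ^ (2 * p)"
      unfolding width_facts(2)[OF that \<epsilon>] power_mult_distrib power_mult
      using that by (simp add: powr_powr mult.commute flip: powr_realpow)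
    then show ?thesis unfolding \<beta>_def powr_diff by (simp add: mult_ac)
  qed
  have "((\<lambda>N. (2 * D / \<epsilon> ^ (2 * p)) * N powr (2 * s - real p * (1 - 2 * s)) * E) \<longlongrightarrow> (2 * D / \<epsilon> ^ (2 * p)) * 0 * E) at_top"
    by (intro tendsto_intros tendsto_neg_powr p filterlim_ident)
  moreover have "\<forall>\<^sub>F N in at_top. 2 * D / \<epsilon> ^ (2 * p) * N powr (2 * s - real p * (1 - 2 * s)) * E = \<beta> N * E"
    using eventually_gt_at_top[of 0] by eventually_elim (simp add: \<beta>eq)
  ultimately have "((\<lambda>N. \<beta> N * E) \<longlongrightarrow> 0) at_top" by (simp add: tendsto_cong)
  then have e1: "\<forall>\<^sub>F N in at_top. \<beta> N * E < min 1 \<theta>" using \<theta> by (intro order_tendstoD(2)) auto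
  \<comment> \<open>This quantity is the mass of the packet, as computed below; s > 0 makes it small
    enough for global existence with either sign.\<close>
  have "((\<lambda>N. N powr (- 2 * s) * mass f) \<longlongrightarrow> 0 * mass f) at_top"
    using s by (intro tendsto_intros tendsto_neg_powr filterlim_ident) auto
  then have e2: "\<forall>\<^sub>F N in at_top. N powr (- 2 * s) * mass f < 1 / 8" by (intro order_tendstoD(2)) auto
  show ?thesis
    using e1 e2 eventually_ge_at_top[of 1]
  proof eventually_elim
    fix N :: real assume N1: "\<beta> N * E < min 1 \<theta>" and N2: "N powr (- 2 * s) * mass f < 1 / 8" and N3: "1 \<le> N"
    have N0: "0 < N" using N3 by simp
    define d where "d = width s \<epsilon> N"
    note w = width_facts[OF N0 \<epsilon>, of s, folded d_def]
    define g where "g \<xi> = of_real (d / \<epsilon>) * f (d * \<xi> - N * d)" for \<xi>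
    have g: "rapid g" unfolding g_def by (rule rapid_scale[OF f w(1)])
    have "mass g = (LINT \<xi>|lborel. (\<lambda>\<eta>. (d / \<epsilon>)\<^sup>2 * (cmod (f \<eta>))\<^sup>2) (d * \<xi> - N * d))"
      unfolding mass_def g_def
      by (rule Bochner_Integration.integral_cong) (simp_all add: norm_mult norm_divide power_mult_distrib power_divide)
    also have "\<dots> = (d / \<epsilon>)\<^sup>2 * mass f / d" 
      using LINT_scale[OF w(1), of "\<lambda>\<eta>. (d / \<epsilon>)\<^sup>2 * (cmod (f \<eta>))\<^sup>2" "N * d"] by (simp add: mass_def)
    also have "\<dots> = (d / \<epsilon>\<^sup>2) * mass f" using w(1) by (simp add: power2_eq_square)
    also have "\<dots> = N powr (- 2 * s) * mass f" unfolding w(4) ..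
    finally have "mass g \<le> 1 / 8" using N2 by simp
    then obtain W where W: "halfwave_flow \<mu> W" "W 0 = g"
      using halfwave_flow_exists[OF \<mu>, of g] g by (auto simp: rapid_def)
    obtain n where n: "4 \<le> n" "\<epsilon> \<le> real n"
      by (metis max.cobounded1 max.cobounded2 of_nat_mono order_trans real_arch_simple)
    obtain ww where ww: "halfwave_profile \<mu> (real n) n ww" "\<forall>t\<in>{0..real n}. W t = ww t"
      using W(1) n unfolding halfwave_flow_def by blast
    \<comment> \<open>The time unit is the inverse of \<alpha> = 1 / \<epsilon>^2, the squared
      amplitude, so the profile time 1 / \<epsilon> is the physical time \<epsilon>.\<close>
    have Ta: "T / (1 / \<epsilon>\<^sup>2) = \<epsilon>" using \<epsilon> by (simp add: T_def power2_eq_square)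
    have prof: "halfwave_profile \<mu> (T / (1 / \<epsilon>\<^sup>2)) 4 ww"
      unfolding Ta by (rule halfwave_profile_subset[OF ww(1)]) (use \<epsilon> n in auto)
    define \<Lambda> where "\<Lambda> \<eta> = 2 / (1 / \<epsilon>\<^sup>2 * d) * max 0 (- (N * d + \<eta>))" for \<eta>
    have L2: "2 / (1 / \<epsilon>\<^sup>2 * d) = 2 * N powr (2 * s)" using w(3) by (metis mult.right_neutral times_divide_eq_right)
    have Nd: "0 < N * d" using N0 w(1) by simp
    have "decay 2 (\<beta> N * T * exp (48 * 4 ^ 2 * (C + 1)\<^sup>2 * T))
      (\<lambda>\<eta>. of_real (1 / (d / \<epsilon>)) * (cis (- (T * \<Lambda> \<eta>)) * ww (T / (1 / \<epsilon>\<^sup>2)) ((N * d + \<eta>) / d)) - Z T \<eta>)"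
    proof (rule rescaled_comparison[OF prof _ w(1) _ _ _ _ _ Z(1) Z(2) Zd \<Lambda>_def])
      show "(d / \<epsilon>)\<^sup>2 = 1 / \<epsilon>\<^sup>2 * d\<^sup>2" by (simp add: power_divide)
      show "ww 0 ((N * d + \<eta>) / d) = of_real (d / \<epsilon>) * Z 0 \<eta>" for \<eta>
        using ww(2) W(2) w(1) by (simp add: g_def Z(3))
      show "decay 2 C (Z t)" if "t \<in> {0..T}" for t using that by (intro C) auto
      show "decay 2 (\<beta> N) (\<lambda>\<eta>. of_real (\<Lambda> \<eta>) * Z t \<eta>)" if "t \<in> {0..T}" for t
        unfolding \<Lambda>_def L2 \<beta>_def d_def[symmetric]
        by (rule frequency_tail[OF D Nd]) (use that in auto)
      show "\<beta> N * T * exp (48 * 4 ^ 2 * (C + 1)\<^sup>2 * T) < 1" using N1 by (simp add: E_def mult.assoc)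
    qed (use \<epsilon> T Nd w(1) in auto)
    moreover have "\<beta> N * T * exp (48 * 4 ^ 2 * (C + 1)\<^sup>2 * T) \<le> \<theta>" using N1 by (simp add: E_def mult.assoc)
    ultimately have dec: "decay 2 \<theta> (\<lambda>\<eta>. of_real (1 / (d / \<epsilon>)) * (cis (- (T * \<Lambda> \<eta>)) * ww \<epsilon> ((N * d + \<eta>) / d)) - Z T \<eta>)"
      unfolding Ta using decay_mono[OF _ order_refl] by blast
    have ph: "cis (- (T * \<Lambda> \<eta>)) = cis (\<epsilon> * ((N * d + \<eta>) / d)) * cis (- (\<epsilon> * \<bar>(N * d + \<eta>) / d\<bar>))" for \<eta>
    proof -
      define x where "x = (N * d + \<eta>) / d"
      have "max 0 (- (N * d + \<eta>)) = d * max 0 (- x)" using w(1) by (simp add: x_def max_def field_simps)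
      then have "T * \<Lambda> \<eta> = T * (2 * \<epsilon>\<^sup>2 * max 0 (- x))" using w(1) by (simp add: \<Lambda>_def)
      also have "\<dots> = \<epsilon> * (2 * max 0 (- x))" using \<epsilon> by (simp add: T_def power2_eq_square)
      also have "2 * max 0 (- x) = \<bar>x\<bar> - x" by (simp add: max_def)
      finally have "- (T * \<Lambda> \<eta>) = \<epsilon> * x + - (\<epsilon> * \<bar>x\<bar>)" by (simp add: right_diff_distrib)
      then show ?thesis unfolding x_def[symmetric] by (simp add: cis_mult)
    qed
    have W\<epsilon>: "W \<epsilon> = ww \<epsilon>" using ww(2) \<epsilon> n by auto
    show "\<exists>W. halfwave_flow \<mu> W \<and> W 0 = packet s \<epsilon> N f \<and>
     (\<forall>\<eta>. cmod (comoving s \<epsilon> N (\<lambda>x. cis (- (\<epsilon> * \<bar>x\<bar>)) * W \<epsilon> x) \<eta> - Z (1 / \<epsilon>) \<eta>) \<le> \<theta> / J \<eta> ^ 2)"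
      unfolding comoving_def packet_def[abs_def] d_def[symmetric]
    proof (intro exI[of _ W] conjI allI)
      show "W 0 = (\<lambda>\<xi>. of_real (d / \<epsilon>) * f (d * \<xi> - N * d))" by (simp add: W(2) g_def[abs_def])
      show "cmod (of_real (\<epsilon> / d) * (cis (\<epsilon> * ((N * d + \<eta>) / d)) * (cis (- (\<epsilon> * \<bar>(N * d + \<eta>) / d\<bar>)) * W \<epsilon> ((N * d + \<eta>) / d)))
        - Z (1 / \<epsilon>) \<eta>) \<le> \<theta> / J \<eta> ^ 2" for \<eta>
      proof -
        have inv: "1 / (d / \<epsilon>) = \<epsilon> / d" by simp
        show ?thesis using dec[unfolded decay_def ph, unfolded T_def inv] by (simp only: mult.assoc W\<epsilon>)
      qed
    qed (rule W(1))
  qed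
qed

section \<open>Decoherence\<close>

text \<open>A real profile with explicit image exp (- y^2 / 2) under \<open>invF\<close>, close to 1
  near the origin, where the dephasing is measured.\<close>

definition gauss :: "real \<Rightarrow> complex" where "gauss \<xi> = of_real (std_normal_density \<xi>)"

lemma power_le_fact_exp: "0 \<le> y \<Longrightarrow> y ^ k \<le> fact k * exp y" for y :: real
  using sum_le_suminf[OF summable_exp[of y], of "{k}"] by (simp add: exp_def field_simps)

lemma rapid_gauss: "rapid gauss"
  unfolding rapid_def
proof (intro conjI allI)
  show "continuous_on UNIV gauss"
    unfolding gauss_def[abs_def] normal_density_def by (intro continuous_intros) auto
  fix k
  have "decay k (fact k * exp (3 / 2)) gauss"
    unfolding decay_iff
  proof
    fix x
    have "sqrt (2 * pi) \<ge> 1" using pi_gt3 by simp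
    then have "std_normal_density x \<le> sqrt (2 * pi) * std_normal_density x"
      using mult_right_mono[of 1 "sqrt (2 * pi)" "std_normal_density x"] by (simp add: normal_density_nonneg)
    also have "\<dots> = exp (- x\<^sup>2 / 2)" by (rule std_normal_density_at)
    finally have "cmod (gauss x) \<le> exp (- x\<^sup>2 / 2)" by (simp add: gauss_def normal_density_nonneg)
    then have "J x ^ k * cmod (gauss x) \<le> (fact k * exp (J x)) * exp (- x\<^sup>2 / 2)"
      by (intro mult_mono power_le_fact_exp) auto
    also have "\<dots> = fact k * exp (J x + - x\<^sup>2 / 2)" by (simp only: exp_add mult.assoc)
    also have "\<dots> \<le> fact k * exp (3 / 2)"
    proof -
      have "0 \<le> (\<bar>x\<bar> - 1)\<^sup>2" by simp
      then have "J x + - x\<^sup>2 / 2 \<le> 3 / 2" by (simp add: J_def power2_diff)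
      then show ?thesis by simp
    qed
    finally show "J x ^ k * cmod (gauss x) \<le> fact k * exp (3 / 2)" .
  qed
  then show "\<exists>C. decay k C gauss" by blast
qed

lemma invF_gauss: "invF gauss y = of_real (exp (- y\<^sup>2 / 2))"
  using ft_gaussian[of 1 "- y"] by (simp add: invF_def gauss_def)

lemma rapid_cmult: "rapid f \<Longrightarrow> rapid (\<lambda>\<xi>. a * f \<xi>)"
  using rapid_scale[of f 1 a 0] by simp

lemma invF_cmult: "invF (\<lambda>\<xi>. a * f \<xi>) y = a * invF f y"
  unfolding invF_def by (simp add: mult.left_commute)

text \<open>The frequency spread 1 / width is at most N, so frequencies in the packet are at most 2
  N J \<eta>. As 2 * s \<le> 1, the Sobolev weight is at most 2 \<open>N powr (2 * s)\<close> J
  \<eta>, and the power of N is cancelled by the squared L2 normalisation of the packet.\<close>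

lemma packet_Hs_bound:
  assumes s: "0 < s" "s < 1/2" and \<epsilon>: "0 < \<epsilon>" and N: "1 \<le> N" "1 \<le> N * width s \<epsilon> N" and f: "rapid f"
  shows "Hs_int s (packet s \<epsilon> N f) \<le> 2 * (LINT \<eta>|lborel. J \<eta> * (cmod (f \<eta>))\<^sup>2)"
proof -
  have N0: "0 < N" using N by simp
  define d where "d = width s \<epsilon> N"
  note w = width_facts[OF N0 \<epsilon>, of s, folded d_def]
  obtain A where fA: "continuous_on UNIV f" "decay 2 A f" using f by (auto simp: rapid_def)
  have Fi: "integrable lborel (\<lambda>\<eta>. J \<eta> * (cmod (f \<eta>))\<^sup>2)"
    using integrable_weighted_square[OF fA, of J 1] by simp
  define H where "H \<eta> = 2 * N powr (2 * s) * (d / \<epsilon>)\<^sup>2 * (J \<eta> * (cmod (f \<eta>))\<^sup>2)" for \<eta>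
  have Hi: "integrable lborel (\<lambda>\<xi>. H (- (N * d) + d * \<xi>))"
    unfolding H_def using w(1) by (intro lborel_integrable_real_affine integrable_mult_right Fi) auto
  have "Hs_int s (\<lambda>\<xi>. of_real (d / \<epsilon>) * f (d * \<xi> - N * d)) \<le> (LINT \<xi>|lborel. H (d * \<xi> - N * d))"
    unfolding Hs_int_def
  proof (rule integral_mono)
    show "integrable lborel (\<lambda>\<xi>. jbr \<xi> powr (2 * s) * (cmod (of_real (d / \<epsilon>) * f (d * \<xi> - N * d)))\<^sup>2)"
      by (rule Hs_integrable[OF rapid_scale[OF f w(1)]])
    show "integrable lborel (\<lambda>\<xi>. H (d * \<xi> - N * d))" using Hi by simp
    fix \<xi>
    define \<eta> where "\<eta> = d * \<xi> - N * d"
    have \<xi>: "\<xi> = N + \<eta> / d" using w(1) by (simp add: \<eta>_def field_simps)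
    have "jbr \<xi> \<le> 2 * N * J \<eta>"
    proof -
      have d1: "1 / d \<le> N" using N(2) w(1) by (simp add: d_def[symmetric] divide_le_eq mult.commute)
      have "\<bar>\<xi>\<bar> \<le> N + \<bar>\<eta>\<bar> * (1 / d)" using N0 w(1) abs_triangle_ineq[of N "\<eta> / d"] unfolding \<xi> by (simp add: abs_divide)
      also have "\<dots> \<le> N + \<bar>\<eta>\<bar> * N" using d1 by (intro add_mono mult_left_mono) auto
      finally have "J \<xi> \<le> 1 + N + \<bar>\<eta>\<bar> * N" by (simp add: J_def)
      also have "\<dots> \<le> 2 * N * J \<eta>"
      proof -
        have "0 \<le> N * \<bar>\<eta>\<bar>" using N(1) by simp
        moreover have "2 * N * J \<eta> = 2 * N + 2 * (N * \<bar>\<eta>\<bar>)" by (simp add: J_def algebra_simps)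
        ultimately show ?thesis using N(1) mult.commute[of "\<bar>\<eta>\<bar>" N] by linarith
      qed
      finally show ?thesis using jbr_le_J[of \<xi>] by linarith
    qed
    then have "jbr \<xi> powr (2 * s) \<le> (2 * N * J \<eta>) powr (2 * s)"
      using s jbr_pos[of \<xi>] by (intro powr_mono2) auto
    also have "\<dots> = 2 powr (2 * s) * N powr (2 * s) * J \<eta> powr (2 * s)"
      using N0 by (simp add: powr_mult)
    also have "\<dots> \<le> 2 * N powr (2 * s) * J \<eta>"
    proof -
      have "2 powr (2 * s) \<le> 2 powr 1" "J \<eta> powr (2 * s) \<le> J \<eta> powr 1"
        using s by (intro powr_mono; simp)+
      then show ?thesis by (intro mult_mono) auto
    qed
    finally have "jbr \<xi> powr (2 * s) * (cmod (of_real (d / \<epsilon>) * f \<eta>))\<^sup>2 \<le> 2 * N powr (2 * s) * J \<eta> * (cmod (of_real (d / \<epsilon>) * f \<eta>))\<^sup>2"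
      by (rule mult_right_mono) simp
    moreover have "(cmod (of_real (d / \<epsilon>) * f \<eta>))\<^sup>2 = (d / \<epsilon>)\<^sup>2 * (cmod (f \<eta>))\<^sup>2"
      by (simp add: norm_mult norm_divide power_mult_distrib power_divide)
    ultimately show "jbr \<xi> powr (2 * s) * (cmod (of_real (d / \<epsilon>) * f (d * \<xi> - N * d)))\<^sup>2 \<le> H (d * \<xi> - N * d)"
      unfolding \<eta>_def[symmetric] H_def by (simp only: mult_ac)
  qed
  also have "(LINT \<xi>|lborel. H (d * \<xi> - N * d)) = (2 * N powr (2 * s) * (d / \<epsilon>)\<^sup>2 * (LINT \<eta>|lborel. J \<eta> * (cmod (f \<eta>))\<^sup>2)) / d"
  proof -
    have "(LINT \<eta>|lborel. H \<eta>) = 2 * N powr (2 * s) * (d / \<epsilon>)\<^sup>2 * (LINT \<eta>|lborel. J \<eta> * (cmod (f \<eta>))\<^sup>2)"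
      unfolding H_def by (rule integral_mult_right_zero)
    then show ?thesis unfolding LINT_scale[OF w(1)] by (simp only:)
  qed
  also have "\<dots> = 2 * (N powr (2 * s) * (d / \<epsilon>\<^sup>2)) * (LINT \<eta>|lborel. J \<eta> * (cmod (f \<eta>))\<^sup>2)"
    using w(1) by (simp add: power2_eq_square)
  also have "N powr (2 * s) * (d / \<epsilon>\<^sup>2) = 1" unfolding w(4) w(5) ..
  finally show ?thesis by (simp add: d_def packet_def[abs_def])
qed

text \<open>For \<eta> \<ge> - m / 2 with m = N * width the actual frequency is at least N / 2, so
  the Sobolev weight is at least half of \<open>N powr (2 * s)\<close>. The remaining \<eta> lie in
  the tail of D and cost only a term of order C^2 / m^2.\<close>

lemma packet_Hs_lower_bound:
  assumes s: "0 < s" "s < 1/2" and \<epsilon>: "0 < \<epsilon>" and N: "1 \<le> N" and g: "rapid g"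
    and D: "continuous_on UNIV D" "decay 2 C D" and \<theta>: "0 \<le> \<theta>"
    and le: "\<And>\<eta>. cmod (D \<eta>) - 2 * \<theta> / J \<eta> ^ 2 \<le> \<epsilon> / width s \<epsilon> N * cmod (g ((N * width s \<epsilon> N + \<eta>) / width s \<epsilon> N))"
  shows "(mass D / 2 - 8 * \<theta>\<^sup>2 - 4 * C\<^sup>2 / (N * width s \<epsilon> N)\<^sup>2) / 2 \<le> Hs_int s g"
proof -
  have N0: "0 < N" using N by simp
  define d where "d = width s \<epsilon> N"
  note w = width_facts[OF N0 \<epsilon>, of s, folded d_def]
  define m where "m = N * d"
  have m: "0 < m" using N0 w(1) by (simp add: m_def)
  \<comment> \<open>A single minorant for both regions: the second term accounts for the
    approximation error, the third is at least |D|^2 / 2 for \<eta> < - m / 2, so R is nonpositive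
    there.\<close>
  define R where "R \<eta> = (cmod (D \<eta>))\<^sup>2 / 2 - (4 * \<theta>\<^sup>2) / J \<eta> ^ 2 - (2 * C\<^sup>2 / m\<^sup>2) / J \<eta> ^ 2" for \<eta>
  define F where "F \<xi> = jbr \<xi> powr (2 * s) * (cmod (g \<xi>))\<^sup>2" for \<xi>
  have Fi: "integrable lborel F" unfolding F_def by (rule Hs_integrable[OF g])
  have Di: "integrable lborel (\<lambda>\<eta>. (cmod (D \<eta>))\<^sup>2)" by (rule mass_integrable[OF D])
  have Ri: "integrable lborel R"
    unfolding R_def using Di by (intro Bochner_Integration.integrable_diff integrable_inverse_J2) simp
  have RI: "(LINT \<eta>|lborel. R \<eta>) = mass D / 2 - 8 * \<theta>\<^sup>2 - 4 * C\<^sup>2 / m\<^sup>2"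
  proof -
    have "(LINT \<eta>|lborel. R \<eta>) = (LINT \<eta>|lborel. (cmod (D \<eta>))\<^sup>2 / 2) - (LINT \<eta>|lborel. (4 * \<theta>\<^sup>2) / J \<eta> ^ 2) - (LINT \<eta>|lborel. (2 * C\<^sup>2 / m\<^sup>2) / J \<eta> ^ 2)"
    proof -
      have i1: "integrable lborel (\<lambda>\<eta>. (cmod (D \<eta>))\<^sup>2 / 2)" using Di by simp
      show ?thesis unfolding R_def
        by (subst Bochner_Integration.integral_diff[OF Bochner_Integration.integrable_diff[OF i1 integrable_inverse_J2] integrable_inverse_J2],
            subst Bochner_Integration.integral_diff[OF i1 integrable_inverse_J2]) (rule refl)
    qed
    then show ?thesis unfolding LINT_inverse_J2 by (simp add: mass_def)
  qed
  have point: "((d / \<epsilon>)\<^sup>2 * (N powr (2 * s) / 2)) * R \<eta> \<le> F ((m + \<eta>) / d)" for \<eta>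
  proof (cases "- (m / 2) \<le> \<eta>")
    case True
    let ?x = "(m + \<eta>) / d" and ?e = "2 * \<theta> / J \<eta> ^ 2"
    define b where "b = \<epsilon> / d * cmod (g ?x)"
    have b0: "0 \<le> b" using \<epsilon> w(1) by (simp add: b_def)
    have e0: "0 \<le> ?e" using \<theta> by simp
    have "cmod (D \<eta>) \<le> b + ?e" using le[of \<eta>] by (simp add: b_def m_def d_def)
    \<comment> \<open>The inequality (b + e)^2 \<le> 2 b^2 + 2 e^2 is the source of the factor 1 / 2
      in front of |D|^2.\<close>
    then have "(cmod (D \<eta>))\<^sup>2 \<le> (b + ?e)\<^sup>2" by (rule power_mono) simp
    also have "\<dots> \<le> 2 * b\<^sup>2 + 2 * ?e\<^sup>2" using sum_squares_bound[of b ?e] by (simp add: power2_sum)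
    finally have "(cmod (D \<eta>))\<^sup>2 / 2 - ?e\<^sup>2 \<le> b\<^sup>2" by simp
    moreover have "?e\<^sup>2 \<le> 4 * \<theta>\<^sup>2 / J \<eta> ^ 2"
    proof -
      have "?e\<^sup>2 = 4 * \<theta>\<^sup>2 / J \<eta> ^ 4" by (simp add: power_divide power_mult_distrib)
      also have "\<dots> \<le> 4 * \<theta>\<^sup>2 / J \<eta> ^ 2" by (intro divide_left_mono power_increasing) auto
      finally show ?thesis .
    qed
    moreover have "0 \<le> (2 * C\<^sup>2 / m\<^sup>2) / J \<eta> ^ 2" by simp
    ultimately have Rb: "R \<eta> \<le> b\<^sup>2" unfolding R_def by linarith
    have "m / 2 / d \<le> ?x" using True w(1) by (intro divide_right_mono) auto
    then have "N / 2 \<le> ?x" using w(1) by (simp add: m_def)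
    also have "?x \<le> jbr ?x" unfolding jbr_def by (rule real_le_rsqrt) simp
    finally have "(N / 2) powr (2 * s) \<le> jbr ?x powr (2 * s)" using s N0 by (intro powr_mono2) auto
    moreover have "N powr (2 * s) / 2 \<le> (N / 2) powr (2 * s)"
    proof -
      have "2 powr (2 * s) \<le> 2 powr 1" using s by (intro powr_mono) auto
      then have "N powr (2 * s) / 2 \<le> N powr (2 * s) / 2 powr (2 * s)" by (intro divide_left_mono) auto
      then show ?thesis using N0 by (simp add: powr_divide)
    qed
    ultimately have "N powr (2 * s) / 2 \<le> jbr ?x powr (2 * s)" by linarith
    then have "(N powr (2 * s) / 2) * b\<^sup>2 \<le> jbr ?x powr (2 * s) * b\<^sup>2" by (rule mult_right_mono) simp
    moreover have "(N powr (2 * s) / 2) * R \<eta> \<le> (N powr (2 * s) / 2) * b\<^sup>2" using Rb by (intro mult_left_mono) auto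
    ultimately have "(N powr (2 * s) / 2) * R \<eta> \<le> jbr ?x powr (2 * s) * b\<^sup>2" by linarith
    then have "(d / \<epsilon>)\<^sup>2 * ((N powr (2 * s) / 2) * R \<eta>) \<le> (d / \<epsilon>)\<^sup>2 * (jbr ?x powr (2 * s) * b\<^sup>2)"
      by (rule mult_left_mono) simp
    also have "\<dots> = F ?x * ((d / \<epsilon>) * (\<epsilon> / d))\<^sup>2" unfolding F_def b_def power_mult_distrib by (simp only: mult_ac)
    also have "(d / \<epsilon>) * (\<epsilon> / d) = 1" using \<epsilon> w(1) by simp
    finally show ?thesis by (simp add: mult.assoc)
  next
    case False
    then have mJ: "m / 2 \<le> J \<eta>" by (simp add: J_def)
    have "cmod (D \<eta>) \<le> C / J \<eta> ^ 2" using D(2) by (simp add: decay_def)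
    then have "(cmod (D \<eta>))\<^sup>2 \<le> (C / J \<eta> ^ 2)\<^sup>2" by (rule power_mono) simp
    also have "\<dots> = C\<^sup>2 / (J \<eta> ^ 2 * J \<eta> ^ 2)" by (simp add: power_divide power2_eq_square)
    also have "\<dots> \<le> C\<^sup>2 / ((m / 2) ^ 2 * J \<eta> ^ 2)"
      using m mJ by (intro divide_left_mono mult_right_mono power_mono) auto
    also have "\<dots> = 2 * ((2 * C\<^sup>2 / m\<^sup>2) / J \<eta> ^ 2)" by (simp add: power_divide)
    finally have "(cmod (D \<eta>))\<^sup>2 / 2 \<le> (2 * C\<^sup>2 / m\<^sup>2) / J \<eta> ^ 2" by simp
    moreover have "0 \<le> (4 * \<theta>\<^sup>2) / J \<eta> ^ 2" by simp
    ultimately have "R \<eta> \<le> 0" unfolding R_def by linarith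
    then have "((d / \<epsilon>)\<^sup>2 * (N powr (2 * s) / 2)) * R \<eta> \<le> 0" by (intro mult_nonneg_nonpos) auto
    also have "0 \<le> F ((m + \<eta>) / d)" by (simp add: F_def)
    finally show ?thesis .
  qed
  have "(LINT \<eta>|lborel. ((d / \<epsilon>)\<^sup>2 * (N powr (2 * s) / 2)) * R \<eta>) \<le> (LINT \<eta>|lborel. F ((m + \<eta>) / d))"
  proof (rule integral_mono)
    show "integrable lborel (\<lambda>\<eta>. F ((m + \<eta>) / d))"
      using lborel_integrable_real_affine[OF Fi, of "1 / d" "m / d"] w(1) by (simp add: add_divide_distrib)
  qed (use Ri point in auto)
  also have "(LINT \<eta>|lborel. F ((m + \<eta>) / d)) = d * Hs_int s g"
  proof -
    have "(LINT \<xi>|lborel. F \<xi>) = \<bar>1 / d\<bar> *\<^sub>R (LINT \<eta>|lborel. F (m / d + (1 / d) * \<eta>))"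
      using w(1) by (intro lborel_integral_real_affine) auto
    then show ?thesis using w(1) by (simp add: Hs_int_def F_def[symmetric] add_divide_distrib)
  qed
  finally have le': "(d / \<epsilon>)\<^sup>2 * (N powr (2 * s) / 2) * (LINT \<eta>|lborel. R \<eta>) \<le> d * Hs_int s g"
    by (simp only: integral_mult_right_zero)
  have "(d / \<epsilon>)\<^sup>2 * (N powr (2 * s) / 2) = d * ((N powr (2 * s) * (d / \<epsilon>\<^sup>2)) / 2)" by (simp add: power2_eq_square)
  also have "N powr (2 * s) * (d / \<epsilon>\<^sup>2) = 1" unfolding w(4) w(5) ..
  finally have "d * ((LINT \<eta>|lborel. R \<eta>) / 2) \<le> d * Hs_int s g" using le' by simp
  then have "(LINT \<eta>|lborel. R \<eta>) / 2 \<le> Hs_int s g" using w(1) by (simp only: mult_le_cancel_left_pos)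
  then show ?thesis unfolding RI m_def d_def .
qed

lemma one_minus_cos_1: "0 < 1 - cos (1::real)" "1 - cos (1::real) \<le> 1"
proof -
  have "cos (1::real) < cos 0" by (rule cos_monotone_0_pi) (use pi_gt3 in auto)
  then show "0 < 1 - cos (1::real)" by simp
  have "0 \<le> cos (1::real)" by (rule cos_ge_zero) (use pi_gt3 in auto)
  then show "1 - cos (1::real) \<le> 1" by simp
qed

lemma one_minus_cis_ge:
  assumes "1 \<le> \<bar>a\<bar>" "\<bar>a\<bar> \<le> pi" shows "1 - cos 1 \<le> cmod (1 - cis a)"
proof -
  have "cos \<bar>a\<bar> \<le> cos 1" using assms by (intro cos_monotone_0_pi_le) auto
  then have "1 - cos 1 \<le> 1 - cos a" by (simp add: abs_if split: if_splits)
  also have "\<dots> = Re (1 - cis a)" by simp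
  also have "\<dots> \<le> cmod (1 - cis a)" by (rule complex_Re_le_cmod)
  finally show ?thesis .
qed

text \<open>At time \<open>1 / \<epsilon>\<close> the phases of the two profiles differ by \<open>(2 + \<epsilon>) * exp (- y\<^sup>2)\<close>, which lies
  between 1 and 3 near the origin.\<close>
lemma decoherence:
  assumes \<mu>: "\<mu> \<in> {-1, 1}" and \<epsilon>: "0 < \<epsilon>" "\<epsilon> \<le> (1 - cos 1) / 2"
    and D: "continuous_on UNIV D" "decay 2 C D"
    and DF: "\<And>y. invF D y = cis (- (\<mu> * (cmod (invF gauss y))\<^sup>2 * (1 / \<epsilon>))) * invF gauss y
        - cis (- (\<mu> * (cmod (of_real (1 + \<epsilon>) * invF gauss y))\<^sup>2 * (1 / \<epsilon>))) * (of_real (1 + \<epsilon>) * invF gauss y)"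
  shows "(3 * (1 - cos 1) / 8)\<^sup>2 / (4 * pi) \<le> mass D"
proof -
  define k where "k = 1 - cos (1::real)"
  have k: "0 < k" "k \<le> 1" using one_minus_cos_1 by (simp_all add: k_def)
  have \<epsilon>1: "\<epsilon> \<le> 1" using \<epsilon> k by (simp add: k_def)
  have low: "3 * k / 8 \<le> cmod (invF D y)" if y: "\<bar>y\<bar> \<le> 1 / 4" for y
  proof -
    define \<phi> where "\<phi> = exp (- y\<^sup>2 / 2)"
    \<comment> \<open>On |y| \<le> 1 / 4 the Gaussian is at least 1 - 1 / 32, which keeps the phase
      difference away from 0.\<close>
    have "y\<^sup>2 \<le> (1 / 4)\<^sup>2" using power_mono[OF y, of 2] by simp
    then have "1 - 1 / 32 \<le> 1 + - y\<^sup>2 / 2" by (simp add: power2_eq_square)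
    also have "\<dots> \<le> \<phi>" unfolding \<phi>_def by (rule exp_ge_add_one_self)
    finally have \<phi>: "31 / 32 \<le> \<phi>" by simp
    have \<phi>1: "\<phi> \<le> 1" by (simp add: \<phi>_def)
    define a where "a = - (\<mu> * \<phi>\<^sup>2 * (1 / \<epsilon>))"
    define b where "b = - (\<mu> * ((1 + \<epsilon>)\<^sup>2 * \<phi>\<^sup>2) * (1 / \<epsilon>))"
    have "invF D y = cis a * of_real \<phi> - cis b * of_real ((1 + \<epsilon>) * \<phi>)"
    proof -
      have "cmod (of_real \<phi>) = \<phi>" "cmod (of_real (1 + \<epsilon>) * of_real \<phi>) = (1 + \<epsilon>) * \<phi>"
        using \<epsilon> \<phi> by (simp_all add: norm_mult del: of_real_add)
      then show ?thesis
        unfolding DF invF_gauss \<phi>_def[symmetric] a_def b_def by (simp only: power_mult_distrib of_real_mult)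
    qed
    also have "\<dots> = of_real \<phi> * (cis a - cis b) - of_real (\<epsilon> * \<phi>) * cis b" by (simp add: algebra_simps)
    also have "cmod \<dots> \<ge> cmod (of_real \<phi> * (cis a - cis b)) - cmod (of_real (\<epsilon> * \<phi>) * cis b)"
      by (rule norm_triangle_ineq2)
    also have "cmod (of_real \<phi> * (cis a - cis b)) = \<phi> * cmod (cis a - cis b)" using \<phi> by (simp add: norm_mult)
    also have "cmod (cis a - cis b) = cmod (1 - cis (b - a))"
    proof -
      have "cis a - cis b = cis a * (1 - cis (b - a))" by (simp add: right_diff_distrib cis_mult)
      then show ?thesis by (simp add: norm_mult)
    qed
    also have "cmod (of_real (\<epsilon> * \<phi>) * cis b) = \<epsilon> * \<phi>" using \<phi> \<epsilon> by (simp add: norm_mult)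
    finally have 1: "\<phi> * cmod (1 - cis (b - a)) - \<epsilon> * \<phi> \<le> cmod (invF D y)" .
    \<comment> \<open>From (1 + \<epsilon>)^2 - 1 = \<epsilon> (2 + \<epsilon>): dividing by
      \<epsilon> leaves a phase difference of order one however small \<epsilon> is.\<close>
    have "b - a = - (\<mu> * ((2 + \<epsilon>) * \<phi>\<^sup>2))"
      using \<epsilon> by (simp add: a_def b_def field_simps power2_eq_square)
    then have ab: "\<bar>b - a\<bar> = (2 + \<epsilon>) * \<phi>\<^sup>2" using \<mu> \<epsilon> by (auto simp: abs_mult)
    have "k \<le> cmod (1 - cis (b - a))"
      unfolding k_def
    proof (rule one_minus_cis_ge)
      have "(31 / 32)\<^sup>2 \<le> \<phi>\<^sup>2" using \<phi> by (intro power_mono) auto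
      then have "2 * (31 / 32)\<^sup>2 \<le> (2 + \<epsilon>) * \<phi>\<^sup>2" using \<epsilon> by (intro mult_mono) auto
      then show "1 \<le> \<bar>b - a\<bar>" unfolding ab by (simp add: power2_eq_square)
      have "\<phi>\<^sup>2 \<le> 1" using \<phi> \<phi>1 by (simp add: power_le_one)
      then have "(2 + \<epsilon>) * \<phi>\<^sup>2 \<le> 3 * 1" using \<epsilon>1 \<epsilon> by (intro mult_mono) auto
      then show "\<bar>b - a\<bar> \<le> pi" unfolding ab using pi_gt3 by simp
    qed
    then have "\<phi> * k \<le> \<phi> * cmod (1 - cis (b - a))" using \<phi> by (intro mult_left_mono) auto
    then have "\<phi> * k - \<epsilon> * \<phi> \<le> cmod (invF D y)" using 1 by linarith
    moreover have "3 * k / 8 \<le> \<phi> * k - \<epsilon> * \<phi>"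
    proof -
      \<comment> \<open>The change of amplitude costs \<epsilon> \<phi>, at most half of the gain k
        \<phi>; with \<phi> \<ge> 3 / 4 this leaves (3 / 4) (k / 2) = 3 k / 8.\<close>
      have "k / 2 \<le> k - \<epsilon>" using \<epsilon> by (simp add: k_def)
      then have "(3 / 4) * (k / 2) \<le> \<phi> * (k - \<epsilon>)" using \<phi> k by (intro mult_mono) auto
      then show ?thesis by (simp add: algebra_simps)
    qed
    ultimately show ?thesis by linarith
  qed
  have Di: "integrable lborel D" by (rule decay_integrable(1)[OF continuous_borel[OF D(1)] D(2) order_refl])
  \<comment> \<open>The interval has length 1 / 2, and Plancherel contributes 2 * pi, whence the
    denominator 4 * pi.\<close>
  have "(3 * k / 8)\<^sup>2 / 2 = (LINT y|lborel. (3 * k / 8)\<^sup>2 * indicator {-1/4..1/4::real} y)" by simp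
  also have "\<dots> \<le> (LINT y|lborel. (cmod (invF D y))\<^sup>2)"
  proof (rule integral_mono)
    show "integrable lborel (\<lambda>y. (3 * k / 8)\<^sup>2 * indicator {-1/4..1/4::real} y)"
    proof (intro integrable_mult_right integrable_real_indicator)
      have "emeasure lborel {-1/4..1/4::real} = ennreal (1/4 - (-1/4))" by (rule emeasure_lborel_Icc) simp
      also have "\<dots> < \<infinity>" unfolding infinity_ennreal_def by (rule ennreal_less_top)
      finally show "emeasure lborel {-1/4..1/4::real} < \<infinity>" .
    qed simp
    show "integrable lborel (\<lambda>y. (cmod (invF D y))\<^sup>2)" by (rule invF_bessel(1)[OF Di mass_integrable[OF D]])
    show "(3 * k / 8)\<^sup>2 * indicator {-1/4..1/4} y \<le> (cmod (invF D y))\<^sup>2" for y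
      using low[of y] k by (auto simp: indicator_def abs_le_iff intro!: power_mono)
  qed
  also have "\<dots> = 2 * pi * mass D" using invF_plancherel[OF D] by (simp add: mass_def)
  finally show ?thesis by (simp add: k_def field_simps)
qed

text \<open>The real supremum over {0..T} dominates its members only for a bounded family. Uniform
  decay of both solutions on {0..T} provides the bound.\<close>

lemma Hs_difference_bounded:
  assumes "global_halfwave \<mu> W1" "global_halfwave \<mu> W2"
  shows "bdd_above ((\<lambda>t. Hs_norm \<sigma> (\<lambda>x. global_halfwave.u W1 t x - global_halfwave.u W2 t x)) ` {0..T})"
proof -
  interpret a: global_halfwave \<mu> W1 by fact
  interpret b: global_halfwave \<mu> W2 by fact
  obtain m where m: "\<And>\<xi>. jbr \<xi> powr (2 * \<sigma>) \<le> J \<xi> ^ m" using jbr_weight_le by blast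
  obtain C where C: "\<And>t. \<bar>t\<bar> \<le> T \<Longrightarrow> decay (m + 2) C (a.V t)" using a.V_uniform by blast
  obtain D where D: "\<And>t. \<bar>t\<bar> \<le> T \<Longrightarrow> decay (m + 2) D (b.V t)" using b.V_uniform by blast
  have "Hs_norm \<sigma> (\<lambda>x. a.u t x - b.u t x) \<le> sqrt (2 * pi * (2 * (C + D)\<^sup>2))" if t: "t \<in> {0..T}" for t
  proof -
    have "Hs_int \<sigma> (\<lambda>\<xi>. a.V t \<xi> - b.V t \<xi>) \<le> (LINT \<xi>|lborel. (C + D)\<^sup>2 / J \<xi> ^ 2)"
      unfolding Hs_int_def
      by (intro integral_mono Hs_integrable rapid_diff a.V_rapid b.V_rapid integrable_inverse_J2
          Hs_integrand_le[OF m] decay_diff C D) (use t in auto)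
    then have "Hs_int \<sigma> (\<lambda>\<xi>. a.V t \<xi> - b.V t \<xi>) \<le> 2 * (C + D)\<^sup>2" by simp
    then show ?thesis
      unfolding a.u_def b.u_def Hs_norm_diff[OF a.V_rapid b.V_rapid] by (intro real_sqrt_le_mono mult_left_mono) auto
  qed
  then show ?thesis by (intro bdd_aboveI2)
qed

text \<open>In K the factor 16 * pi is 2 * pi * 2 * 2^2: the transform constant, the constant of
  \<open>packet_Hs_bound\<close>, and the squared relative amplitude 1 + \<epsilon> \<le> 2. The
  number a is the lower bound for the mass of the difference of the two profiles at time 1 /
  \<epsilon>.\<close>

theorem wave_packet_pair:
  assumes s: "0 < s" "s < 1/2" and \<mu>: "\<mu> \<in> {-1, 1}" and \<epsilon>: "0 < \<epsilon>" "\<epsilon> \<le> (1 - cos 1) / 2"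
  defines "K \<equiv> sqrt (16 * pi * (LINT \<eta>|lborel. J \<eta> * (cmod (gauss \<eta>))\<^sup>2))"
    and "a \<equiv> (3 * (1 - cos 1) / 8)\<^sup>2 / (4 * pi)"
  shows "\<exists>u1 u2. half_wave_global_solution \<mu> u1 \<and> half_wave_global_solution \<mu> u2 \<and>
     Hs_norm s (u1 0) \<le> K \<and> Hs_norm s (u2 0) \<le> K \<and> Hs_norm s (\<lambda>x. u1 0 x - u2 0 x) \<le> K * \<epsilon> \<and>
     sqrt (pi * a / 4) \<le> Hs_norm s (\<lambda>x. u1 \<epsilon> x - u2 \<epsilon> x) \<and>
     (\<forall>T. bdd_above ((\<lambda>t. Hs_norm s (\<lambda>x. u1 t x - u2 t x)) ` {0..T}))"
proof -
  define G where "G = (LINT \<eta>|lborel. J \<eta> * (cmod (gauss \<eta>))\<^sup>2)"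
  have G: "0 \<le> G" unfolding G_def by (intro Bochner_Integration.integral_nonneg) auto
  note cos1 = one_minus_cos_1
  have \<epsilon>1: "\<epsilon> \<le> 1" using \<epsilon> cos1 by simp
  have a: "0 < a" using cos1 by (simp add: a_def)
  \<comment> \<open>The approximation loss 8 \<theta>^2 becomes a / 8. With the tail loss also at
    most a / 8, the lower bound is (a / 2 - a / 8 - a / 8) / 2 = a / 8, and 2 * pi * a / 8 = pi * a
    / 4.\<close>
  define \<theta> where "\<theta> = sqrt a / 8"
  have \<theta>: "0 < \<theta>" "8 * \<theta>\<^sup>2 = a / 8" using a by (simp_all add: \<theta>_def power_divide)
  define f2 where "f2 \<xi> = of_real (1 + \<epsilon>) * gauss \<xi>" for \<xi>
  have f2: "rapid f2" unfolding f2_def by (rule rapid_cmult[OF rapid_gauss])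
  obtain Z1 where Z1: "jcont Z1" "\<And>k. ldecay k Z1" "Z1 0 = gauss"
    "\<And>t y. 0 \<le> t \<Longrightarrow> invF (Z1 t) y = cis (- (\<mu> * (cmod (invF gauss y))\<^sup>2 * t)) * invF gauss y"
    "\<And>t T \<xi>. t \<in> {0..T} \<Longrightarrow> ((\<lambda>t. Z1 t \<xi>) has_vector_derivative - \<i> * of_real \<mu> * cubic (Z1 t) \<xi>) (at t within {0..T})"
    using transport_profile_exists[OF rapid_gauss, of \<mu>] by blast
  obtain Z2 where Z2: "jcont Z2" "\<And>k. ldecay k Z2" "Z2 0 = f2"
    "\<And>t y. 0 \<le> t \<Longrightarrow> invF (Z2 t) y = cis (- (\<mu> * (cmod (invF f2 y))\<^sup>2 * t)) * invF f2 y"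
    "\<And>t T \<xi>. t \<in> {0..T} \<Longrightarrow> ((\<lambda>t. Z2 t \<xi>) has_vector_derivative - \<i> * of_real \<mu> * cubic (Z2 t) \<xi>) (at t within {0..T})"
    using transport_profile_exists[OF f2, of \<mu>] by blast
  define D where "D \<eta> = Z1 (1 / \<epsilon>) \<eta> - Z2 (1 / \<epsilon>) \<eta>" for \<eta>
  have rZ: "rapid (Z1 (1 / \<epsilon>))" "rapid (Z2 (1 / \<epsilon>))"
    unfolding rapid_def using jcont_slice(1)[OF Z1(1)] jcont_slice(1)[OF Z2(1)] ldecay_slice[OF Z1(2)] ldecay_slice[OF Z2(2)] by blast+
  have Dr: "rapid D" unfolding D_def by (rule rapid_diff[OF rZ])
  obtain C where Dc: "continuous_on UNIV D" "decay 2 C D" using Dr by (auto simp: rapid_def)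
  have mD: "a \<le> mass D"
    unfolding a_def
  proof (rule decoherence[OF \<mu> \<epsilon> Dc])
    fix y
    have "invF D y = invF (Z1 (1 / \<epsilon>)) y - invF (Z2 (1 / \<epsilon>)) y"
      unfolding D_def[abs_def] invF_diff[OF rZ] ..
    also have "invF f2 = (\<lambda>y. of_real (1 + \<epsilon>) * invF gauss y)" unfolding f2_def[abs_def] by (rule ext) (rule invF_cmult)
    then have "invF (Z2 (1 / \<epsilon>)) y = cis (- (\<mu> * (cmod (of_real (1 + \<epsilon>) * invF gauss y))\<^sup>2 * (1 / \<epsilon>))) * (of_real (1 + \<epsilon>) * invF gauss y)"
      using Z2(4)[of "1 / \<epsilon>" y] \<epsilon> by simp
    also have "invF (Z1 (1 / \<epsilon>)) y = cis (- (\<mu> * (cmod (invF gauss y))\<^sup>2 * (1 / \<epsilon>))) * invF gauss y"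
      using Z1(4)[of "1 / \<epsilon>" y] \<epsilon> by simp
    finally show "invF D y = cis (- (\<mu> * (cmod (invF gauss y))\<^sup>2 * (1 / \<epsilon>))) * invF gauss y
        - cis (- (\<mu> * (cmod (of_real (1 + \<epsilon>) * invF gauss y))\<^sup>2 * (1 / \<epsilon>))) * (of_real (1 + \<epsilon>) * invF gauss y)" .
  qed
  \<comment> \<open>Once N * width \<ge> M, its square is at least 32 C^2 / a, which makes the tail
    loss 4 C^2 / (N * width)^2 at most a / 8; the 1 is for \<open>packet_Hs_bound\<close>.\<close>
  define M where "M = max 1 (32 * C\<^sup>2 / a)"
  have "filterlim (\<lambda>N. N powr (1 - 2 * s) * \<epsilon>\<^sup>2) at_top at_top"
    using s \<epsilon> by real_asymp
  then have e3: "\<forall>\<^sub>F N in at_top. M \<le> N powr (1 - 2 * s) * \<epsilon>\<^sup>2" by (simp add: filterlim_at_top)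
  \<comment> \<open>Both solutions must use the same frequency N, so all conditions are collected as
    eventual ones and met at once.\<close>
  obtain N where N: "1 \<le> N" "M \<le> N powr (1 - 2 * s) * \<epsilon>\<^sup>2"
    and "\<exists>W. halfwave_flow \<mu> W \<and> W 0 = packet s \<epsilon> N gauss \<and>
     (\<forall>\<eta>. cmod (comoving s \<epsilon> N (\<lambda>x. cis (- (\<epsilon> * \<bar>x\<bar>)) * W \<epsilon> x) \<eta> - Z1 (1 / \<epsilon>) \<eta>) \<le> \<theta> / J \<eta> ^ 2)"
    and "\<exists>W. halfwave_flow \<mu> W \<and> W 0 = packet s \<epsilon> N f2 \<and>
     (\<forall>\<eta>. cmod (comoving s \<epsilon> N (\<lambda>x. cis (- (\<epsilon> * \<bar>x\<bar>)) * W \<epsilon> x) \<eta> - Z2 (1 / \<epsilon>) \<eta>) \<le> \<theta> / J \<eta> ^ 2)"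
    using eventually_happens'[OF _ eventually_conj[OF eventually_conj[OF eventually_ge_at_top[of 1] e3]
        eventually_conj[OF scaled_solution[OF s \<mu> \<epsilon>(1) \<theta>(1) rapid_gauss Z1(1,2,3,5)] scaled_solution[OF s \<mu> \<epsilon>(1) \<theta>(1) f2 Z2(1,2,3,5)]]]]
    by auto
  then obtain W1 W2 where W1: "halfwave_flow \<mu> W1"
      "W1 0 = packet s \<epsilon> N gauss"
      "\<And>\<eta>. cmod (comoving s \<epsilon> N (\<lambda>x. cis (- (\<epsilon> * \<bar>x\<bar>)) * W1 \<epsilon> x) \<eta> - Z1 (1 / \<epsilon>) \<eta>) \<le> \<theta> / J \<eta> ^ 2"
    and W2: "halfwave_flow \<mu> W2"
      "W2 0 = packet s \<epsilon> N f2"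
      "\<And>\<eta>. cmod (comoving s \<epsilon> N (\<lambda>x. cis (- (\<epsilon> * \<bar>x\<bar>)) * W2 \<epsilon> x) \<eta> - Z2 (1 / \<epsilon>) \<eta>) \<le> \<theta> / J \<eta> ^ 2"
    by blast
  define d where "d = width s \<epsilon> N"
  have N0: "0 < N" using N by simp
  note w = width_facts[OF N0 \<epsilon>(1), of s, folded d_def]
  have Nd: "M \<le> N * d" using N(2) w(2) by simp
  \<comment> \<open>The packets are real on the Fourier side because the Gaussian is, as the
    reflection to negative times demands.\<close>
  have g1: "global_halfwave \<mu> W1"
    by unfold_locales (simp_all add: W1 packet_def gauss_def)
  have g2: "global_halfwave \<mu> W2"
    by unfold_locales (simp_all add: W2 packet_def f2_def gauss_def)
  interpret p: global_halfwave \<mu> W1 by (rule g1)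
  interpret q: global_halfwave \<mu> W2 by (rule g2)
  have u0: "p.u 0 = invF (p.V 0)" "q.u 0 = invF (q.V 0)" by (auto simp: p.u_def q.u_def fun_eq_iff)
  have Nd1: "1 \<le> N * width s \<epsilon> N" using Nd by (simp add: M_def d_def)
  note packet = packet_Hs_bound[OF s \<epsilon>(1) N(1) Nd1]
  have scaleG: "(LINT \<eta>|lborel. J \<eta> * (cmod (of_real r * gauss \<eta>))\<^sup>2) = r\<^sup>2 * G" for r
    by (simp add: norm_mult power_mult_distrib G_def mult.left_commute[of "J _"])
  have K: "K = sqrt (2 * pi * (8 * G))" by (simp add: K_def G_def)
  have b1: "Hs_norm s (p.u 0) \<le> K"
  proof -
    have "Hs_int s (p.V 0) \<le> 2 * G" unfolding p.V0 W1(2) G_def by (rule packet[OF rapid_gauss])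
    then have "Hs_int s (p.V 0) \<le> 8 * G" using G by simp
    then show ?thesis unfolding u0 Hs_norm_invF[OF p.V_rapid] K by (intro real_sqrt_le_mono mult_left_mono) auto
  qed
  have b2: "Hs_norm s (q.u 0) \<le> K"
  proof -
    have "Hs_int s (q.V 0) \<le> 2 * (LINT \<eta>|lborel. J \<eta> * (cmod (f2 \<eta>))\<^sup>2)"
      unfolding q.V0 W2(2) by (rule packet[OF f2])
    also have "\<dots> = 2 * ((1 + \<epsilon>)\<^sup>2 * G)" unfolding f2_def scaleG ..
    also have "\<dots> \<le> 2 * (2\<^sup>2 * G)"
      using \<epsilon> \<epsilon>1 G by (intro mult_left_mono mult_right_mono power_mono) auto
    finally have "Hs_int s (q.V 0) \<le> 8 * G" by simp
    then show ?thesis unfolding u0 Hs_norm_invF[OF q.V_rapid] K by (intro real_sqrt_le_mono mult_left_mono) auto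
  qed
  have b3: "Hs_norm s (\<lambda>x. p.u 0 x - q.u 0 x) \<le> K * \<epsilon>"
  proof -
    \<comment> \<open>The initial difference is itself a packet with profile - \<epsilon> times the
      Gaussian, so the same upper bound yields the factor \<epsilon>.\<close>
    have "p.V 0 \<xi> - q.V 0 \<xi> = packet s \<epsilon> N (\<lambda>\<xi>. of_real (- \<epsilon>) * gauss \<xi>) \<xi>" for \<xi>
      unfolding p.V0 q.V0 W1(2) W2(2) packet_def f2_def by (simp add: algebra_simps)
    then have "Hs_int s (\<lambda>\<xi>. p.V 0 \<xi> - q.V 0 \<xi>) \<le> 2 * ((- \<epsilon>)\<^sup>2 * G)"
      using packet[OF rapid_cmult[OF rapid_gauss, of "of_real (- \<epsilon>)"]] unfolding scaleG by simp
    also have "\<dots> \<le> (8 * G) * \<epsilon>\<^sup>2" using G by (simp add: mult_right_mono)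
    finally have "Hs_norm s (\<lambda>x. p.u 0 x - q.u 0 x) \<le> sqrt (2 * pi * ((8 * G) * \<epsilon>\<^sup>2))"
      unfolding u0 Hs_norm_diff[OF p.V_rapid q.V_rapid] by (intro real_sqrt_le_mono mult_left_mono) auto
    also have "\<dots> = K * \<epsilon>" using \<epsilon> by (simp add: K real_sqrt_mult)
    finally show ?thesis .
  qed
  have b4: "sqrt (pi * a / 4) \<le> Hs_norm s (\<lambda>x. p.u \<epsilon> x - q.u \<epsilon> x)"
  proof -
    define g where "g \<xi> = p.V \<epsilon> \<xi> - q.V \<epsilon> \<xi>" for \<xi>
    have g: "rapid g" unfolding g_def by (rule rapid_diff[OF p.V_rapid q.V_rapid])
    have "(mass D / 2 - 8 * \<theta>\<^sup>2 - 4 * C\<^sup>2 / (N * width s \<epsilon> N)\<^sup>2) / 2 \<le> Hs_int s g"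
    proof (rule packet_Hs_lower_bound[OF s \<epsilon>(1) N(1) g Dc])
      fix \<eta>
      define x where "x = (N * d + \<eta>) / d"
      define A where "A V = of_real (\<epsilon> / d) * (cis (\<epsilon> * x) * V)" for V :: complex
      have V: "p.V \<epsilon> x = cis (- (\<epsilon> * \<bar>x\<bar>)) * W1 \<epsilon> x" "q.V \<epsilon> x = cis (- (\<epsilon> * \<bar>x\<bar>)) * W2 \<epsilon> x"
        using \<epsilon> by (simp_all add: p.V_def p.Vp_def q.V_def q.Vp_def)
      have 1: "cmod (A (p.V \<epsilon> x) - Z1 (1 / \<epsilon>) \<eta>) \<le> \<theta> / J \<eta> ^ 2" "cmod (A (q.V \<epsilon> x) - Z2 (1 / \<epsilon>) \<eta>) \<le> \<theta> / J \<eta> ^ 2"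
        using W1(3)[of \<eta>, unfolded comoving_def, folded d_def, folded x_def] W2(3)[of \<eta>, unfolded comoving_def, folded d_def, folded x_def] unfolding A_def V by auto
      have "D \<eta> = (A (p.V \<epsilon> x) - A (q.V \<epsilon> x)) - ((A (p.V \<epsilon> x) - Z1 (1 / \<epsilon>) \<eta>) - (A (q.V \<epsilon> x) - Z2 (1 / \<epsilon>) \<eta>))"
        by (simp add: D_def)
      also have "cmod \<dots> \<le> cmod (A (p.V \<epsilon> x) - A (q.V \<epsilon> x)) + (cmod (A (p.V \<epsilon> x) - Z1 (1 / \<epsilon>) \<eta>) + cmod (A (q.V \<epsilon> x) - Z2 (1 / \<epsilon>) \<eta>))"
        by (intro order_trans[OF norm_triangle_ineq4] add_mono order_refl norm_triangle_ineq4)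
      also have "A (p.V \<epsilon> x) - A (q.V \<epsilon> x) = A (g x)" by (simp only: A_def g_def right_diff_distrib)
      also have "cmod (A (g x)) = \<epsilon> / d * cmod (g x)" using \<epsilon> w(1) by (simp add: A_def norm_mult norm_divide)
      finally have "cmod (D \<eta>) \<le> \<epsilon> / d * cmod (g x) + (\<theta> / J \<eta> ^ 2 + \<theta> / J \<eta> ^ 2)" using 1 by linarith
      moreover have "2 * \<theta> / J \<eta> ^ 2 = \<theta> / J \<eta> ^ 2 + \<theta> / J \<eta> ^ 2" by simp
      ultimately show "cmod (D \<eta>) - 2 * \<theta> / J \<eta> ^ 2 \<le> \<epsilon> / width s \<epsilon> N * cmod (g ((N * width s \<epsilon> N + \<eta>) / width s \<epsilon> N))"
        unfolding d_def[symmetric] x_def[symmetric] by linarith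
    qed (use \<theta> in auto)
    moreover have "4 * C\<^sup>2 / (N * width s \<epsilon> N)\<^sup>2 \<le> a / 8"
    proof -
      have m: "1 \<le> N * d" "32 * C\<^sup>2 / a \<le> N * d" using Nd by (auto simp: M_def)
      have "N * d \<le> (N * d)\<^sup>2" using m(1) by (rule self_le_power) simp
      then have "32 * C\<^sup>2 / a \<le> (N * d)\<^sup>2" using m(2) by linarith
      then have "32 * C\<^sup>2 \<le> a * (N * d)\<^sup>2" using a by (simp only: pos_divide_le_eq mult.commute)
      moreover have "0 < (N * d)\<^sup>2" using m(1) by (intro zero_less_power) linarith
      ultimately show ?thesis unfolding d_def[symmetric] by (simp only: pos_divide_le_eq)
    qed
    moreover have "a / 8 \<le> h" if "(m / 2 - t - x) / 2 \<le> h" "x \<le> a / 8" "a \<le> m" "t = a / 8" for h m t x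
      using that by (simp add: field_simps)
    ultimately have "a / 8 \<le> Hs_int s g" using mD \<theta>(2) by blast
    then have "2 * pi * (a / 8) \<le> 2 * pi * Hs_int s g" by (intro mult_left_mono) auto
    then show ?thesis
      unfolding p.u_def q.u_def Hs_norm_diff[OF p.V_rapid q.V_rapid] g_def[symmetric] by (intro real_sqrt_le_mono) simp
  qed
  show ?thesis
    by (intro exI[of _ p.u] exI[of _ q.u] conjI allI p.global_solution q.global_solution b1 b2 b3 b4
        Hs_difference_bounded[OF g1 g2])
qed

lemma Hs_norm_nonneg: "0 \<le> Hs_norm s f"
  by (simp add: Hs_norm_def)

theorem theorem1p2:
  fixes s \<mu> :: real
  assumes "0 < s" "s < 1/2" "\<mu> \<in> {-1, 1}"
  shows "\<exists>\<epsilon>0>0. \<exists>C>0. \<exists>c>0. \<exists>u1 u2 :: real \<Rightarrow> real \<Rightarrow> real \<Rightarrow> complex.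
     (\<forall>\<epsilon>\<in>{0<..<\<epsilon>0}.
        half_wave_global_solution \<mu> (u1 \<epsilon>) \<and> half_wave_global_solution \<mu> (u2 \<epsilon>) \<and>
        Hs_norm s (u1 \<epsilon> 0) \<le> C \<and> Hs_norm s (u2 \<epsilon> 0) \<le> C) \<and>
     ((\<lambda>\<epsilon>. Hs_norm s (\<lambda>x. u1 \<epsilon> 0 x - u2 \<epsilon> 0 x)) \<longlongrightarrow> 0) (at_right 0) \<and>
     (\<forall>T>0. Liminf (at_right 0)
        (\<lambda>\<epsilon>. ereal (SUP t\<in>{0..T}. Hs_norm s (\<lambda>x. u1 \<epsilon> t x - u2 \<epsilon> t x))) \<ge> ereal c)"
proof -
  define \<epsilon>0 :: real where "\<epsilon>0 = (1 - cos 1) / 2"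
  define K where "K = sqrt (16 * pi * (LINT \<eta>|lborel. J \<eta> * (cmod (gauss \<eta>))\<^sup>2))"
  define c where "c = sqrt (pi * ((3 * (1 - cos 1) / 8)\<^sup>2 / (4 * pi)) / 4)"
  have \<epsilon>0: "0 < \<epsilon>0" and c: "0 < c" using one_minus_cos_1 by (simp_all add: \<epsilon>0_def c_def)
  define P where "P \<epsilon> u1 u2 \<longleftrightarrow> half_wave_global_solution \<mu> u1 \<and> half_wave_global_solution \<mu> u2 \<and>
     Hs_norm s (u1 0) \<le> K \<and> Hs_norm s (u2 0) \<le> K \<and> Hs_norm s (\<lambda>x. u1 0 x - u2 0 x) \<le> K * \<epsilon> \<and>
     c \<le> Hs_norm s (\<lambda>x. u1 \<epsilon> x - u2 \<epsilon> x) \<and>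
     (\<forall>T. bdd_above ((\<lambda>t. Hs_norm s (\<lambda>x. u1 t x - u2 t x)) ` {0..T}))" for \<epsilon> u1 u2
  have "\<exists>u1 u2. P \<epsilon> u1 u2" if "0 < \<epsilon>" "\<epsilon> < \<epsilon>0" for \<epsilon>
    using wave_packet_pair[OF assms, of \<epsilon>] that unfolding P_def \<epsilon>0_def K_def c_def by simp
  then obtain u1 u2 where P: "\<And>\<epsilon>. 0 < \<epsilon> \<Longrightarrow> \<epsilon> < \<epsilon>0 \<Longrightarrow> P \<epsilon> (u1 \<epsilon>) (u2 \<epsilon>)" by metis
  note u = P[unfolded P_def]
  have small: "\<forall>\<^sub>F \<epsilon> in at_right 0. 0 < \<epsilon> \<and> \<epsilon> < b" if "0 < b" for b :: real
    using eventually_at_right_less[of 0] eventually_at_right_real[OF that] by eventually_elim auto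
  \<comment> \<open>K is only known to be nonnegative here, while a strictly positive constant is
    required.\<close>
  have K1: "0 < K + 1" by (simp add: K_def add_nonneg_pos Bochner_Integration.integral_nonneg)
  show ?thesis
  proof (rule exI[of _ \<epsilon>0], rule conjI[OF \<epsilon>0], rule exI[of _ "K + 1"], rule conjI[OF K1], rule exI[of _ c],
      rule conjI[OF c], rule exI[of _ u1], rule exI[of _ u2], intro conjI ballI allI impI)
    show "((\<lambda>\<epsilon>. Hs_norm s (\<lambda>x. u1 \<epsilon> 0 x - u2 \<epsilon> 0 x)) \<longlongrightarrow> 0) (at_right 0)"
    proof (rule tendsto_sandwich[OF _ _ tendsto_const])
      show "\<forall>\<^sub>F \<epsilon> in at_right 0. Hs_norm s (\<lambda>x. u1 \<epsilon> 0 x - u2 \<epsilon> 0 x) \<le> K * \<epsilon>"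
        using small[OF \<epsilon>0] by eventually_elim (use u in blast)
      have "((\<lambda>\<epsilon>. K * \<epsilon>) \<longlongrightarrow> K * 0) (at_right 0)" by (intro tendsto_intros)
      then show "((\<lambda>\<epsilon>. K * \<epsilon>) \<longlongrightarrow> 0) (at_right 0)" by simp
    qed (simp add: Hs_norm_nonneg)
    fix T :: real assume T: "0 < T"
    show "ereal c \<le> Liminf (at_right 0) (\<lambda>\<epsilon>. ereal (SUP t\<in>{0..T}. Hs_norm s (\<lambda>x. u1 \<epsilon> t x - u2 \<epsilon> t x)))"
    proof (rule Liminf_bounded)
      show "\<forall>\<^sub>F \<epsilon> in at_right 0. ereal c \<le> ereal (SUP t\<in>{0..T}. Hs_norm s (\<lambda>x. u1 \<epsilon> t x - u2 \<epsilon> t x))"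
        using small[OF \<epsilon>0] small[OF T]
      proof eventually_elim
        fix \<epsilon> :: real assume e: "0 < \<epsilon> \<and> \<epsilon> < \<epsilon>0" "0 < \<epsilon> \<and> \<epsilon> < T"
        \<comment> \<open>The separation is seen at time \<epsilon>, which lies in {0..T} as soon as
          \<epsilon> < T; hence a constant c independent of T.\<close>
        have "Hs_norm s (\<lambda>x. u1 \<epsilon> \<epsilon> x - u2 \<epsilon> \<epsilon> x) \<le> (SUP t\<in>{0..T}. Hs_norm s (\<lambda>x. u1 \<epsilon> t x - u2 \<epsilon> t x))"
          by (rule cSUP_upper) (use e u[of \<epsilon>] in auto)
        moreover have "c \<le> Hs_norm s (\<lambda>x. u1 \<epsilon> \<epsilon> x - u2 \<epsilon> \<epsilon> x)" using u[of \<epsilon>] e by simp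
        ultimately show "ereal c \<le> ereal (SUP t\<in>{0..T}. Hs_norm s (\<lambda>x. u1 \<epsilon> t x - u2 \<epsilon> t x))" by simp
      qed
    qed
  next
    fix \<epsilon> assume "\<epsilon> \<in> {0<..<\<epsilon>0}"
    then have "0 < \<epsilon>" "\<epsilon> < \<epsilon>0" by auto
    from u[OF this] show "half_wave_global_solution \<mu> (u1 \<epsilon>)" "half_wave_global_solution \<mu> (u2 \<epsilon>)"
      "Hs_norm s (u1 \<epsilon> 0) \<le> K + 1" "Hs_norm s (u2 \<epsilon> 0) \<le> K + 1" by auto
  qed
qed

end
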